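(* Let $d\in\mathbb N$, $\mathcal A\subseteq\mathbb R$, $\Omega:=\mathcal A^{\mathbb Z^d}$ and let $(\Omega,\mathcal B(\Omega),\mathbb P)$ be a probability space such that $\mathbb P$ satisfies the properties (M1), (M2), (M3) (listed in the context) with correlation length $r\in\mathbb N_0$. Let $\Lambda_n:=[0,n)^d\cap\mathbb Z^d$ for $n\in\mathbb N$. Let $K,D,D'>0$ and $r'\in\mathbb N$. Then there exists a set $\tilde\Omega\in\mathcal B(\Omega)$ with $\mathbb P(\tilde\Omega)=1$ such that, for all $m,n\in\mathbb N$ with $n>2m>4r$ and all $\omega\in\tilde\Omega$, $$\sup_{f\in\mathcal U_{K,D,D',r'}}\Bigl\lVert\frac{f(\Lambda_n,\omega)}{|\Lambda_n|}-f^*\Bigr\rVert\le2^{2d+1}\Bigl(\frac{(2K+D)m^d+D'{r'}^d}{n-2m}+\frac{2(K+D)r^d+3D'{r'}^d}{m-2r}\Bigr)+\sup_{f\in\mathcal U_{K,D,D',r'}}\frac{\bigl\lVert\langle f_{\Lambda_m^r},L_{m,n}^{r,\omega}-\mathbb P_{\Lambda_m^r}\rangle\bigr\rVert}{|\Lambda_m|},$$ where $f^*\in\mathbb B$ is the almost sure limit of $f(\Lambda_n,\cdot)/|\Lambda_n|$ (see context). Furthermore, for all $m\in\mathbb N$ and $\omega\in\tilde\Omega$, $$\lim_{n\to\infty}\sup_{f\in\mathcal U_{K,D,D',r'}}\bigl\lVert\langle f_{\Lambda_m^r},L_{m,n}^{r,\omega}-\mathbb P_{\Lambda_m^r}\rangle\bigr\rVert=0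 .$$ Moreover, for each $m\in\mathbb N$ and each $\epsilon>0$ there exist $a=a(\epsilon,m,K)>0$ and $b=b(\epsilon,m,K)\in\mathbb R$ such that for all $n\in\mathbb N$ with $n\ge m$ there is a measurable set $\Omega(\epsilon,n)$ with $\mathbb P(\Omega(\epsilon,n))\ge1-b\exp(-a\lfloor n/m\rfloor^d)$ and $$\sup_{f\in\mathcal U_{K,D,D',r'}}\bigl\lVert\langle f_{\Lambda_m^r},L_{m,n}^{r,\omega}-\mathbb P_{\Lambda_m^r}\rangle\bigr\rVert\le\epsilon\quad\text{for all }\omega\in\Omega(\epsilon,n).$$
   Context: Geometry: $\mathcal F$ is the set of all finite subsets of $\mathbb Z^d$; $|\Lambda|$ is the cardinality of $\Lambda\in\mathcal F$; $\mathfrak d(x,y):=\|x-y\|_1$, $\mathfrak d(\Lambda_1,\Lambda_2):=\min\{\mathfrak d(x,y):x\in\Lambda_1,y\in\Lambda_2\}$, $\mathfrak d(x,\Lambda):=\mathfrak d(\{x\},\Lambda)$; $\Lambda+z:=\{x+z: x\in\Lambda\}$. A cube of side length $n$ is a set $([0,n)^d\cap\mathbb Z^d)+z$, $z\in\mathbb Z^d$. For $r\in\mathbb N_0$, $\partial^r(\Lambda):=\{x\in\Lambda:\mathfrak d(x,\mathbb Z^d\setminus\Lambda)\le r\}\cup\{x\in\mathbb Z^d\setminus\Lambda:\mathfrak d(x,\Lambda)\le r\}$ and $\Lambda^r:=\Lambda\setminus\partial^r(\Lambda)$; $\Lambda_m^r:=(\Lambda_m)^r$. Colorings: $\mathcal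 A$ carries the Borel $\sigma$-algebra $\mathcal B(\mathcal A)$ inherited from $\mathbb R$, and $\mathcal B(\Omega)$ is the product $\sigma$-algebra. For $z\in\mathbb Z^d$, $\tau_z\colon\Omega\to\Omega$, $(\tau_z\omega)_x:=\omega_{x+z}$. For $\Lambda\in\mathcal F$, $\Omega_\Lambda:=\mathcal A^\Lambda$ with product $\sigma$-algebra, $\Pi_\Lambda\colon\Omega\to\Omega_\Lambda$, $\Pi_\Lambda(\omega):=\omega_\Lambda:=(\omega_z)_{z\in\Lambda}$. Assumptions on $\mathbb P$: (M1) $\mathbb P\circ\tau_z^{-1}=\mathbb P$ for all $z\in\mathbb Z^d$. (M2) There are $\sigma$-finite measures $\mu_z$, $z\in\mathbb Z^d$, on $(\mathcal A,\mathcal B(\mathcal A))$ such that for each $\Lambda\in\mathcal F$ the marginal $\mathbb P_\Lambda:=\mathbb P\circ\Pi_\Lambda^{-1}$ is absolutely continuous with respect to $\mu_\Lambda:=\bigotimes_{z\in\Lambda}\mu_z$, with density $\rho_\Lambda:=d\mathbb P_\Lambda/d\mu_\Lambda$. (M3) There is $r\ge0$ (the correlation length) such that for all $n\in\mathbb N$ and non-empty $\Lambda_1,\dots,\Lambda_n\in\mathcal F$ with $\min\{\mathfrak d(\Lambda_i,\Lambda_j): i\ne j\}>r$ one has $\rho_\Lambda=\prod_{j=1}^n\rho_{\Lambda_j}$ ($\mu_\Lambda$-a.e., where $\rho_{\Lambda_j}$ is evaluated at $\omega_{\Lambda_j}$), $\Lambda=\bigcup_j\Lambda_j$. $\mathbb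 B:=\{F\colon\mathbb R\to\mathbb R\mid F\text{ right-continuous and bounded}\}$ with the supremum norm $\|\cdot\|$. A function $f\colon\mathcal F\times\Omega\to\mathbb B$ is admissible if: (i) $f(\Lambda+z,\omega)=f(\Lambda,\tau_z\omega)$ for all $\Lambda\in\mathcal F$, $z\in\mathbb Z^d$, $\omega\in\Omega$; (ii) $f(\Lambda,\omega)=f(\Lambda,\omega')$ whenever $\Lambda\in\mathcal F$ and $\Pi_\Lambda(\omega)=\Pi_\Lambda(\omega')$; (iii) there is $b_f\colon\mathcal F\to[0,\infty)$ such that for all $\omega\in\Omega$ and pairwise disjoint $\Lambda_1,\dots,\Lambda_n\in\mathcal F$ with union $\Lambda$, $\|f(\Lambda,\omega)-\sum_{i=1}^nf(\Lambda_i,\omega)\|\le\sum_{i=1}^nb_f(\Lambda_i)$, where $b_f(\Lambda+z)=b_f(\Lambda)$ for all $\Lambda\in\mathcal F,z\in\mathbb Z^d$; there is $D_f>0$ with $b_f(\Lambda)\le D_f|\Lambda|$ for all $\Lambda\in\mathcal F$; and $b_f(\Lambda_i)/|\Lambda_i|\to0$ for every sequence $(\Lambda_i)$ of cubes with strictly increasing side length; (iv) there is $s\in\{-1,1\}^{\mathbb Z^d}$ such that for all $\Lambda\in\mathcal F$, $\omega,\omega'\in\Omega$, $z\in\Lambda$, $E\in\mathbb R$ with $\omega_{\Lambda\setminus\{z\}}=\omega'_{\Lambda\setminus\{z\}}$ and $\omega_z\le\omega'_z$: $f(\Lambda,\omega)(E)\le f(\Lambda,\omega')(E)$ if $s(z)=1$,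 and $f(\Lambda,\omega)(E)\ge f(\Lambda,\omega')(E)$ if $s(z)=-1$; (v) $\sup_{\omega\in\Omega}\|f(\{0\},\omega)\|<\infty$. For admissible $f$, $K_f:=\sup\{\|f(\Lambda,\omega)\|/|\Lambda| : \omega\in\Omega,\ \Lambda\in\mathcal F\setminus\{\emptyset\}\}<\infty$. The function $b_f$ is called a proper boundary term if in addition there are $r'_f\in\mathbb N$, $D'_f>0$ with $b_f(\Lambda)\le D'_f|\partial^{r'_f}\Lambda|$ for all cubes $\Lambda$. $\mathcal U_{K,D,D',r'}$ is the set of admissible $f$ (having a proper boundary term $b_f$) with $K_f\le K$, $D_f\le D$, $D'_f\le D'$, $r'_f\le r'$. Under the present assumptions, for every admissible $f$ there is a unique $f^*\in\mathbb B$ with $\lim_{n\to\infty}\|f(\Lambda_n,\omega)/|\Lambda_n|-f^*\|=0$ for all $\omega$ in a measurable set of full $\mathbb P$-measure; this is the $f^*$ in the claim. For $\Lambda\in\mathcal F$, $f_\Lambda\colon\Omega_\Lambda\to\mathbb B$ is defined by $f_\Lambda(\omega_\Lambda):=f(\Lambda,\omega)$ (well-defined by (ii)). For $n\ge m$, $T_{m,n}:=\{t\in m\mathbb Z^d:\Lambda_m+t\subseteq\Lambda_n\}$ (so $|T_{m,n}|=\lfloor n/m\rfloor^d$), and $L_{m,n}^{r,\omega}:=\frac1{|T_{m,n}|}\sum_{t\in T_{m,n}}\delta_{(\tau_t\omega)_{\Lambda_m^r}}$ is the empirical probability measure on $\Omega_{\Lambda_m^r}$. For a measure $\nu$ on $\Omega_\Lambda$,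 $\langle g,\nu\rangle:=\int_{\Omega_\Lambda}g(\omega)\,d\nu(\omega)\in\mathbb B$, the integral being taken pointwise, $\langle g,\nu\rangle(E)=\int g(\omega)(E)\,d\nu(\omega)$ (with respect to the completion of $\nu$), and $\langle g,\nu_1-\nu_2\rangle:=\langle g,\nu_1\rangle-\langle g,\nu_2\rangle$. *)

theory Defs
  imports "HOL-Probability.Probability" "HOL-Library.Extended_Nat"
begin

section \<open>Geometry of the lattice\<close>

text \<open>The lattice \<open>\<int>\<^sup>d\<close> is the type \<open>int ^ 'd\<close>, with \<open>d = CARD('d) \<ge> 1\<close>.\<close>

definition ldist :: "int ^ 'd \<Rightarrow> int ^ 'd \<Rightarrow> nat" where
  "ldist x y = nat (\<Sum>i\<in>UNIV. \<bar>x $ i - y $ i\<bar>)"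

text \<open>The minimum is an infimum in \<open>enat\<close>; it is attained for nonempty sets, and the
  distance to the empty set is \<open>\<infinity>\<close>.\<close>

definition sdist :: "(int ^ 'd) set \<Rightarrow> (int ^ 'd) set \<Rightarrow> enat" where
  "sdist S T = (INF x\<in>S. INF y\<in>T. enat (ldist x y))"

definition translate :: "(int ^ 'd) set \<Rightarrow> int ^ 'd \<Rightarrow> (int ^ 'd) set" where
  "translate S z = (\<lambda>x. x + z) ` S"

definition cube :: "nat \<Rightarrow> (int ^ 'd) set" where
  "cube n = {x. \<forall>i. 0 \<le> x $ i \<and> x $ i < int n}"

definition bdry :: "nat \<Rightarrow> (int ^ 'd) set \<Rightarrow> (int ^ 'd) set" where
  "bdry r S = {x. x \<in> S \<and> sdist {x} (- S) \<le> enat r} \<union> {x. x \<notin> S \<and> sdist {x} S \<le> enat r}"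

definition inner_part :: "nat \<Rightarrow> (int ^ 'd) set \<Rightarrow> (int ^ 'd) set" where
  "inner_part r S = S - bdry r S"

definition grid :: "nat \<Rightarrow> nat \<Rightarrow> (int ^ 'd) set" where
  "grid m n = {t. (\<exists>k. t = int m *s k) \<and> translate (cube m) t \<subseteq> cube n}"

section \<open>Colorings\<close>

text \<open>For infinite index sets \<open>PiM\<close> carries the product \<open>\<sigma>\<close>-algebra; the measure on each factor
  is irrelevant here, since \<open>cspace\<close> is only used for its space and its \<open>\<sigma>\<close>-algebra.
  Elements of \<open>\<Omega>\<^sub>\<Lambda>\<close> are functions that are \<open>undefined\<close> outside \<open>\<Lambda>\<close>, and \<open>\<Pi>\<^sub>\<Lambda>\<close> is \<open>restrict\<close>.\<close>

definition cspace :: "real set \<Rightarrow> (int ^ 'd) set \<Rightarrow> (int ^ 'd \<Rightarrow> real) measure" where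
  "cspace A S = PiM S (\<lambda>_. restrict_space borel A)"

abbreviation Omega :: "real set \<Rightarrow> (int ^ 'd \<Rightarrow> real) set" where
  "Omega A \<equiv> UNIV \<rightarrow>\<^sub>E A"

definition tau :: "int ^ 'd \<Rightarrow> (int ^ 'd \<Rightarrow> real) \<Rightarrow> int ^ 'd \<Rightarrow> real" where
  "tau z \<omega> = (\<lambda>x. \<omega> (x + z))"

definition marginal ::
    "real set \<Rightarrow> (int ^ 'd \<Rightarrow> real) measure \<Rightarrow> (int ^ 'd) set \<Rightarrow> (int ^ 'd \<Rightarrow> real) measure" where
  "marginal A P S = distr P (cspace A S) (\<lambda>\<omega>. restrict \<omega> S)"

definition rho ::
    "real set \<Rightarrow> (int ^ 'd \<Rightarrow> real) measure \<Rightarrow> (int ^ 'd \<Rightarrow> real measure)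
      \<Rightarrow> (int ^ 'd) set \<Rightarrow> (int ^ 'd \<Rightarrow> real) \<Rightarrow> ennreal" where
  "rho A P \<mu> S = RN_deriv (PiM S \<mu>) (marginal A P S)"

definition M1 :: "(int ^ 'd \<Rightarrow> real) measure \<Rightarrow> bool" where
  "M1 P \<longleftrightarrow> (\<forall>z. distr P P (tau z) = P)"

definition M2 ::
    "real set \<Rightarrow> (int ^ 'd \<Rightarrow> real) measure \<Rightarrow> (int ^ 'd \<Rightarrow> real measure) \<Rightarrow> bool" where
  "M2 A P \<mu> \<longleftrightarrow>
     (\<forall>z. sigma_finite_measure (\<mu> z) \<and> sets (\<mu> z) = sets (restrict_space borel A)) \<and>
     (\<forall>S. finite S \<longrightarrow> absolutely_continuous (PiM S \<mu>) (marginal A P S))"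

definition M3 ::
    "real set \<Rightarrow> (int ^ 'd \<Rightarrow> real) measure \<Rightarrow> (int ^ 'd \<Rightarrow> real measure) \<Rightarrow> nat \<Rightarrow> bool" where
  "M3 A P \<mu> r \<longleftrightarrow>
     (\<forall>n\<ge>1. \<forall>S :: nat \<Rightarrow> (int ^ 'd) set.
        (\<forall>i\<in>{1..n}. finite (S i) \<and> S i \<noteq> {}) \<and>
        (\<forall>i\<in>{1..n}. \<forall>j\<in>{1..n}. i \<noteq> j \<longrightarrow> enat r < sdist (S i) (S j)) \<longrightarrow>
        (AE \<eta> in PiM (\<Union>i\<in>{1..n}. S i) \<mu>.
           rho A P \<mu> (\<Union>i\<in>{1..n}. S i) \<eta> = (\<Prod>j\<in>{1..n}. rho A P \<mu> (S j) (restrict \<eta> (S j)))))"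

section \<open>Admissible functions\<close>

definition BB :: "(real \<Rightarrow> real) set" where
  "BB = {F. (\<forall>E. continuous (at_right E) F) \<and> bounded (range F)}"

text \<open>Norms and suprema take values in \<open>ereal\<close>, so that no boundedness has to be known in order
  to write them down.\<close>

definition supnorm :: "(real \<Rightarrow> real) \<Rightarrow> ereal" where
  "supnorm F = (SUP E. ereal \<bar>F E\<bar>)"

type_synonym 'd field_fun = "(int ^ 'd) set \<Rightarrow> (int ^ 'd \<Rightarrow> real) \<Rightarrow> real \<Rightarrow> real"

definition boundary_term :: "real set \<Rightarrow> ('d::finite) field_fun \<Rightarrow> ((int ^ 'd) set \<Rightarrow> real) \<Rightarrow> bool" where
  "boundary_term A f b \<longleftrightarrow>
     (\<forall>S. finite S \<longrightarrow> 0 \<le> b S) \<and>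
     (\<forall>\<omega>\<in>Omega A. \<forall>n\<ge>1. \<forall>S :: nat \<Rightarrow> (int ^ 'd) set.
        (\<forall>i\<in>{1..n}. finite (S i)) \<and> disjoint_family_on S {1..n} \<longrightarrow>
        supnorm (\<lambda>E. f (\<Union>i\<in>{1..n}. S i) \<omega> E - (\<Sum>i=1..n. f (S i) \<omega> E))
          \<le> ereal (\<Sum>i=1..n. b (S i))) \<and>
     (\<forall>S z. finite S \<longrightarrow> b (translate S z) = b S) \<and>
     (\<exists>D>0. \<forall>S. finite S \<longrightarrow> b S \<le> D * real (card S)) \<and>
     (\<forall>l z. strict_mono l \<and> (\<forall>i. 1 \<le> l i) \<longrightarrow>
        (\<lambda>i::nat. b (translate (cube (l i)) (z i)) / real (card (translate (cube (l i)) (z i))))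
          \<longlonglongrightarrow> 0)"

definition admissible :: "real set \<Rightarrow> ('d::finite) field_fun \<Rightarrow> bool" where
  "admissible A f \<longleftrightarrow>
     (\<forall>S. finite S \<longrightarrow> (\<forall>\<omega>\<in>Omega A. f S \<omega> \<in> BB)) \<and>
     (\<forall>S z. finite S \<longrightarrow> (\<forall>\<omega>\<in>Omega A. f (translate S z) \<omega> = f S (tau z \<omega>))) \<and>
     (\<forall>S. finite S \<longrightarrow> (\<forall>\<omega>\<in>Omega A. \<forall>\<omega>'\<in>Omega A.
        restrict \<omega> S = restrict \<omega>' S \<longrightarrow> f S \<omega> = f S \<omega>')) \<and>
     (\<exists>b. boundary_term A f b) \<and>
     (\<exists>s :: int ^ 'd \<Rightarrow> int. range s \<subseteq> {-1, 1} \<and>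
        (\<forall>S. finite S \<longrightarrow> (\<forall>\<omega>\<in>Omega A. \<forall>\<omega>'\<in>Omega A. \<forall>z\<in>S. \<forall>E.
           restrict \<omega> (S - {z}) = restrict \<omega>' (S - {z}) \<and> \<omega> z \<le> \<omega>' z \<longrightarrow>
             (s z = 1 \<longrightarrow> f S \<omega> E \<le> f S \<omega>' E) \<and> (s z = -1 \<longrightarrow> f S \<omega>' E \<le> f S \<omega> E)))) \<and>
     (SUP \<omega>\<in>Omega A. supnorm (f {0} \<omega>)) < \<infinity>"

definition Kf :: "real set \<Rightarrow> ('d::finite) field_fun \<Rightarrow> ereal" where
  "Kf A f = (SUP (\<omega>, S) \<in> Omega A \<times> {S. finite S \<and> S \<noteq> {}}.
               supnorm (f S \<omega>) / ereal (real (card S)))"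

text \<open>The boundary term and its constants are not determined by \<open>f\<close>: membership asks for some
  proper boundary term with constants within the given bounds.\<close>

definition UU :: "real set \<Rightarrow> real \<Rightarrow> real \<Rightarrow> real \<Rightarrow> nat \<Rightarrow> ('d::finite) field_fun set" where
  "UU A K D D' r' = {f. admissible A f \<and> Kf A f \<le> ereal K \<and>
     (\<exists>b Df Df' rf'. boundary_term A f b \<and>
        0 < Df \<and> Df \<le> D \<and> (\<forall>S. finite S \<longrightarrow> b S \<le> Df * real (card S)) \<and>
        0 < Df' \<and> Df' \<le> D' \<and> 1 \<le> rf' \<and> rf' \<le> r' \<and>
        (\<forall>n\<ge>1. \<forall>z. b (translate (cube n) z)
                     \<le> Df' * real (card (bdry rf' (translate (cube n) z)))))}"

definition fstar :: "(int ^ 'd \<Rightarrow> real) measure \<Rightarrow> ('d::finite) field_fun \<Rightarrow> real \<Rightarrow> real" where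
  "fstar P f = (THE F. F \<in> BB \<and>
     (\<exists>G\<in>sets P. measure P G = 1 \<and>
        (\<forall>\<omega>\<in>G. (\<lambda>n. supnorm (\<lambda>E. f (cube n) \<omega> E / real (card (cube n :: (int ^ 'd) set)) - F E))
                  \<longlonglongrightarrow> 0)))"

section \<open>Empirical measures\<close>

text \<open>\<open>f\<^sub>\<Lambda>\<close> on \<open>\<Omega>\<^sub>\<Lambda>\<close>: evaluate \<open>f\<close> at any extension of \<open>\<eta>\<close> to a coloring of the whole lattice.\<close>

definition floc :: "real set \<Rightarrow> ('d::finite) field_fun \<Rightarrow> (int ^ 'd) set \<Rightarrow> (int ^ 'd \<Rightarrow> real) \<Rightarrow> real \<Rightarrow> real"
  where "floc A f S \<eta> = f S (SOME \<omega>. \<omega> \<in> Omega A \<and> restrict \<omega> S = \<eta>)"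

definition empirical ::
    "real set \<Rightarrow> nat \<Rightarrow> nat \<Rightarrow> nat \<Rightarrow> (int ^ 'd \<Rightarrow> real) \<Rightarrow> (int ^ 'd \<Rightarrow> real) measure" where
  "empirical A r m n \<omega> = distr (uniform_count_measure (grid m n)) (cspace A (inner_part r (cube m)))
     (\<lambda>t. restrict (tau t \<omega>) (inner_part r (cube m)))"

lemma finite_grid:
  assumes "1 \<le> m"
  shows "finite (grid m n :: (int ^ 'd) set)"
proof -
  have "grid m n \<subseteq> (\<lambda>f. \<chi> i. f i) ` (PiE UNIV (\<lambda>_::'d. {0..<int n}))"
  proof
    fix t :: "int ^ 'd" assume "t \<in> grid m n"
    then have "t \<in> cube n"
    proof -
      have "(0 :: int ^ 'd) \<in> cube m" using assms by (simp add: cube_def)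
      then have "0 + t \<in> translate (cube m) t" unfolding translate_def by (rule imageI)
      with \<open>t \<in> grid m n\<close> show ?thesis by (auto simp: grid_def)
    qed
    then have "(\<lambda>i. t $ i) \<in> PiE UNIV (\<lambda>_::'d. {0..<int n})" by (auto simp: cube_def)
    then show "t \<in> (\<lambda>f. \<chi> i. f i) ` (PiE UNIV (\<lambda>_::'d. {0..<int n}))"
      by (rule image_eqI[rotated]) (simp add: vec_eq_iff)
  qed
  then show ?thesis by (rule finite_subset) (auto intro!: finite_imageI finite_PiE)
qed

text \<open>\<open>empirical\<close> is the normalised sum of Dirac measures.\<close>

lemma emeasure_empirical:
  fixes \<omega> :: "int ^ 'd \<Rightarrow> real"
  assumes "\<omega> \<in> Omega A" "1 \<le> m"
    and B: "B \<in> sets (cspace A (inner_part r (cube m)))"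
  shows "emeasure (empirical A r m n \<omega>) B =
    ennreal ((\<Sum>t\<in>grid m n. indicator B (restrict (tau t \<omega>) (inner_part r (cube m))))
      / real (card (grid m n :: (int ^ 'd) set)))"
proof -
  let ?G = "grid m n :: (int ^ 'd) set"
  let ?g = "\<lambda>t. restrict (tau t \<omega>) (inner_part r (cube m))"
  have fin: "finite ?G" using assms finite_grid by blast
  have "?g t \<in> space (cspace A (inner_part r (cube m)))" for t
    using assms(1) by (simp add: cspace_def space_PiM space_restrict_space tau_def PiE_iff)
  then have "?g \<in> measurable (uniform_count_measure ?G) (cspace A (inner_part r (cube m)))"
    by (intro measurableI) (simp_all add: sets_uniform_count_measure space_uniform_count_measure)
  then have "emeasure (empirical A r m n \<omega>) B
      = emeasure (uniform_count_measure ?G) (?g -` B \<inter> ?G)"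
    by (simp add: empirical_def emeasure_distr[OF _ B] space_uniform_count_measure)
  also have "\<dots> = ennreal (real (card (?g -` B \<inter> ?G)) / real (card ?G))"
    using fin by (intro emeasure_uniform_count_measure) auto
  also have "real (card (?g -` B \<inter> ?G)) = (\<Sum>t\<in>?G \<inter> ?g -` B. 1)"
    by (simp only: sum_constant Int_commute mult_1_right)
  also have "\<dots> = (\<Sum>t\<in>?G. if t \<in> ?g -` B then 1 else 0)"
    using fin by (rule sum.inter_restrict)
  also have "\<dots> = (\<Sum>t\<in>?G. indicator B (?g t))"
    by (rule sum.cong[OF refl]) (simp only: indicator_def of_bool_def vimage_eq)
  finally show ?thesis .
qed

definition pairing ::
    "((int ^ 'd \<Rightarrow> real) \<Rightarrow> real \<Rightarrow> real) \<Rightarrow> (int ^ 'd \<Rightarrow> real) measure \<Rightarrow> real \<Rightarrow> real" where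
  "pairing g \<nu> = (\<lambda>E. integral\<^sup>L (completion \<nu>) (\<lambda>\<eta>. g \<eta> E))"

text \<open>The norm of \<open>\<langle>f\<^sub>\<Lambda>, L - P\<^sub>\<Lambda>\<rangle>\<close> for \<open>\<Lambda> = \<Lambda>\<^sub>m\<^sup>r\<close> and \<open>L\<close> the empirical measure.\<close>

definition deviation ::
    "real set \<Rightarrow> (int ^ 'd \<Rightarrow> real) measure \<Rightarrow> nat \<Rightarrow> nat \<Rightarrow> nat \<Rightarrow> (int ^ 'd \<Rightarrow> real)
      \<Rightarrow> ('d::finite) field_fun \<Rightarrow> ereal" where
  "deviation A P r m n \<omega> f =
     supnorm (\<lambda>E. pairing (floc A f (inner_part r (cube m))) (empirical A r m n \<omega>) E
                - pairing (floc A f (inner_part r (cube m)))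
                    (marginal A P (inner_part r (cube m))) E)"

end

theory Submission
  imports Defs
begin

text \<open>
  Three ideas carry the proof.

  \<^bold>\<open>A uniform law of large numbers for monotone functions.\<close> By (iv) the functions \<open>f\<^sub>\<Lambda>(\<cdot>)(E)\<close> are
  monotone in each coordinate, increasing or decreasing, and they are bounded by \<open>K |\<Lambda>|\<close>. For a
  product of finite measures on the line there is one finite partition of the space into cells such
  that every such function has small total oscillation: a line is cut at finitely many points so
  that the open gaps have small mass, heavy atoms become cells of their own, and the increments of a
  monotone function over the gaps telescope (\<open>one_dimensional_cells\<close>); in several coordinates one
  changes one coordinate at a time (\<open>sum_corner_difference_le\<close>). Absolute continuity (M2)
  transports this from product measures to the marginals of \<open>P\<close> (\<open>monotone_cells\<close>). The partition
  depends on neither \<open>f\<close> nor \<open>E\<close>. So the integral of \<open>f\<^sub>\<Lambda>\<close> against the empirical measure is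
  close to the one against \<open>P\<^sub>\<Lambda>\<close> as soon as the finitely many cell frequencies are close to their
  probabilities (\<open>average_minus_integral_le\<close>). The partitions also show that \<open>f\<^sub>\<Lambda>\<close> is measurable
  for the completion of \<open>P\<^sub>\<Lambda>\<close> (\<open>floc_measurable\<close>).

  \<^bold>\<open>Independence.\<close> The inner parts of different tiles are more than \<open>r\<close> apart, so by (M3) the
  patterns seen in them are independent, and by (M1) they have the same distribution. Hoeffding's
  inequality for the cell frequencies gives the exponential estimate (\<open>deviation_exponential\<close>), and
  Borel-Cantelli turns it into almost sure convergence (\<open>deviation_SUP_tendsto_0\<close>).

  \<^bold>\<open>Almost additivity.\<close> Cutting the large cube into tiles, and shrinking every tile to its inner
  part, changes \<open>f(\<Lambda>\<^sub>n) / |\<Lambda>\<^sub>n|\<close> only by boundary terms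
  (\<open>field_average_minus_pairing_le\<close>). With the law of large numbers this shows that the almost sure
  limit exists and is close to the integral against the marginal
  (\<open>fstar_minus_marginal_pairing_le\<close>). The triangle inequality then gives the explicit bound; its
  constants come from counting lattice points near the boundary of a cube (\<open>card_bdry_cube_le\<close>,
  \<open>error_constants_le\<close>).
\<close>

section \<open>Cubes, their boundaries and their tilings\<close>

lemma mem_translate_cube:
  "x \<in> translate (cube N) z \<longleftrightarrow> (\<forall>i. z $ i \<le> x $ i \<and> x $ i < z $ i + int N)"
proof
  assume "\<forall>i. z $ i \<le> x $ i \<and> x $ i < z $ i + int N"
  then have "x - z \<in> cube N" "x = (x - z) + z"
    by (auto simp: cube_def algebra_simps)
  then show "x \<in> translate (cube N) z"
    unfolding translate_def by (rule rev_image_eqI)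
qed (auto simp: translate_def cube_def)

lemma translate_cube_eq_image:
  fixes z :: "int ^ 'd"
  shows "translate (cube N) z = (\<lambda>f. \<chi> i. f i) ` (\<Pi>\<^sub>E i\<in>UNIV. {z $ i..<z $ i + int N})"
proof (intro set_eqI iffI)
  fix x assume "x \<in> translate (cube N) z"
  then have "(\<lambda>i. x $ i) \<in> (\<Pi>\<^sub>E i\<in>UNIV. {z $ i..<z $ i + int N})"
    by (auto simp: mem_translate_cube)
  then show "x \<in> (\<lambda>f. \<chi> i. f i) ` (\<Pi>\<^sub>E i\<in>UNIV. {z $ i..<z $ i + int N})"
    by (rule rev_image_eqI) (simp add: vec_eq_iff)
qed (auto simp: mem_translate_cube PiE_iff)

lemma finite_translate_cube [simp]: "finite (translate (cube N) (z :: int ^ 'd))"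
  unfolding translate_cube_eq_image by (intro finite_imageI finite_PiE) auto

lemma card_translate_cube: "card (translate (cube N) (z :: int ^ 'd)) = N ^ CARD('d)"
proof -
  have "inj_on (\<lambda>f. \<chi> i. f i) (\<Pi>\<^sub>E i\<in>UNIV. {z $ i..<z $ i + int N})"
    by (rule inj_onI) (metis vec_lambda_beta ext)
  then have "card (translate (cube N) z) = card (\<Pi>\<^sub>E i\<in>UNIV. {z $ i..<z $ i + int N})"
    unfolding translate_cube_eq_image by (rule card_image)
  then show ?thesis by (simp add: card_PiE)
qed

lemma translate_0 [simp]: "translate S 0 = S"
  by (simp add: translate_def)

lemma translate_translate: "translate (translate S y) z = translate S (y + z)"
  by (simp add: translate_def image_image add.assoc)

lemma finite_cube [simp]: "finite (cube N :: (int ^ 'd) set)"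
  using finite_translate_cube[of N 0] by simp

lemma card_cube: "card (cube N :: (int ^ 'd) set) = N ^ CARD('d)"
  using card_translate_cube[of N 0] by simp

lemma abs_component_le_ldist: "\<bar>x $ i - y $ i\<bar> \<le> int (ldist x y)"
proof -
  have "\<bar>x $ i - y $ i\<bar> \<le> (\<Sum>i\<in>UNIV. \<bar>x $ i - y $ i\<bar>)"
    by (rule member_le_sum) auto
  then show ?thesis
    unfolding ldist_def by linarith
qed

text \<open>Changing a single coordinate reaches the points outside a cube that are nearest to a point inside.\<close>

lemma ldist_shift_axis:
  fixes x :: "int ^ 'd"
  shows "ldist x (\<chi> j. if j = i then c else x $ j) = nat \<bar>x $ i - c\<bar>"
proof -
  have "(\<Sum>j\<in>UNIV. \<bar>x $ j - (\<chi> j. if j = i then c else x $ j) $ j\<bar>)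
      = (\<Sum>j\<in>UNIV. if j = i then \<bar>x $ i - c\<bar> else 0)"
    by (rule sum.cong) auto
  then show ?thesis by (simp add: ldist_def)
qed

lemma sdist_le_iff:
  "sdist {x} S \<le> enat k \<longleftrightarrow> (\<exists>y\<in>S. ldist x y \<le> k)"
proof
  assume le: "sdist {x} S \<le> enat k"
  have "(INF y\<in>S. enat (ldist x y)) < enat (Suc k)"
    using le by (simp add: sdist_def) (metis enat_ord_simps(2) le_less_trans lessI)
  then obtain y where "y \<in> S" "enat (ldist x y) < enat (Suc k)"
    unfolding INF_less_iff by blast
  then show "\<exists>y\<in>S. ldist x y \<le> k" by (auto simp: less_Suc_eq_le)
next
  assume "\<exists>y\<in>S. ldist x y \<le> k"
  then obtain y where "y \<in> S" "ldist x y \<le> k" by blast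
  then show "sdist {x} S \<le> enat k"
    by (auto simp: sdist_def intro: INF_lower2)
qed

text \<open>A point has \<open>l\<^sup>1\<close>-distance at most \<open>r\<close> to the complement of a cube exactly when one of its
  coordinates is within \<open>r\<close> of a face. So the inner part is again a cube; for \<open>m \<le> 2 r\<close> the
  truncated side length \<open>m - 2 * r\<close> makes it empty.\<close>

lemma inner_part_cube:
  "inner_part r (cube m :: (int ^ 'd) set) = translate (cube (m - 2 * r)) (\<chi> i. int r)"
proof (intro set_eqI iffI)
  fix x :: "int ^ 'd"
  assume "x \<in> inner_part r (cube m)"
  then have x: "x \<in> cube m" and far: "\<And>y. y \<notin> cube m \<Longrightarrow> r < ldist x y"
    by (auto simp: inner_part_def bdry_def sdist_le_iff not_le)
  have x': "0 \<le> x $ i" "x $ i < int m" for i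
    using x by (auto simp: cube_def)
  have "int r \<le> x $ i \<and> x $ i < int r + int (m - 2 * r)" for i
  proof -
    have "(\<chi> j. if j = i then -1 else x $ j) \<notin> cube m"
      by (auto simp: cube_def intro!: exI[of _ i])
    from far[OF this] have 1: "int r \<le> x $ i"
      using x'(1)[of i] by (simp add: ldist_shift_axis)
    have "(\<chi> j. if j = i then int m else x $ j) \<notin> cube m"
      by (auto simp: cube_def intro!: exI[of _ i])
    from far[OF this] have 2: "x $ i + int r < int m"
      using x'(2)[of i] by (simp add: ldist_shift_axis)
    from 1 2 show ?thesis by linarith
  qed
  then show "x \<in> translate (cube (m - 2 * r)) (\<chi> i. int r)"
    by (simp add: mem_translate_cube)
next
  fix x :: "int ^ 'd"
  assume "x \<in> translate (cube (m - 2 * r)) (\<chi> i. int r)"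
  then have x: "int r \<le> x $ i" "x $ i < int r + int (m - 2 * r)" for i
    by (auto simp: mem_translate_cube)
  have "0 \<le> x $ i \<and> x $ i < int m" for i using x[of i] by linarith
  then have xm: "x \<in> cube m"
    by (simp add: cube_def)
  have "r < ldist x y" if "y \<notin> cube m" for y
  proof -
    obtain i where "y $ i < 0 \<or> int m \<le> y $ i"
      using \<open>y \<notin> cube m\<close> unfolding cube_def mem_Collect_eq not_all de_Morgan_conj not_le not_less
      by blast
    then show ?thesis
      using abs_component_le_ldist[of x i y] x[of i] by linarith
  qed
  then show "x \<in> inner_part r (cube m)"
    using xm by (fastforce simp: inner_part_def bdry_def sdist_le_iff)
qed

lemma bdry_cube_subset:
  fixes z :: "int ^ 'd"
  shows "bdry \<rho> (translate (cube N) z)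
    \<subseteq> translate (cube (N + 2 * \<rho>)) (z - (\<chi> i. int \<rho>)) - translate (cube (N - 2 * \<rho>)) (z + (\<chi> i. int \<rho>))"
proof
  fix x assume "x \<in> bdry \<rho> (translate (cube N) z)"
  then consider y where "x \<in> translate (cube N) z" "y \<notin> translate (cube N) z" "ldist x y \<le> \<rho>"
    | y where "x \<notin> translate (cube N) z" "y \<in> translate (cube N) z" "ldist x y \<le> \<rho>"
    by (auto simp: bdry_def sdist_le_iff)
  then show "x \<in> translate (cube (N + 2 * \<rho>)) (z - (\<chi> i. int \<rho>))
      - translate (cube (N - 2 * \<rho>)) (z + (\<chi> i. int \<rho>))"
  proof cases
    case 1
    from 1 obtain i where "y $ i < z $ i \<or> z $ i + int N \<le> y $ i"
      unfolding mem_translate_cube not_all de_Morgan_conj not_le not_less by blast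
    then have "x $ i < z $ i + int \<rho> \<or> z $ i + int N \<le> x $ i + int \<rho>"
      using abs_component_le_ldist[of x i y] 1 by linarith
    then have "x \<notin> translate (cube (N - 2 * \<rho>)) (z + (\<chi> i. int \<rho>))"
      using 1 by (auto simp: mem_translate_cube intro!: exI[of _ i])
    moreover have "z $ i - int \<rho> \<le> x $ i \<and> x $ i < z $ i - int \<rho> + int (N + 2 * \<rho>)" for i
    proof -
      have "z $ i \<le> x $ i" "x $ i < z $ i + int N" using 1 by (auto simp: mem_translate_cube)
      then show ?thesis by simp
    qed
    then have "x \<in> translate (cube (N + 2 * \<rho>)) (z - (\<chi> i. int \<rho>))"
      by (simp add: mem_translate_cube)
    ultimately show ?thesis by blast
  next
    case 2
    have "z $ i - int \<rho> \<le> x $ i \<and> x $ i < z $ i + int N + int \<rho>" for i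
    proof -
      have "z $ i \<le> y $ i" "y $ i < z $ i + int N" using 2 by (auto simp: mem_translate_cube)
      then show ?thesis using abs_component_le_ldist[of x i y] 2(3) by linarith
    qed
    then have "x \<in> translate (cube (N + 2 * \<rho>)) (z - (\<chi> i. int \<rho>))"
      by (simp add: mem_translate_cube algebra_simps)
    moreover have "x \<notin> translate (cube (N - 2 * \<rho>)) (z + (\<chi> i. int \<rho>))"
    proof -
      obtain i where "x $ i < z $ i \<or> z $ i + int N \<le> x $ i"
        using 2 unfolding mem_translate_cube not_all de_Morgan_conj not_le not_less by blast
      then show ?thesis by (auto simp: mem_translate_cube intro!: exI[of _ i])
    qed
    ultimately show ?thesis by blast
  qed
qed

text \<open>This bounds the number of points between two concentric cubes. For \<open>N \<ge> 2 \<rho>\<close> the difference is of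
  order \<open>\<rho> N\<^sup>k\<close>; for smaller \<open>N\<close> the inner cube is empty and the power of \<open>\<rho>\<close> has to absorb the
  outer one. Induction on the exponent treats both cases at once, since \<open>N + 2 \<rho> \<le> 3 N \<rho>\<close>.\<close>

lemma power_difference_le:
  fixes N \<rho> :: nat
  assumes "1 \<le> N" "1 \<le> \<rho>"
  shows "real (N + 2 * \<rho>) ^ Suc k - real (N - 2 * \<rho>) ^ Suc k \<le> 4 ^ Suc k * real \<rho> ^ Suc k * real N ^ k"
proof (induction k)
  case 0
  show ?case by (cases "2 * \<rho> \<le> N") (auto simp: of_nat_diff)
next
  case (Suc k)
  define a b where "a = real (N + 2 * \<rho>)" and "b = real (N - 2 * \<rho>)"
  have N: "1 \<le> real N" and \<rho>: "1 \<le> real \<rho>" using assms by auto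
  have "real N * 1 \<le> real N * real \<rho>" "1 * real \<rho> \<le> real N * real \<rho>"
    using N \<rho> by (intro mult_mono; simp)+
  then have a: "a \<le> 3 * (real N * real \<rho>)" by (simp add: a_def)
  have ab: "a - b \<le> 4 * real \<rho>" by (simp add: a_def b_def)
  have b: "0 \<le> b" "b \<le> real N" by (auto simp: b_def)
  have a0: "0 \<le> a" by (simp add: a_def)
  have r: "real \<rho> \<le> real \<rho> ^ Suc (Suc k)"
    using \<rho> power_increasing[of 1 "Suc (Suc k)" "real \<rho>"] by simp
  have four: "(4::real) \<le> 4 ^ Suc k" using power_increasing[of 1 "Suc k" "4::real"] by simp
  have "a ^ Suc (Suc k) - b ^ Suc (Suc k) = a * (a ^ Suc k - b ^ Suc k) + b ^ Suc k * (a - b)"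
    by (simp add: algebra_simps)
  also have "\<dots> \<le> a * (4 ^ Suc k * real \<rho> ^ Suc k * real N ^ k) + real N ^ Suc k * (4 * real \<rho>)"
    using Suc a0 ab b unfolding a_def[symmetric] b_def[symmetric]
    by (intro add_mono mult_left_mono mult_mono power_mono) (auto simp: a_def b_def)
  also have "\<dots> \<le> 3 * (real N * real \<rho>) * (4 ^ Suc k * real \<rho> ^ Suc k * real N ^ k)
      + real N ^ Suc k * (4 ^ Suc k * real \<rho> ^ Suc (Suc k))"
    using a r four by (intro add_mono mult_right_mono mult_left_mono mult_mono) auto
  also have "\<dots> = 4 ^ Suc (Suc k) * real \<rho> ^ Suc (Suc k) * real N ^ Suc k"
    by (simp add: algebra_simps)
  finally show ?case by (simp add: a_def b_def)
qed

lemma card_bdry_cube_le: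
  fixes z :: "int ^ 'd"
  assumes "1 \<le> N" "1 \<le> \<rho>"
  shows "real (card (bdry \<rho> (translate (cube N) z)))
    \<le> 4 ^ CARD('d) * real \<rho> ^ CARD('d) * real N ^ (CARD('d) - 1)"
proof -
  obtain k where k: "CARD('d) = Suc k"
    using zero_less_card_finite[where 'a = 'd] by (cases "CARD('d)") auto
  let ?O = "translate (cube (N + 2 * \<rho>)) (z - (\<chi> i. int \<rho>))"
  let ?I = "translate (cube (N - 2 * \<rho>)) (z + (\<chi> i. int \<rho>))"
  have sub: "?I \<subseteq> ?O"
  proof
    fix x assume "x \<in> ?I"
    then have x: "z $ i + int \<rho> \<le> x $ i" "x $ i < z $ i + int \<rho> + int (N - 2 * \<rho>)" for i
      by (auto simp: mem_translate_cube)
    have "z $ i - int \<rho> \<le> x $ i \<and> x $ i < z $ i - int \<rho> + int (N + 2 * \<rho>)" for i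
      using x[of i] by (simp add: of_nat_diff split: nat_diff_split_asm)
    then show "x \<in> ?O" by (simp add: mem_translate_cube)
  qed
  have "real (card (bdry \<rho> (translate (cube N) z))) \<le> real (card (?O - ?I))"
    by (intro of_nat_mono card_mono bdry_cube_subset) auto
  also have "card (?O - ?I) = card ?O - card ?I"
    by (rule card_Diff_subset) (use sub in auto)
  also have "real (card ?O - card ?I) = real (card ?O) - real (card ?I)"
    by (intro of_nat_diff card_mono sub) auto
  also have "\<dots> \<le> 4 ^ Suc k * real \<rho> ^ Suc k * real N ^ k"
    using power_difference_le[OF assms, of k] by (simp only: card_translate_cube k of_nat_power)
  finally show ?thesis by (simp add: k)
qed

lemma mem_grid_iff:
  fixes t :: "int ^ 'd"
  assumes "1 \<le> m"
  shows "t \<in> grid m n \<longleftrightarrow> (\<exists>k\<in>cube (n div m). t = int m *s k)"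
proof -
  have "translate (cube m) (int m *s k) \<subseteq> cube n \<longleftrightarrow> k \<in> cube (n div m)" for k :: "int ^ 'd"
  proof
    assume sub: "translate (cube m) (int m *s k) \<subseteq> cube n"
    have "0 \<le> k $ i \<and> k $ i < int (n div m)" for i
    proof -
      have "int m *s k \<in> cube n"
        using sub assms by (auto simp: mem_translate_cube)
      then have "0 \<le> int m * k $ i" by (simp add: cube_def)
      then have 0: "0 \<le> k $ i" using assms by (simp add: zero_le_mult_iff)
      have "int m *s k + (\<chi> i. int m - 1) \<in> cube n"
        using sub assms by (auto simp: mem_translate_cube)
      then have "int m * k $ i + (int m - 1) < int n" by (simp add: cube_def)
      then have "(k $ i + 1) * int m \<le> int n" by (simp add: algebra_simps)
      then have "k $ i + 1 \<le> int n div int m"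
        using zdiv_mono1[of "(k $ i + 1) * int m" "int n" "int m"] assms by simp
      then show ?thesis using 0 by (simp add: zdiv_int)
    qed
    then show "k \<in> cube (n div m)" by (simp add: cube_def)
  next
    assume k: "k \<in> cube (n div m)"
    show "translate (cube m) (int m *s k) \<subseteq> cube n"
    proof
      fix x assume "x \<in> translate (cube m) (int m *s k)"
      then have x: "int m * k $ i \<le> x $ i" "x $ i < int m * k $ i + int m" for i
        by (auto simp: mem_translate_cube)
      have "0 \<le> x $ i \<and> x $ i < int n" for i
      proof -
        have k0: "0 \<le> k $ i" "k $ i < int (n div m)" using k by (auto simp: cube_def)
        then have "int m * (k $ i + 1) \<le> int m * int (n div m)"
          by (intro mult_left_mono) auto
        also have "\<dots> \<le> int n"
          by (metis of_nat_mult of_nat_mono times_div_less_eq_dividend)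
        finally have "x $ i < int n" using x(2)[of i] by (simp add: algebra_simps)
        moreover have "0 \<le> int m * k $ i" using k0 by simp
        ultimately show ?thesis using x(1)[of i] by linarith
      qed
      then show "x \<in> cube n" by (simp add: cube_def)
    qed
  qed
  then show ?thesis by (auto simp: grid_def)
qed

lemma card_grid:
  assumes "1 \<le> m"
  shows "card (grid m n :: (int ^ 'd) set) = (n div m) ^ CARD('d)"
proof -
  have "grid m n = (\<lambda>k :: int ^ 'd. int m *s k) ` cube (n div m)"
    using mem_grid_iff[OF assms] by auto
  moreover have "inj_on (\<lambda>k :: int ^ 'd. int m *s k) (cube (n div m))"
    using assms by (auto simp: inj_on_def vec_eq_iff)
  ultimately show ?thesis by (simp add: card_image card_cube)
qed

lemma grid_separated:
  fixes t t' :: "int ^ 'd"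
  assumes "t \<in> grid m n" "t' \<in> grid m n" "t \<noteq> t'"
  obtains i where "int m \<le> \<bar>t $ i - t' $ i\<bar>"
proof -
  obtain k k' where k: "t = int m *s k" "t' = int m *s k'"
    using assms by (auto simp: grid_def)
  then obtain i where i: "k $ i \<noteq> k' $ i" using assms(3) by (auto simp: vec_eq_iff)
  then have "1 \<le> \<bar>k $ i - k' $ i\<bar>" by simp
  then have "int m * 1 \<le> int m * \<bar>k $ i - k' $ i\<bar>" by (intro mult_left_mono) auto
  also have "\<dots> = \<bar>t $ i - t' $ i\<bar>" by (simp add: k right_diff_distrib[symmetric] abs_mult)
  finally show ?thesis using that by simp
qed

lemma disjoint_tiles: "disjoint_family_on (translate (cube m :: (int ^ 'd) set)) (grid m n)"
unfolding disjoint_family_on_def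
proof (intro ballI impI)
  fix t t' :: "int ^ 'd" assume tt: "t \<in> grid m n" "t' \<in> grid m n" "t \<noteq> t'"
  from tt obtain i where i: "int m \<le> \<bar>t $ i - t' $ i\<bar>" by (rule grid_separated)
  show "translate (cube m) t \<inter> translate (cube m) t' = {}"
  proof (rule ccontr)
    assume "translate (cube m) t \<inter> translate (cube m) t' \<noteq> {}"
    then obtain x where "x \<in> translate (cube m) t" "x \<in> translate (cube m) t'" by blast
    then have "t $ i \<le> x $ i" "x $ i < t $ i + int m" "t' $ i \<le> x $ i" "x $ i < t' $ i + int m"
      by (auto simp: mem_translate_cube)
    with i show False by linarith
  qed
qed

lemma sdist_inner_tiles:
  fixes t t' :: "int ^ 'd"
  assumes "t \<in> grid m n" "t' \<in> grid m n" "t \<noteq> t'"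
  shows "enat r < sdist (translate (inner_part r (cube m)) t) (translate (inner_part r (cube m)) t')"
proof -
  from assms obtain i where i: "int m \<le> \<bar>t $ i - t' $ i\<bar>" by (rule grid_separated)
  have "enat (Suc r) \<le> sdist (translate (inner_part r (cube m)) t) (translate (inner_part r (cube m)) t')"
    unfolding sdist_def
  proof (intro INF_greatest)
    fix x y assume "x \<in> translate (inner_part r (cube m)) t" "y \<in> translate (inner_part r (cube m)) t'"
    then have "x \<in> translate (cube (m - 2 * r)) ((\<chi> i. int r) + t)"
      "y \<in> translate (cube (m - 2 * r)) ((\<chi> i. int r) + t')"
      by (auto simp: inner_part_cube translate_translate)
    then have "int r + t $ i \<le> x $ i" "x $ i < int r + t $ i + int (m - 2 * r)"
      "int r + t' $ i \<le> y $ i" "y $ i < int r + t' $ i + int (m - 2 * r)"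
      by (auto simp: mem_translate_cube)
    then have "int (Suc r) \<le> \<bar>x $ i - y $ i\<bar>" using i by linarith
    then show "enat (Suc r) \<le> enat (ldist x y)"
      using abs_component_le_ldist[of x i y] by simp
  qed
  then show ?thesis by (metis enat_ord_simps(2) lessI less_le_trans)
qed

section \<open>Cells adapted to monotone functions of one variable\<close>

text \<open>Every real number has a neighbourhood that has small mass once the number itself is removed, because
  these punctured neighbourhoods shrink to the empty set. Bisection chains such gaps across a compact
  interval, and the two unbounded gaps have small mass because the measure is finite. The cut points
  \<open>\<plusminus>\<infinity>\<close> make it unnecessary to treat the unbounded gaps separately.\<close>

lemma finite_cut_points:
  fixes N :: "real measure"
  assumes "finite_measure N" and [measurable_cong]: "sets N = sets borel" and "0 < \<delta>"
  shows "\<exists>q (p :: nat \<Rightarrow> ereal). p 0 = -\<infinity> \<and> p q = \<infinity> \<and>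
    (\<forall>j<q. p j \<le> p (Suc j) \<and> measure N {x. p j < ereal x \<and> ereal x < p (Suc j)} \<le> \<delta>)"
proof -
  interpret finite_measure N by fact
  have sp: "space N = UNIV" using sets_eq_imp_space_eq[OF assms(2)] by simp
  define R where "R a b \<longleftrightarrow> a \<le> b \<and> measure N {x. a < ereal x \<and> ereal x < b} \<le> \<delta>" for a b :: ereal
  have small: "\<exists>n. measure N (B n) < \<delta>"
    if "\<And>n. B n \<in> sets N" "decseq B" "(\<Inter>n. B n) = {}" for B :: "nat \<Rightarrow> real set"
  proof -
    have "(\<lambda>n. measure N (B n)) \<longlonglongrightarrow> measure N (\<Inter>n. B n)"
      using that by (intro finite_Lim_measure_decseq) auto
    then have "(\<lambda>n. measure N (B n)) \<longlonglongrightarrow> 0" using that by simp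
    then have "eventually (\<lambda>n. measure N (B n) < \<delta>) sequentially"
      by (rule order_tendstoD) fact
    then show ?thesis using eventually_happens trivial_limit_sequentially by blast
  qed
  \<comment> \<open>A chain of admissible gaps crosses every compact interval, by bisection.\<close>
  have bounded: "R\<^sup>*\<^sup>* (ereal a) (ereal b)" if "a \<le> b" for a b
    using that
  proof (induction rule: Bolzano)
    case (trans a b c)
    then show ?case by (meson rtranclp_trans)
  next
    case (local x)
    define B where "B n = {x - 1 / Suc n<..<x + 1 / Suc n} - {x}" for n
    have "\<exists>n. measure N (B n) < \<delta>"
    proof (rule small)
      show "decseq B"
        unfolding B_def
      proof (intro antimonoI Diff_mono subsetI)
        fix m n :: nat and y assume "m \<le> n" "y \<in> {x - 1 / Suc n<..<x + 1 / Suc n}"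
        moreover from this have "1 / real (Suc n) \<le> 1 / Suc m" by (intro divide_left_mono) auto
        ultimately show "y \<in> {x - 1 / Suc m<..<x + 1 / Suc m}" by auto
      qed auto
      have "\<exists>n. y \<notin> B n" for y
      proof (cases "y = x")
        case False
        then obtain n where "inverse (real (Suc n)) < \<bar>y - x\<bar>"
          using reals_Archimedean[of "\<bar>y - x\<bar>"] by auto
        then have "y \<notin> B n" by (auto simp: B_def inverse_eq_divide)
        then show ?thesis ..
      qed (auto simp: B_def)
      then show "(\<Inter>n. B n) = {}" by auto
    qed (auto simp: B_def assms)
    then obtain n where n: "measure N (B n) < \<delta>" ..
    have gap: "R (ereal a) (ereal b)"
      if "a \<le> b" "{a<..<b} \<subseteq> B n" for a b
    proof -
      have "measure N {a<..<b} \<le> measure N (B n)"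
        using that by (intro finite_measure_mono) (auto simp: B_def assms)
      then show ?thesis using that n by (simp add: R_def greaterThanLessThan_def greaterThan_def lessThan_def Int_def)
    qed
    have "R\<^sup>*\<^sup>* (ereal a) (ereal b)" if "a \<le> x" "x \<le> b" "b - a < 1 / Suc n" for a b
    proof -
      have "R (ereal a) (ereal x)" "R (ereal x) (ereal b)"
        using that by (auto intro!: gap simp: B_def)
      then show ?thesis by (meson converse_rtranclp_into_rtranclp r_into_rtranclp)
    qed
    then show ?case by (intro exI[of _ "1 / Suc n"]) auto
  qed
  define B where "B n = {x. real n < x} \<union> {x. x < - real n}" for n
  have "\<exists>n. measure N (B n) < \<delta>"
  proof (rule small)
    show "decseq B" by (rule antimonoI) (auto simp: B_def)
    have "\<exists>n. y \<notin> B n" for y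
      using real_arch_simple[of "\<bar>y\<bar>"] by (auto simp: B_def abs_le_iff not_less)
    then show "(\<Inter>n. B n) = {}" by auto
  qed (auto simp: B_def assms)
  then obtain n where n: "measure N (B n) < \<delta>" ..
  have "measure N {x. x < - real n} \<le> measure N (B n)" "measure N {x. real n < x} \<le> measure N (B n)"
    by (intro finite_measure_mono; auto simp: B_def assms)+
  then have "R (-\<infinity>) (ereal (- real n))" "R (ereal (real n)) \<infinity>"
    using n by (auto simp: R_def)
  with bounded[of "- real n" "real n"] have "R\<^sup>*\<^sup>* (-\<infinity>) \<infinity>"
    by (metis (no_types, lifting) converse_rtranclp_into_rtranclp neg_le_0_iff_le of_nat_0_le_iff
        order_trans rtranclp.rtrancl_into_rtrancl)
  then obtain q where "(R ^^ q) (-\<infinity>) \<infinity>" using rtranclp_imp_relpowp by metis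
  then obtain p where "p 0 = -\<infinity>" "p q = \<infinity>" "\<forall>j<q. R (p j) (p (Suc j))"
    unfolding relpowp_fun_conv by blast
  then show ?thesis by (intro exI[of _ q] exI[of _ p]) (auto simp: R_def)
qed

text \<open>The cells are the gaps between the cut points and the cut points themselves. On a cut point both
  endpoints of the cell agree, so atoms contribute nothing. Each gap has mass at most \<open>\<delta>\<close>, and the
  increments of a monotone function over successive gaps telescope to at most \<open>2 M\<close>. The cells do not
  depend on \<open>g\<close>.\<close>

lemma one_dimensional_cells:
  fixes \<nu> :: "real measure"
  assumes "finite_measure \<nu>" and sets_\<nu>: "sets \<nu> = sets (restrict_space borel A)" and "0 < \<delta>"
  shows "\<exists>(J :: (nat \<times> bool) set) idx lo hi. finite J \<and> idx \<in> measurable \<nu> (count_space J) \<and>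
    (\<forall>x. lo (idx x) \<le> ereal x \<and> ereal x \<le> hi (idx x)) \<and>
    (\<forall>M (g :: ereal \<Rightarrow> real). (\<forall>y. \<bar>g y\<bar> \<le> M) \<longrightarrow> mono g \<or> antimono g \<longrightarrow>
       (\<Sum>k\<in>J. measure \<nu> (idx -` {k} \<inter> space \<nu>) * \<bar>g (hi k) - g (lo k)\<bar>) \<le> 2 * M * \<delta>)"
proof -
  interpret finite_measure \<nu> by fact
  have space_\<nu>: "space \<nu> = A"
    using sets_eq_imp_space_eq[OF sets_\<nu>] by (simp add: space_restrict_space)
  have id: "(\<lambda>x. x) \<in> measurable \<nu> borel"
    using measurable_restrict_space1[OF measurable_ident, of borel A]
    by (simp add: measurable_cong_sets[OF sets_\<nu> refl] id_def)
  have borel_sets: "B \<inter> A \<in> sets \<nu>" if "B \<in> sets borel" for B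
    using measurable_sets[OF id that] by (simp add: space_\<nu>)
  have "finite_measure (distr \<nu> borel (\<lambda>x. x))" by (rule finite_measure_distr[OF id])
  from finite_cut_points[OF this sets_distr \<open>0 < \<delta>\<close>] obtain q and p :: "nat \<Rightarrow> ereal" where
    p01: "p 0 = -\<infinity>" "p q = \<infinity>" and
    p_step: "\<And>j. j < q \<Longrightarrow> p j \<le> p (Suc j) \<and>
      measure (distr \<nu> borel (\<lambda>x. x)) {x. p j < ereal x \<and> ereal x < p (Suc j)} \<le> \<delta>"
    by blast
  have p: "p 0 = -\<infinity>" "p q = \<infinity>" "\<And>j. j < q \<Longrightarrow> p j \<le> p (Suc j)"
    using p01 p_step by auto
  have gap: "measure \<nu> ({x. p j < ereal x \<and> ereal x < p (Suc j)} \<inter> A) \<le> \<delta>" if "j < q" for j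
    using p_step[OF that] by (simp add: measure_distr[OF id] space_\<nu>)
  \<comment> \<open>\<open>x\<close> lies in the half-open interval from \<open>p (num x)\<close>, exclusive, to \<open>p (Suc (num x))\<close>.\<close>
  define num where "num x = (LEAST j. ereal x \<le> p (Suc j))" for x
  \<comment> \<open>The pair with second component \<open>True\<close> is the open gap above a cut point, the one with
    \<open>False\<close> the cut point that ends this gap.\<close>
  define idx where "idx x = (num x, ereal x \<noteq> p (Suc (num x)))" for x
  define lo where "lo k = (if snd k then p (fst k) else p (Suc (fst k)))" for k
  define hi where "hi k = p (Suc (fst k))" for k :: "nat \<times> bool"
  have q0: "q \<noteq> 0" using p(1,2) by (intro notI) simp
  then obtain q' where q': "q = Suc q'" by (cases q) auto
  have num_ex: "ereal x \<le> p (Suc q')" for x using p q' by simp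
  have num_le: "ereal x \<le> p (Suc (num x))" for x
    unfolding num_def by (rule LeastI[of _ q']) (rule num_ex)
  have num_lt: "num x < q" for x
    unfolding num_def using Least_le[of "\<lambda>j. ereal x \<le> p (Suc j)", OF num_ex] q' by (metis le_imp_less_Suc)
  have num_gt: "p (num x) < ereal x" for x
  proof (cases "num x")
    case (Suc j)
    then have "\<not> ereal x \<le> p (Suc j)" unfolding num_def by (intro not_less_Least) simp
    then show ?thesis using Suc by simp
  qed (use p in simp)
  define J where "J = {..<q} \<times> (UNIV :: bool set)"
  have num_eq: "num x = j \<longleftrightarrow> ereal x \<le> p (Suc j) \<and> (\<forall>i<j. \<not> ereal x \<le> p (Suc i))" for x j
    unfolding num_def by (metis (mono_tags, lifting) LeastI_ex Least_equality leI not_less_Least num_def num_le)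
  have meas: "{x. idx x = k} \<in> sets borel" for k
  proof -
    have "{x. idx x = k} = {x. ereal x \<le> p (Suc (fst k)) \<and> (\<forall>i<fst k. \<not> ereal x \<le> p (Suc i))
      \<and> (ereal x \<noteq> p (Suc (fst k)) \<longleftrightarrow> snd k)}"
    proof -
      have "idx x = k \<longleftrightarrow> num x = fst k \<and> (ereal x \<noteq> p (Suc (fst k)) \<longleftrightarrow> snd k)" for x
        by (cases k) (auto simp: idx_def)
      then show ?thesis by (simp only: num_eq conj_assoc)
    qed
    also have "\<dots> \<in> sets borel" by measurable
    finally show ?thesis .
  qed
  show ?thesis
  proof (rule exI[of _ J], rule exI[of _ idx], rule exI[of _ lo], rule exI[of _ hi], intro conjI allI impI)
    show "finite J" by (simp add: J_def)
    show "idx \<in> measurable \<nu> (count_space J)"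
    proof (subst measurable_count_space_eq2)
      have "idx -` {k} \<inter> space \<nu> \<in> sets \<nu>" for k
        using borel_sets[OF meas[of k]] by (simp add: vimage_def space_\<nu>)
      then show "idx \<in> space \<nu> \<rightarrow> J \<and> (\<forall>a\<in>J. idx -` {a} \<inter> space \<nu> \<in> sets \<nu>)"
        using num_lt by (auto simp: idx_def J_def)
    qed fact
    show "lo (idx x) \<le> ereal x" "ereal x \<le> hi (idx x)" for x
      using num_le[of x] num_gt[of x] by (auto simp: lo_def hi_def idx_def)
    fix M and g :: "ereal \<Rightarrow> real"
    assume M: "\<forall>y. \<bar>g y\<bar> \<le> M" and g: "mono g \<or> antimono g"
    have "(\<Sum>k\<in>J. measure \<nu> (idx -` {k} \<inter> space \<nu>) * \<bar>g (hi k) - g (lo k)\<bar>)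
        = (\<Sum>j<q. measure \<nu> (idx -` {(j, True)} \<inter> space \<nu>) * \<bar>g (p (Suc j)) - g (p j)\<bar>)"
      by (simp add: J_def sum.cartesian_product' UNIV_bool lo_def hi_def)
    also have "\<dots> \<le> (\<Sum>j<q. \<delta> * \<bar>g (p (Suc j)) - g (p j)\<bar>)"
    proof (intro sum_mono mult_right_mono)
      fix j assume j: "j \<in> {..<q}"
      have "idx -` {(j, True)} \<inter> space \<nu> \<subseteq> {x. p j < ereal x \<and> ereal x < p (Suc j)} \<inter> A"
        using num_le num_gt by (auto simp: idx_def space_\<nu> less_le)
      then have "measure \<nu> (idx -` {(j, True)} \<inter> space \<nu>)
          \<le> measure \<nu> ({x. p j < ereal x \<and> ereal x < p (Suc j)} \<inter> A)"
        by (intro finite_measure_mono borel_sets) measurable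
      also have "\<dots> \<le> \<delta>" using gap j by simp
      finally show "measure \<nu> (idx -` {(j, True)} \<inter> space \<nu>) \<le> \<delta>" .
    qed auto
    also have "\<dots> = \<delta> * (\<Sum>j<q. \<bar>g (p (Suc j)) - g (p j)\<bar>)" by (simp add: sum_distrib_left)
    also have "(\<Sum>j<q. \<bar>g (p (Suc j)) - g (p j)\<bar>) = \<bar>\<Sum>j<q. g (p (Suc j)) - g (p j)\<bar>"
      using g
    proof
      assume "mono g"
      then have "0 \<le> g (p (Suc j)) - g (p j)" if "j < q" for j
        using p(3)[OF that] by (simp add: monoD)
      then show ?thesis by (subst abs_of_nonneg) (auto intro!: sum_nonneg sum.cong)
    next
      assume "antimono g"
      then have "g (p (Suc j)) - g (p j) \<le> 0" if "j < q" for j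
        using p(3)[OF that] by (simp add: antimonoD)
      then show ?thesis
        by (subst abs_of_nonpos) (auto intro!: sum_nonpos simp: sum_negf[symmetric] intro!: sum.cong)
    qed
    also have "(\<Sum>j<q. g (p (Suc j)) - g (p j)) = g (p q) - g (p 0)"
      by (rule sum_lessThan_telescope)
    also have "\<delta> * \<bar>g (p q) - g (p 0)\<bar> \<le> \<delta> * (2 * M)"
      using M[rule_format, of "p q"] M[rule_format, of "p 0"] \<open>0 < \<delta>\<close> by (intro mult_left_mono) auto
    finally show "(\<Sum>k\<in>J. measure \<nu> (idx -` {k} \<inter> space \<nu>) * \<bar>g (hi k) - g (lo k)\<bar>) \<le> 2 * M * \<delta>"
      by (simp add: mult_ac)
  qed
qed

text \<open>One passes from the upper to the lower corner of a cell by changing one coordinate at a time. With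
  the other coordinates fixed, changing coordinate \<open>i\<close> costs at most \<open>c\<close> on average over the cells
  of this coordinate. The values \<open>v\<close> outside \<open>S\<close> are free, because the induction freezes
  coordinates that have already been treated.\<close>

lemma sum_corner_difference_le:
  fixes w :: "'i \<Rightarrow> 'k \<Rightarrow> real" and F :: "('i \<Rightarrow> ereal) \<Rightarrow> real" and c :: real
  assumes "finite S"
    and J: "\<And>i. i \<in> S \<Longrightarrow> finite (J i)"
    and w: "\<And>i k. i \<in> S \<Longrightarrow> 0 \<le> w i k" "\<And>i. i \<in> S \<Longrightarrow> (\<Sum>k\<in>J i. w i k) \<le> 1"
    and one: "\<And>i v. i \<in> S \<Longrightarrow> (\<Sum>k\<in>J i. w i k * \<bar>F (v(i := hi i k)) - F (v(i := lo i k))\<bar>) \<le> c"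
  shows "(\<Sum>\<kappa>\<in>PiE S J. (\<Prod>i\<in>S. w i (\<kappa> i)) *
      \<bar>F (\<lambda>i. if i \<in> S then hi i (\<kappa> i) else v i) - F (\<lambda>i. if i \<in> S then lo i (\<kappa> i) else v i)\<bar>) \<le> card S * c"
  using assms
proof (induction S arbitrary: v rule: finite_induct)
  case (insert i S)
  let ?h = "\<lambda>v \<kappa> x. if x \<in> S then hi x (\<kappa> x) else v x"
  let ?l = "\<lambda>v \<kappa> x. if x \<in> S then lo x (\<kappa> x) else v x"
  let ?W = "\<lambda>\<kappa>. \<Prod>j\<in>S. w j (\<kappa> j)"
  have c: "0 \<le> c"
  proof -
    have "0 \<le> (\<Sum>k\<in>J i. w i k * \<bar>F (v(i := hi i k)) - F (v(i := lo i k))\<bar>)"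
      using insert.prems by (intro sum_nonneg mult_nonneg_nonneg) auto
    also have "\<dots> \<le> c" using insert.prems by blast
    finally show ?thesis .
  qed
  have W0: "0 \<le> ?W \<kappa>" for \<kappa> using insert.prems by (intro prod_nonneg) auto
  have W1: "(\<Sum>\<kappa>\<in>PiE S J. ?W \<kappa>) \<le> 1"
  proof -
    have "(\<Sum>\<kappa>\<in>PiE S J. ?W \<kappa>) = (\<Prod>j\<in>S. \<Sum>k\<in>J j. w j k)"
      using insert by (intro prod_sum_PiE[symmetric]) auto
    also have "\<dots> \<le> 1" using insert.prems by (intro prod_le_1) (auto intro!: sum_nonneg)
    finally show ?thesis .
  qed
  let ?diff = "\<lambda>\<kappa>. (\<Prod>j\<in>insert i S. w j (\<kappa> j)) *
      \<bar>F (\<lambda>x. if x \<in> insert i S then hi x (\<kappa> x) else v x)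
       - F (\<lambda>x. if x \<in> insert i S then lo x (\<kappa> x) else v x)\<bar>"
  have "(\<Sum>\<kappa>\<in>PiE (insert i S) J. ?diff \<kappa>) = (\<Sum>(k, \<kappa>)\<in>J i \<times> PiE S J. ?diff (\<kappa>(i := k)))"
    unfolding PiE_insert_eq sum.reindex[OF inj_combinator[OF \<open>i \<notin> S\<close>]]
    by (rule sum.cong) (auto simp del: fun_upd_apply)
  also have "\<dots> = (\<Sum>(k, \<kappa>)\<in>J i \<times> PiE S J. w i k * ?W \<kappa> *
      \<bar>F (?h (v(i := hi i k)) \<kappa>) - F (?l (v(i := lo i k)) \<kappa>)\<bar>)"
  proof (intro sum.cong refl, clarsimp simp only: case_prod_conv mem_Times_iff)
    fix k \<kappa>
    have 1: "(\<Prod>j\<in>insert i S. w j ((\<kappa>(i := k)) j)) = w i k * ?W \<kappa>"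
      using insert.hyps by (simp add: prod.insert) (intro disjI2 prod.cong, auto)
    have 2: "(\<lambda>x. if x \<in> insert i S then hi x ((\<kappa>(i := k)) x) else v x) = ?h (v(i := hi i k)) \<kappa>"
      "(\<lambda>x. if x \<in> insert i S then lo x ((\<kappa>(i := k)) x) else v x) = ?l (v(i := lo i k)) \<kappa>"
      using insert.hyps by (auto simp: fun_eq_iff)
    show "?diff (\<kappa>(i := k)) = w i k * ?W \<kappa> * \<bar>F (?h (v(i := hi i k)) \<kappa>) - F (?l (v(i := lo i k)) \<kappa>)\<bar>"
      unfolding 1 2 ..
  qed
  also have "\<dots> \<le> (\<Sum>(k, \<kappa>)\<in>J i \<times> PiE S J.
      w i k * (?W \<kappa> * \<bar>F (?h (v(i := hi i k)) \<kappa>) - F (?l (v(i := hi i k)) \<kappa>)\<bar>)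
      + ?W \<kappa> * (w i k * \<bar>F ((?l v \<kappa>)(i := hi i k)) - F ((?l v \<kappa>)(i := lo i k))\<bar>))"
  proof (intro sum_mono, clarsimp simp only: case_prod_conv)
    fix k \<kappa>
    have upd: "?l (v(i := y)) \<kappa> = (?l v \<kappa>)(i := y)" for y
      using insert.hyps by (auto simp: fun_eq_iff)
    let ?a = "F (?h (v(i := hi i k)) \<kappa>)" and ?b = "F ((?l v \<kappa>)(i := hi i k))"
      and ?c = "F ((?l v \<kappa>)(i := lo i k))"
    have "w i k * ?W \<kappa> * \<bar>?a - ?c\<bar> \<le> w i k * ?W \<kappa> * (\<bar>?a - ?b\<bar> + \<bar>?b - ?c\<bar>)"
      using insert.prems W0 by (intro mult_left_mono) auto
    then show "w i k * ?W \<kappa> * \<bar>F (?h (v(i := hi i k)) \<kappa>) - F (?l (v(i := lo i k)) \<kappa>)\<bar>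
      \<le> w i k * (?W \<kappa> * \<bar>F (?h (v(i := hi i k)) \<kappa>) - F (?l (v(i := hi i k)) \<kappa>)\<bar>)
      + ?W \<kappa> * (w i k * \<bar>F ((?l v \<kappa>)(i := hi i k)) - F ((?l v \<kappa>)(i := lo i k))\<bar>)"
      unfolding upd by (simp only: distrib_left mult.assoc mult.left_commute)
  qed
  also have "\<dots> = (\<Sum>k\<in>J i. w i k *
        (\<Sum>\<kappa>\<in>PiE S J. ?W \<kappa> * \<bar>F (?h (v(i := hi i k)) \<kappa>) - F (?l (v(i := hi i k)) \<kappa>)\<bar>))
      + (\<Sum>\<kappa>\<in>PiE S J. ?W \<kappa> *
        (\<Sum>k\<in>J i. w i k * \<bar>F ((?l v \<kappa>)(i := hi i k)) - F ((?l v \<kappa>)(i := lo i k))\<bar>))"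
    unfolding sum.cartesian_product[symmetric] sum.distrib sum_distrib_left
    by (subst (2) sum.swap) (rule refl)
  also have "\<dots> \<le> (\<Sum>k\<in>J i. w i k * (card S * c)) + (\<Sum>\<kappa>\<in>PiE S J. ?W \<kappa> * c)"
  proof (intro add_mono sum_mono mult_left_mono)
    show "(\<Sum>\<kappa>\<in>PiE S J. ?W \<kappa> * \<bar>F (?h v' \<kappa>) - F (?l v' \<kappa>)\<bar>) \<le> card S * c" for v'
      using insert.prems by (intro insert.IH) (blast+)
    show "(\<Sum>k\<in>J i. w i k * \<bar>F (v'(i := hi i k)) - F (v'(i := lo i k))\<bar>) \<le> c" for v'
      using insert.prems by blast
    show "0 \<le> w i k" for k using insert.prems by blast
  qed (rule W0)
  also have "\<dots> \<le> 1 * (card S * c) + 1 * c"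
    using insert.prems(3)[of i] W1 c unfolding sum_distrib_right[symmetric]
    by (intro add_mono mult_right_mono) auto
  also have "\<dots> = card (insert i S) * c" using insert.hyps by (simp add: algebra_simps)
  finally show ?case .
qed simp

section \<open>Cells adapted to coordinatewise monotone functions\<close>

text \<open>\<open>s i\<close> tells whether the function increases (\<open>True\<close>) or decreases in coordinate \<open>i\<close>.\<close>

definition coordinatewise_monotone ::
    "('i \<Rightarrow> bool) \<Rightarrow> 'i set \<Rightarrow> real set \<Rightarrow> (('i \<Rightarrow> real) \<Rightarrow> real) \<Rightarrow> bool" where
  "coordinatewise_monotone s S A f \<longleftrightarrow>
     (\<forall>x\<in>S \<rightarrow>\<^sub>E A. \<forall>y\<in>S \<rightarrow>\<^sub>E A.
        (\<forall>i\<in>S. if s i then x i \<le> y i else y i \<le> x i) \<longrightarrow> f x \<le> f y)"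

text \<open>The corners of a cell need not have their coordinates in \<open>A\<close>, and they may be infinite. The
  extension takes the supremum of \<open>f\<close> over all points of \<open>A\<^sup>S\<close> below the given one in the order
  determined by \<open>s\<close>; the value \<open>- M\<close> is added since there may be no such point.\<close>

lemma monotone_extension:
  fixes f :: "('i \<Rightarrow> real) \<Rightarrow> real"
  assumes mono: "coordinatewise_monotone s S A f" and M: "0 \<le> M" "\<And>x. x \<in> S \<rightarrow>\<^sub>E A \<Longrightarrow> \<bar>f x\<bar> \<le> M"
  shows "\<exists>F :: ('i \<Rightarrow> ereal) \<Rightarrow> real. (\<forall>v. \<bar>F v\<bar> \<le> M) \<and>
    (\<forall>v v'. (\<forall>i\<in>S. if s i then v i \<le> v' i else v' i \<le> v i) \<longrightarrow> F v \<le> F v') \<and>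
    (\<forall>x\<in>S \<rightarrow>\<^sub>E A. F (\<lambda>i. ereal (x i)) = f x)"
proof -
  define below where
    "below v = {y \<in> S \<rightarrow>\<^sub>E A. \<forall>i\<in>S. if s i then ereal (y i) \<le> v i else v i \<le> ereal (y i)}" for v :: "'i \<Rightarrow> ereal"
  define F where "F v = Sup (insert (- M) (f ` below v))" for v
  have le_M: "y \<le> M" if "y \<in> insert (- M) (f ` below v)" for v y
    using that M by (auto simp: below_def dest!: M(2))
  then have bdd: "bdd_above (insert (- M) (f ` below v))" for v by (auto intro!: bdd_aboveI)
  show ?thesis
  proof (rule exI[of _ F], intro conjI allI impI ballI)
    show "\<bar>F v\<bar> \<le> M" for v
    proof -
      have "F v \<le> M" unfolding F_def by (rule cSup_least) (use le_M in auto)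
      moreover have "- M \<le> F v" unfolding F_def by (rule cSup_upper) (use bdd in auto)
      ultimately show ?thesis by simp
    qed
    fix v v' :: "'i \<Rightarrow> ereal" assume le: "\<forall>i\<in>S. if s i then v i \<le> v' i else v' i \<le> v i"
    have "below v \<subseteq> below v'"
      using le unfolding below_def by (fastforce split: if_splits)
    then show "F v \<le> F v'" unfolding F_def by (intro cSup_subset_mono bdd) auto
  next
    fix x assume x: "x \<in> S \<rightarrow>\<^sub>E A"
    then have "x \<in> below (\<lambda>i. ereal (x i))" by (auto simp: below_def)
    moreover have "f y \<le> f x" if "y \<in> below (\<lambda>i. ereal (x i))" for y
    proof -
      have "y \<in> S \<rightarrow>\<^sub>E A" "\<forall>i\<in>S. if s i then y i \<le> x i else x i \<le> y i"
        using that by (auto simp: below_def split: if_splits)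
      then show ?thesis using x mono unfolding coordinatewise_monotone_def by blast
    qed
    moreover have "- M \<le> f x" using M(2)[OF x] by simp
    ultimately show "F (\<lambda>i. ereal (x i)) = f x"
      unfolding F_def by (intro cSup_eq_maximum) auto
  qed
qed

text \<open>The inner quantifiers say that one partition \<open>\<kappa>\<close> serves all coordinatewise monotone functions
  with bound \<open>M\<close>, whatever their signs; \<open>l\<close> and \<open>u\<close> bracket such a function on the cells.\<close>

definition adapted_cells ::
    "real set \<Rightarrow> 'i set \<Rightarrow> ('i \<Rightarrow> real) measure \<Rightarrow> real \<Rightarrow> real \<Rightarrow> 'c set \<Rightarrow> (('i \<Rightarrow> real) \<Rightarrow> 'c) \<Rightarrow> bool" where
  "adapted_cells A S Q M \<epsilon> J \<kappa> \<longleftrightarrow> finite J \<and> \<kappa> \<in> measurable Q (count_space J) \<and>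
    (\<forall>s f. coordinatewise_monotone s S A f \<longrightarrow> (\<forall>x\<in>S \<rightarrow>\<^sub>E A. \<bar>f x\<bar> \<le> M) \<longrightarrow>
      (\<exists>l u. (\<forall>x\<in>S \<rightarrow>\<^sub>E A. l (\<kappa> x) \<le> f x \<and> f x \<le> u (\<kappa> x)) \<and> (\<forall>c. \<bar>l c\<bar> \<le> M \<and> \<bar>u c\<bar> \<le> M) \<and>
        (\<Sum>c\<in>J. \<bar>u c - l c\<bar> * measure Q (\<kappa> -` {c} \<inter> space Q)) \<le> \<epsilon>))"

lemma adapted_cellsD:
  assumes "adapted_cells A S Q M \<epsilon> J \<kappa>"
  shows "finite J" "\<kappa> \<in> measurable Q (count_space J)"
    and "coordinatewise_monotone s S A f \<Longrightarrow> (\<And>x. x \<in> S \<rightarrow>\<^sub>E A \<Longrightarrow> \<bar>f x\<bar> \<le> M) \<Longrightarrow>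
      \<exists>l u. (\<forall>x\<in>S \<rightarrow>\<^sub>E A. l (\<kappa> x) \<le> f x \<and> f x \<le> u (\<kappa> x)) \<and> (\<forall>c. \<bar>l c\<bar> \<le> M \<and> \<bar>u c\<bar> \<le> M) \<and>
        (\<Sum>c\<in>J. \<bar>u c - l c\<bar> * measure Q (\<kappa> -` {c} \<inter> space Q)) \<le> \<epsilon>"
  using assms unfolding adapted_cells_def by blast+

text \<open>The cells are products of one-dimensional cells, and \<open>l\<close> and \<open>u\<close> are the values of the extended
  function at the two extreme corners of a cell.\<close>

lemma monotone_cells_product:
  fixes \<nu> :: "'i \<Rightarrow> real measure" and M \<delta> :: real
  assumes "finite S" and fin: "\<And>i. finite_measure (\<nu> i)"
    and mass: "\<And>i. measure (\<nu> i) (space (\<nu> i)) \<le> 1"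
    and sets_\<nu>: "\<And>i. sets (\<nu> i) = sets (restrict_space borel A)" and "0 < \<delta>" "0 \<le> M"
  shows "\<exists>(J :: ('i \<Rightarrow> nat \<times> bool) set) \<kappa>. adapted_cells A S (PiM S \<nu>) M (card S * (2 * M * \<delta>)) J \<kappa>"
proof -
  interpret fm: finite_measure "\<nu> i" for i by (rule fin)
  interpret product_sigma_finite \<nu> by unfold_locales
  define good where "good i J idx lo hi \<longleftrightarrow> finite J \<and> idx \<in> measurable (\<nu> i) (count_space J) \<and>
    (\<forall>x. lo (idx x) \<le> ereal x \<and> ereal x \<le> hi (idx x)) \<and>
    (\<forall>M (g :: ereal \<Rightarrow> real). (\<forall>y. \<bar>g y\<bar> \<le> M) \<longrightarrow> mono g \<or> antimono g \<longrightarrow>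
       (\<Sum>k\<in>J. measure (\<nu> i) (idx -` {k} \<inter> space (\<nu> i)) * \<bar>g (hi k) - g (lo k)\<bar>) \<le> 2 * M * \<delta>)"
    for i and J :: "(nat \<times> bool) set" and idx lo hi
  have "\<forall>i. \<exists>J idx lo hi. good i J idx lo hi"
    unfolding good_def by (intro allI one_dimensional_cells[OF fin sets_\<nu> \<open>0 < \<delta>\<close>])
  then obtain J idx lo hi where good: "\<And>i. good i (J i) (idx i) (lo i) (hi i)"
    by metis
  have J: "finite (J i)" and idx: "idx i \<in> measurable (\<nu> i) (count_space (J i))"
    and lohi: "lo i (idx i x) \<le> ereal x \<and> ereal x \<le> hi i (idx i x)" for i x
    using good[of i] by (auto simp: good_def)
  have osc: "(\<Sum>k\<in>J i. measure (\<nu> i) (idx i -` {k} \<inter> space (\<nu> i)) * \<bar>g (hi i k) - g (lo i k)\<bar>) \<le> 2 * M * \<delta>"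
    if "\<forall>y. \<bar>g y\<bar> \<le> M" "mono g \<or> antimono g" for i M and g :: "ereal \<Rightarrow> real"
    using good[of i] that unfolding good_def by blast
  define \<kappa> where "\<kappa> x = (\<lambda>i\<in>S. idx i (x i))" for x :: "'i \<Rightarrow> real"
  define w where "w i k = measure (\<nu> i) (idx i -` {k} \<inter> space (\<nu> i))" for i k
  have space_\<nu>: "space (\<nu> i) = A" for i
    using sets_eq_imp_space_eq[OF sets_\<nu>] by (simp add: space_restrict_space)
  have space: "space (PiM S \<nu>) = S \<rightarrow>\<^sub>E A" by (simp add: space_PiM space_\<nu>)
  have idx_sets: "idx i -` {k} \<inter> space (\<nu> i) \<in> sets (\<nu> i)" if "k \<in> J i" for i k
    using idx[of i] that by (intro measurable_sets[OF idx]) auto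
  have cell: "\<kappa> -` {c} \<inter> space (PiM S \<nu>) = (\<Pi>\<^sub>E i\<in>S. idx i -` {c i} \<inter> space (\<nu> i))"
    if "c \<in> PiE S J" for c
    using that by (auto simp: \<kappa>_def space_PiM PiE_iff extensional_def fun_eq_iff restrict_def)
  have cell_sets: "\<kappa> -` {c} \<inter> space (PiM S \<nu>) \<in> sets (PiM S \<nu>)" if "c \<in> PiE S J" for c
    unfolding cell[OF that] using that \<open>finite S\<close> idx_sets
    by (intro sets_PiM_I_finite) (auto simp: PiE_iff)
  have cell_measure: "measure (PiM S \<nu>) (\<kappa> -` {c} \<inter> space (PiM S \<nu>)) = (\<Prod>i\<in>S. w i (c i))"
    if "c \<in> PiE S J" for c
  proof -
    have "emeasure (PiM S \<nu>) (\<Pi>\<^sub>E i\<in>S. idx i -` {c i} \<inter> space (\<nu> i))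
        = (\<Prod>i\<in>S. emeasure (\<nu> i) (idx i -` {c i} \<inter> space (\<nu> i)))"
      using that \<open>finite S\<close> idx_sets by (intro emeasure_PiM) (auto simp: PiE_iff)
    also have "\<dots> = ennreal (\<Prod>i\<in>S. w i (c i))"
      by (simp add: w_def fm.emeasure_eq_measure prod_ennreal)
    finally show ?thesis
      unfolding cell[OF that] by (simp add: measure_def w_def prod_nonneg)
  qed
  show ?thesis
    unfolding adapted_cells_def
  proof (rule exI[of _ "PiE S J"], rule exI[of _ \<kappa>], intro conjI allI impI)
    show fin_cells: "finite (PiE S J)" using J \<open>finite S\<close> by (intro finite_PiE) auto
    show "\<kappa> \<in> measurable (PiM S \<nu>) (count_space (PiE S J))"
      unfolding measurable_count_space_eq2[OF fin_cells]
    proof (intro conjI ballI Pi_I cell_sets)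
      fix x assume "x \<in> space (PiM S \<nu>)"
      then show "\<kappa> x \<in> PiE S J"
        using measurable_space[OF idx] by (simp add: \<kappa>_def space_PiM PiE_iff)
    qed
  next
    fix s f assume f: "coordinatewise_monotone s S A f" "\<forall>x\<in>S \<rightarrow>\<^sub>E A. \<bar>f x\<bar> \<le> M"
    from monotone_extension[OF f(1) \<open>0 \<le> M\<close> f(2)[rule_format]] obtain F where F: "\<And>v. \<bar>F v\<bar> \<le> M"
      and F_mono: "\<And>v v'. \<forall>i\<in>S. if s i then v i \<le> v' i else v' i \<le> v i \<Longrightarrow> F v \<le> F v'"
      and F_ext: "\<And>x. x \<in> S \<rightarrow>\<^sub>E A \<Longrightarrow> F (\<lambda>i. ereal (x i)) = f x"
      by metis
    \<comment> \<open>In a coordinate in which \<open>f\<close> decreases the roles of the two endpoints are exchanged.\<close>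
    define a where "a i k = (if s i then lo i k else hi i k)" for i k
    define b where "b i k = (if s i then hi i k else lo i k)" for i k
    define u where "u c = F (\<lambda>i. if i \<in> S then b i (c i) else 0)" for c
    define l where "l c = F (\<lambda>i. if i \<in> S then a i (c i) else 0)" for c
    have "l (\<kappa> x) \<le> f x \<and> f x \<le> u (\<kappa> x)" if "x \<in> S \<rightarrow>\<^sub>E A" for x
      unfolding F_ext[OF that, symmetric] l_def u_def
      by (intro conjI F_mono) (auto simp: a_def b_def \<kappa>_def lohi)
    moreover have "(\<Sum>c\<in>PiE S J. (\<Prod>i\<in>S. w i (c i)) * \<bar>u c - l c\<bar>) \<le> card S * (2 * M * \<delta>)"
      unfolding u_def l_def
    proof (rule sum_corner_difference_le)
      fix i assume "i \<in> S"
      show "(\<Sum>k\<in>J i. w i k) \<le> 1"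
      proof -
        have "(\<Sum>k\<in>J i. w i k) = measure (\<nu> i) (\<Union>k\<in>J i. idx i -` {k} \<inter> space (\<nu> i))"
          unfolding w_def using idx_sets J
          by (intro fm.finite_measure_finite_Union[symmetric]) (auto simp: disjoint_family_on_def)
        also have "\<dots> \<le> measure (\<nu> i) (space (\<nu> i))" by (rule fm.bounded_measure)
        finally show ?thesis using mass[of i] by simp
      qed
    next
      fix i v assume "i \<in> S"
      have "mono (\<lambda>y. F (v(i := y))) \<or> antimono (\<lambda>y. F (v(i := y)))"
      proof (cases "s i")
        case True
        then show ?thesis by (intro disjI1 monoI F_mono) auto
      next
        case False
        then show ?thesis by (intro disjI2 antimonoI F_mono) auto
      qed
      then have "(\<Sum>k\<in>J i. w i k * \<bar>F (v(i := hi i k)) - F (v(i := lo i k))\<bar>) \<le> 2 * M * \<delta>"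
        unfolding w_def using F by (intro osc[of "\<lambda>y. F (v(i := y))"]) auto
      then show "(\<Sum>k\<in>J i. w i k * \<bar>F (v(i := b i k)) - F (v(i := a i k))\<bar>) \<le> 2 * M * \<delta>"
        by (cases "s i") (auto simp: a_def b_def abs_minus_commute)
    qed (auto simp: \<open>finite S\<close> J w_def)
    then have "(\<Sum>c\<in>PiE S J. \<bar>u c - l c\<bar> * measure (PiM S \<nu>) (\<kappa> -` {c} \<inter> space (PiM S \<nu>)))
        \<le> card S * (2 * M * \<delta>)"
      by (simp add: cell_measure mult.commute cong: sum.cong)
    ultimately show "\<exists>l u. (\<forall>x\<in>S \<rightarrow>\<^sub>E A. l (\<kappa> x) \<le> f x \<and> f x \<le> u (\<kappa> x)) \<and> (\<forall>c. \<bar>l c\<bar> \<le> M \<and> \<bar>u c\<bar> \<le> M) \<and>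
        (\<Sum>c\<in>PiE S J. \<bar>u c - l c\<bar> * measure (PiM S \<nu>) (\<kappa> -` {c} \<inter> space (PiM S \<nu>))) \<le> card S * (2 * M * \<delta>)"
      using F by (intro exI[of _ l] exI[of _ u]) (auto simp: u_def l_def)
  qed
qed

text \<open>Otherwise there are sets with summable \<open>N\<close>-measure and with \<open>Q\<close>-measure at least \<open>\<epsilon>\<close>. By
  Borel-Cantelli their limes superior is an \<open>N\<close>-null set, but its \<open>Q\<close>-measure is at least \<open>\<epsilon>\<close>.\<close>

lemma absolutely_continuous_eps_delta:
  fixes \<epsilon> :: real
  assumes "finite_measure N" "finite_measure Q" "sets Q = sets N" "absolutely_continuous N Q" "0 < \<epsilon>"
  obtains \<delta> :: real where "0 < \<delta>" "\<And>B. B \<in> sets N \<Longrightarrow> measure N B < \<delta> \<Longrightarrow> measure Q B < \<epsilon>"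
proof (rule ccontr)
  interpret N: finite_measure N by fact
  interpret Q: finite_measure Q by fact
  assume "\<not> thesis"
  then have "\<exists>B\<in>sets N. measure N B < (1/2) ^ n \<and> \<epsilon> \<le> measure Q B" for n :: nat
    using that[of "(1/2) ^ n"] by (force simp: not_less)
  then obtain B where B: "\<And>n. B n \<in> sets N" "\<And>n. measure N (B n) < (1/2) ^ n" "\<And>n. \<epsilon> \<le> measure Q (B n)"
    by metis
  have "summable (\<lambda>n. measure N (B n))"
    by (rule summable_comparison_test'[of "\<lambda>n. (1/2) ^ n"]) (use B(2) in \<open>auto intro: less_imp_le\<close>)
  then have "limsup B \<in> null_sets N"
    using B(1) by (intro borel_cantelli_limsup1) (auto simp: N.emeasure_eq_measure)
  then have "limsup B \<in> null_sets Q"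
    using assms(4) by (auto simp: absolutely_continuous_def)
  then have "measure Q (limsup B) = 0" by (simp add: measure_def null_setsD1)
  define C where "C n = (\<Union>k\<in>{n..}. B k)" for n
  have C: "C n \<in> sets Q" for n
    using B(1) by (auto simp: C_def assms(3) intro!: sets.countable_UN')
  have "decseq C"
    unfolding C_def by (intro antimonoI UN_mono) auto
  have "(\<lambda>n. measure Q (C n)) \<longlonglongrightarrow> measure Q (\<Inter>n. C n)"
    using C \<open>decseq C\<close> by (intro Q.finite_Lim_measure_decseq) auto
  moreover have "(\<Inter>n. C n) = limsup B" by (simp add: C_def limsup_INF_SUP)
  moreover have "\<epsilon> \<le> measure Q (C n)" for n
  proof -
    have "measure Q (B n) \<le> measure Q (C n)"
      using C by (intro Q.finite_measure_mono) (auto simp: C_def)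
    then show ?thesis using B(3)[of n] by simp
  qed
  ultimately have "\<epsilon> \<le> 0"
    using \<open>measure Q (limsup B) = 0\<close> by (intro LIMSEQ_le_const[of _ _ \<epsilon>]) auto
  then show False using assms(5) by simp
qed

text \<open>A \<open>\<sigma>\<close>-finite measure has the same null sets as some measure of total mass at most \<open>1\<close>.\<close>

lemma (in sigma_finite_measure) positive_density_mass_le_1:
  obtains h where "h \<in> borel_measurable M" "\<And>x. x \<in> space M \<Longrightarrow> 0 < h x" "integral\<^sup>N M h \<le> 1"
proof -
  obtain h where h: "h \<in> borel_measurable M" "integral\<^sup>N M h \<noteq> \<infinity>" "\<And>x. x \<in> space M \<Longrightarrow> 0 < h x"
    using Ex_finite_integrable_function by blast
  define c where "c = 1 + integral\<^sup>N M h"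
  have c: "c \<noteq> 0" "c \<noteq> top" using h by (auto simp: c_def ennreal_add_eq_top)
  show ?thesis
  proof (rule that[of "\<lambda>x. h x / c"])
    show "0 < h x / c" if "x \<in> space M" for x
      using h(3)[OF that] c by (simp add: ennreal_divide_eq_0_iff zero_less_iff_neq_zero)
    have "(\<integral>\<^sup>+ x. h x / c \<partial>M) = integral\<^sup>N M h / c" using h(1) by (rule nn_integral_divide)
    also have "\<dots> \<le> c / c" by (intro divide_right_mono_ennreal) (simp add: c_def)
    also have "\<dots> = 1" using c by (simp add: ennreal_divide_self less_top)
    finally show "(\<integral>\<^sup>+ x. h x / c \<partial>M) \<le> 1" .
  qed (use h in auto)
qed

lemma PiM_density:
  assumes "finite S" and \<mu>: "product_sigma_finite \<mu>" and h: "\<And>i. h i \<in> borel_measurable (\<mu> i)"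
    and \<nu>: "product_sigma_finite (\<lambda>i. density (\<mu> i) (h i))"
  shows "PiM S (\<lambda>i. density (\<mu> i) (h i)) = density (PiM S \<mu>) (\<lambda>x. \<Prod>i\<in>S. h i (x i))"
proof -
  interpret \<mu>: product_sigma_finite \<mu> by fact
  interpret \<nu>: product_sigma_finite "\<lambda>i. density (\<mu> i) (h i)" by fact
  note h[measurable]
  have "density (PiM S \<mu>) (\<lambda>x. \<Prod>i\<in>S. h i (x i)) = PiM S (\<lambda>i. density (\<mu> i) (h i))"
  proof (rule \<nu>.PiM_eqI[OF \<open>finite S\<close>])
    show "sets (density (PiM S \<mu>) (\<lambda>x. \<Prod>i\<in>S. h i (x i))) = sets (PiM S (\<lambda>i. density (\<mu> i) (h i)))"
      by (simp cong: sets_PiM_cong)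
    fix B assume "\<And>i. i \<in> S \<Longrightarrow> B i \<in> sets (density (\<mu> i) (h i))"
    then have B: "B i \<in> sets (\<mu> i)" if "i \<in> S" for i using that by simp
    have "emeasure (density (PiM S \<mu>) (\<lambda>x. \<Prod>i\<in>S. h i (x i))) (PiE S B)
        = (\<integral>\<^sup>+ x. (\<Prod>i\<in>S. h i (x i)) * indicator (PiE S B) x \<partial>PiM S \<mu>)"
      using B \<open>finite S\<close> by (intro emeasure_density sets_PiM_I_finite) (auto)
    also have "\<dots> = (\<integral>\<^sup>+ x. (\<Prod>i\<in>S. h i (x i) * indicator (B i) (x i)) \<partial>PiM S \<mu>)"
    proof (intro nn_integral_cong)
      fix x assume "x \<in> space (PiM S \<mu>)"
      then have "indicator (PiE S B) x = (\<Prod>i\<in>S. indicator (B i) (x i) :: ennreal)"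
        using \<open>finite S\<close> by (auto simp: indicator_def space_PiM PiE_iff split: if_splits intro!: prod_zero)
      then show "(\<Prod>i\<in>S. h i (x i)) * indicator (PiE S B) x = (\<Prod>i\<in>S. h i (x i) * indicator (B i) (x i))"
        by (simp add: prod.distrib)
    qed
    also have "\<dots> = (\<Prod>i\<in>S. \<integral>\<^sup>+ y. h i y * indicator (B i) y \<partial>\<mu> i)"
      using B by (intro \<mu>.product_nn_integral_prod \<open>finite S\<close>) auto
    also have "\<dots> = (\<Prod>i\<in>S. emeasure (density (\<mu> i) (h i)) (B i))"
      using B by (intro prod.cong) (auto simp: emeasure_density)
    finally show "emeasure (density (PiM S \<mu>) (\<lambda>x. \<Prod>i\<in>S. h i (x i))) (PiE S B)
      = (\<Prod>i\<in>S. emeasure (density (\<mu> i) (h i)) (B i))" .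
  qed
  then show ?thesis ..
qed

text \<open>The reference measures are first replaced by equivalent measures of mass at most \<open>1\<close>, for which
  \<open>monotone_cells_product\<close> applies with a tiny \<open>\<delta>\<close>. By Markov's inequality the cells on which \<open>f\<close>
  oscillates by more than \<open>\<epsilon> / 2\<close> have small product measure, hence small \<open>Q\<close>-measure by absolute
  continuity; there the oscillation is still bounded by \<open>2 M\<close>.\<close>

lemma monotone_cells:
  fixes \<mu> :: "'i \<Rightarrow> real measure" and M \<epsilon> :: real
  assumes "finite S" and sf: "\<And>i. sigma_finite_measure (\<mu> i)"
    and sets_\<mu>: "\<And>i. sets (\<mu> i) = sets (restrict_space borel A)"
    and Q: "prob_space Q" "sets Q = sets (PiM S \<mu>)" "absolutely_continuous (PiM S \<mu>) Q"
    and "0 \<le> M" "0 < \<epsilon>"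
  shows "\<exists>(J :: ('i \<Rightarrow> nat \<times> bool) set) \<kappa>. adapted_cells A S Q M \<epsilon> J \<kappa>"
proof -
  interpret Q: prob_space Q by fact
  have "\<exists>h. h \<in> borel_measurable (\<mu> i) \<and> (\<forall>x\<in>space (\<mu> i). 0 < h x) \<and> integral\<^sup>N (\<mu> i) h \<le> 1" for i
    using sigma_finite_measure.positive_density_mass_le_1[OF sf[of i]] by metis
  then obtain h where h: "\<And>i. h i \<in> borel_measurable (\<mu> i)"
    "\<And>i x. x \<in> space (\<mu> i) \<Longrightarrow> 0 < h i x" "\<And>i. integral\<^sup>N (\<mu> i) (h i) \<le> 1"
    by metis
  define \<nu> where "\<nu> i = density (\<mu> i) (h i)" for i
  have mass: "emeasure (\<nu> i) (space (\<nu> i)) \<le> 1" for i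
    using h(1,3)[of i] by (simp add: \<nu>_def emeasure_density cong: nn_integral_cong)
  have fin: "finite_measure (\<nu> i)" for i
    by (rule finite_measureI) (use mass[of i] in \<open>auto simp: top_unique\<close>)
  interpret fm: finite_measure "\<nu> i" for i by (rule fin)
  have mass': "measure (\<nu> i) (space (\<nu> i)) \<le> 1" for i
    using mass[of i] by (simp add: fm.emeasure_eq_measure)
  have sets_\<nu>: "sets (\<nu> i) = sets (restrict_space borel A)" for i by (simp add: \<nu>_def sets_\<mu>)
  have psf\<nu>: "product_sigma_finite \<nu>" by unfold_locales
  then interpret P: product_sigma_finite \<nu> .
  have psf\<mu>: "product_sigma_finite \<mu>" using sf by (simp add: product_sigma_finite_def)
  have sets_Q: "sets Q = sets (PiM S \<nu>)"
    using Q(2) by (simp add: \<nu>_def cong: sets_PiM_cong)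
  have space_Q: "space Q = space (PiM S \<nu>)" using sets_eq_imp_space_eq[OF sets_Q] .
  have finN: "finite_measure (PiM S \<nu>)"
  proof (rule finite_measureI)
    have "emeasure (PiM S \<nu>) (space (PiM S \<nu>)) = (\<Prod>i\<in>S. emeasure (\<nu> i) (space (\<nu> i)))"
      unfolding space_PiM by (rule P.emeasure_PiM) (auto simp: \<open>finite S\<close>)
    also have "\<dots> \<noteq> \<infinity>" by (simp add: fm.emeasure_eq_measure prod_ennreal)
    finally show "emeasure (PiM S \<nu>) (space (PiM S \<nu>)) \<noteq> \<infinity>" .
  qed
  interpret N: finite_measure "PiM S \<nu>" by fact
  have PiM_\<nu>: "PiM S \<nu> = density (PiM S \<mu>) (\<lambda>x. \<Prod>i\<in>S. h i (x i))"
    unfolding \<nu>_def by (rule PiM_density[OF \<open>finite S\<close> psf\<mu> h(1)]) (use psf\<nu> in \<open>simp add: \<nu>_def[abs_def]\<close>)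
  have ac: "absolutely_continuous (PiM S \<nu>) Q"
    unfolding absolutely_continuous_def
  proof
    fix B assume B: "B \<in> null_sets (PiM S \<nu>)"
    note h(1)[measurable]
    have meas: "(\<lambda>x. \<Prod>i\<in>S. h i (x i)) \<in> borel_measurable (PiM S \<mu>)" by measurable
    have "B \<in> sets (PiM S \<mu>)" and 0: "AE x in PiM S \<mu>. x \<in> B \<longrightarrow> (\<Prod>i\<in>S. h i (x i)) = 0"
      using B unfolding PiM_\<nu> null_sets_density_iff[OF meas] by auto
    have pos: "(\<Prod>i\<in>S. h i (x i)) \<noteq> 0" if "x \<in> space (PiM S \<mu>)" for x
      using that h(2) \<open>finite S\<close> by (auto simp: space_PiM PiE_iff zero_less_iff_neq_zero)
    from AE_space 0 have "AE x in PiM S \<mu>. x \<notin> B"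
      by eventually_elim (use pos in blast)
    then have "B \<in> null_sets (PiM S \<mu>)"
      using \<open>B \<in> sets (PiM S \<mu>)\<close> by (simp add: AE_iff_null_sets)
    then show "B \<in> null_sets Q" using Q(3) by (auto simp: absolutely_continuous_def)
  qed
  \<comment> \<open>Cells with oscillation at most \<open>\<eta>\<close> contribute at most \<open>\<eta> = \<epsilon> / 2\<close>, the others
    \<open>2 M\<close> times their \<open>Q\<close>-measure, which has to be below \<open>\<epsilon> / (4 (M + 1))\<close>.\<close>
  define \<eta> where "\<eta> = \<epsilon> / 2"
  have \<eta>: "0 < \<eta>" using \<open>0 < \<epsilon>\<close> by (simp add: \<eta>_def)
  have "0 < \<epsilon> / (4 * (M + 1))" using \<open>0 < \<epsilon>\<close> \<open>0 \<le> M\<close> by simp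
  then obtain \<theta> where \<theta>: "0 < \<theta>"
    "\<And>B. B \<in> sets (PiM S \<nu>) \<Longrightarrow> measure (PiM S \<nu>) B < \<theta> \<Longrightarrow> measure Q B < \<epsilon> / (4 * (M + 1))"
    by (rule absolutely_continuous_eps_delta[OF finN Q.finite_measure_axioms sets_Q ac]) blast
  \<comment> \<open>The summand \<open>1\<close> keeps the denominator positive when \<open>S\<close> is empty or \<open>M = 0\<close>.\<close>
  define W where "W = card S * (2 * M) + 1"
  define \<delta> where "\<delta> = \<eta> * \<theta> / (2 * W)"
  have pos: "0 < W" using \<open>0 \<le> M\<close> unfolding W_def by (intro add_nonneg_pos) auto
  then have \<delta>: "0 < \<delta>" using \<eta> \<theta> by (simp add: \<delta>_def)
  have \<delta>_small: "card S * (2 * M * \<delta>) < \<eta> * \<theta>"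
  proof -
    have "card S * (2 * M * \<delta>) \<le> W * \<delta>" using \<delta> by (simp add: W_def algebra_simps)
    also have "\<dots> = \<eta> * \<theta> / 2" using pos by (simp add: \<delta>_def)
    also have "\<dots> < \<eta> * \<theta>" using \<eta> \<theta> by simp
    finally show ?thesis .
  qed
  obtain J :: "('i \<Rightarrow> nat \<times> bool) set" and \<kappa> where
    cells: "adapted_cells A S (PiM S \<nu>) M (card S * (2 * M * \<delta>)) J \<kappa>"
    using monotone_cells_product[of S \<nu> A, OF \<open>finite S\<close> fin mass' sets_\<nu> \<delta> \<open>0 \<le> M\<close>] by (elim exE)
  note J = adapted_cellsD(1)[OF cells] and \<kappa> = adapted_cellsD(2)[OF cells]
  have \<kappa>_sets: "\<kappa> -` {c} \<inter> space Q \<in> sets Q" if "c \<in> J" for c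
    unfolding sets_Q space_Q by (rule measurable_sets[OF \<kappa>]) (use that in auto)
  show ?thesis
    unfolding adapted_cells_def
  proof (rule exI[of _ J], rule exI[of _ \<kappa>], intro conjI allI impI)
    show "finite J" by (rule J)
    show "\<kappa> \<in> measurable Q (count_space J)" using \<kappa> by (simp add: measurable_cong_sets[OF sets_Q refl])
  next
    fix s f assume f: "coordinatewise_monotone s S A f" "\<forall>x\<in>S \<rightarrow>\<^sub>E A. \<bar>f x\<bar> \<le> M"
    from adapted_cellsD(3)[OF cells f(1) f(2)[rule_format]] obtain l u where
      lu: "\<forall>x\<in>S \<rightarrow>\<^sub>E A. l (\<kappa> x) \<le> f x \<and> f x \<le> u (\<kappa> x)" "\<forall>c. \<bar>l c\<bar> \<le> M \<and> \<bar>u c\<bar> \<le> M"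
      and sum: "(\<Sum>c\<in>J. \<bar>u c - l c\<bar> * measure (PiM S \<nu>) (\<kappa> -` {c} \<inter> space Q)) \<le> card S * (2 * M * \<delta>)"
      unfolding space_Q by blast
    define bad where "bad = {c\<in>J. \<eta> < \<bar>u c - l c\<bar>}"
    let ?c = "\<lambda>c. \<kappa> -` {c} \<inter> space Q"
    have bad: "bad \<subseteq> J" "finite bad" using J by (auto simp: bad_def)
    have UnN: "measure (PiM S \<nu>) (\<Union>c\<in>bad. ?c c) = (\<Sum>c\<in>bad. measure (PiM S \<nu>) (?c c))"
      using \<kappa>_sets bad
      by (intro N.finite_measure_finite_Union) (force simp: disjoint_family_on_def sets_Q)+
    have UnQ: "measure Q (\<Union>c\<in>K. ?c c) = (\<Sum>c\<in>K. measure Q (?c c))" if "K \<subseteq> J" for K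
      using \<kappa>_sets that finite_subset[OF that J]
      by (intro Q.finite_measure_finite_Union) (force simp: disjoint_family_on_def)+
    have "\<eta> * measure (PiM S \<nu>) (\<Union>c\<in>bad. ?c c) = (\<Sum>c\<in>bad. \<eta> * measure (PiM S \<nu>) (?c c))"
      unfolding UnN sum_distrib_left ..
    also have "\<dots> \<le> (\<Sum>c\<in>bad. \<bar>u c - l c\<bar> * measure (PiM S \<nu>) (?c c))"
      by (intro sum_mono mult_right_mono) (auto simp: bad_def)
    also have "\<dots> \<le> (\<Sum>c\<in>J. \<bar>u c - l c\<bar> * measure (PiM S \<nu>) (?c c))"
      using J by (intro sum_mono2) (auto simp: bad_def)
    also have "\<dots> < \<eta> * \<theta>" using sum \<delta>_small by simp
    finally have "measure (PiM S \<nu>) (\<Union>c\<in>bad. ?c c) < \<theta>"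
      using \<eta> by (simp only: mult_less_cancel_left_pos)
    moreover have "(\<Union>c\<in>bad. ?c c) \<in> sets (PiM S \<nu>)"
      unfolding sets_Q[symmetric] using \<kappa>_sets bad by (intro sets.finite_UN) auto
    ultimately have bad_small: "measure Q (\<Union>c\<in>bad. ?c c) < \<epsilon> / (4 * (M + 1))"
      by (intro \<theta>(2))
    have "(\<Sum>c\<in>J. \<bar>u c - l c\<bar> * measure Q (?c c))
        \<le> (\<Sum>c\<in>J. \<eta> * measure Q (?c c) + (if c \<in> bad then 2 * M * measure Q (?c c) else 0))"
    proof (intro sum_mono)
      fix c assume "c \<in> J"
      have "\<bar>u c - l c\<bar> * measure Q (?c c) \<le> (\<eta> + (if c \<in> bad then 2 * M else 0)) * measure Q (?c c)"
      proof (rule mult_right_mono)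
        have "\<bar>l c\<bar> \<le> M" "\<bar>u c\<bar> \<le> M" using lu(2) by auto
        then have "\<bar>u c - l c\<bar> \<le> 2 * M" by linarith
        then show "\<bar>u c - l c\<bar> \<le> \<eta> + (if c \<in> bad then 2 * M else 0)"
          using \<open>c \<in> J\<close> \<eta> by (auto simp: bad_def)
      qed simp
      then show "\<bar>u c - l c\<bar> * measure Q (?c c)
          \<le> \<eta> * measure Q (?c c) + (if c \<in> bad then 2 * M * measure Q (?c c) else 0)"
        by (auto simp: distrib_right split: if_splits)
    qed
    also have "\<dots> = \<eta> * (\<Sum>c\<in>J. measure Q (?c c)) + 2 * M * (\<Sum>c\<in>bad. measure Q (?c c))"
      using J by (simp add: sum.distrib sum_distrib_left sum.If_cases bad_def Int_def cong: conj_cong)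
    also have "\<dots> = \<eta> * measure Q (\<Union>c\<in>J. ?c c) + 2 * M * measure Q (\<Union>c\<in>bad. ?c c)"
      unfolding UnQ[OF subset_refl] UnQ[OF bad(1)] ..
    also have "\<dots> \<le> \<eta> * 1 + 2 * (M + 1) * (\<epsilon> / (4 * (M + 1)))"
      using \<eta> \<open>0 \<le> M\<close> bad_small by (intro add_mono mult_left_mono mult_mono) auto
    also have "\<dots> = \<epsilon>" using \<open>0 \<le> M\<close> by (simp add: \<eta>_def field_simps)
    finally have "(\<Sum>c\<in>J. \<bar>u c - l c\<bar> * measure Q (?c c)) \<le> \<epsilon>" .
    then show "\<exists>l u. (\<forall>x\<in>S \<rightarrow>\<^sub>E A. l (\<kappa> x) \<le> f x \<and> f x \<le> u (\<kappa> x)) \<and> (\<forall>c. \<bar>l c\<bar> \<le> M \<and> \<bar>u c\<bar> \<le> M) \<and>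
        (\<Sum>c\<in>J. \<bar>u c - l c\<bar> * measure Q (\<kappa> -` {c} \<inter> space Q)) \<le> \<epsilon>"
      using lu by blast
  qed
qed

section \<open>Independence at a distance\<close>

text \<open>Tonelli's theorem, splitting off one block of coordinates at a time.\<close>

lemma (in product_sigma_finite) nn_integral_PiM_disjoint_prod:
  assumes "finite K" "\<And>k. k \<in> K \<Longrightarrow> finite (S k)" "disjoint_family_on S K"
    and g: "\<And>k. k \<in> K \<Longrightarrow> g k \<in> borel_measurable (PiM (S k) M)"
  shows "(\<integral>\<^sup>+ x. (\<Prod>k\<in>K. g k (restrict x (S k))) \<partial>PiM (\<Union>k\<in>K. S k) M)
    = (\<Prod>k\<in>K. \<integral>\<^sup>+ x. g k x \<partial>PiM (S k) M)"
  using assms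
proof (induction K rule: finite_induct)
  case empty
  show ?case using nn_integral_empty[of "\<lambda>_. 1"] by simp
next
  case (insert k K)
  let ?I = "S k" and ?J = "\<Union>k\<in>K. S k"
  let ?P = "\<lambda>x. \<Prod>k\<in>K. g k (restrict x (S k))"
  have disj: "?I \<inter> ?J = {}"
    using insert.prems(2) insert.hyps by (fastforce simp: disjoint_family_on_def)
  have gm: "(\<lambda>x. g j (restrict x (S j))) \<in> borel_measurable (PiM L M)"
    if "j \<in> insert k K" "S j \<subseteq> L" for j L
    by (rule measurable_compose[OF measurable_restrict_subset[OF that(2)] insert.prems(3)[OF that(1)]])
  have Pm: "?P \<in> borel_measurable (PiM ?J M)"
    by (intro borel_measurable_prod_ennreal gm) auto
  have "(\<integral>\<^sup>+ x. (\<Prod>k\<in>insert k K. g k (restrict x (S k))) \<partial>PiM (?I \<union> ?J) M)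
    = (\<integral>\<^sup>+ x. (\<integral>\<^sup>+ y. (\<Prod>j\<in>insert k K. g j (restrict (merge ?I ?J (x, y)) (S j))) \<partial>PiM ?J M) \<partial>PiM ?I M)"
    using disj insert.hyps insert.prems(1)
    by (intro product_nn_integral_fold borel_measurable_prod_ennreal gm) auto
  also have "\<dots> = (\<integral>\<^sup>+ x. (\<integral>\<^sup>+ y. g k x * ?P y \<partial>PiM ?J M) \<partial>PiM ?I M)"
  proof (intro nn_integral_cong)
    fix x y assume x: "x \<in> space (PiM ?I M)" and y: "y \<in> space (PiM ?J M)"
    have "restrict (merge ?I ?J (x, y)) (S k) = x"
      using x disj by (simp add: space_PiM PiE_restrict)
    moreover have "restrict (merge ?I ?J (x, y)) (S j) = restrict y (S j)" if "j \<in> K" for j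
      using that disj by (auto simp: restrict_def merge_def fun_eq_iff)
    ultimately show "(\<Prod>j\<in>insert k K. g j (restrict (merge ?I ?J (x, y)) (S j))) = g k x * ?P y"
      using insert.hyps by (simp cong: prod.cong)
  qed
  also have "\<dots> = (\<integral>\<^sup>+ x. g k x * (\<integral>\<^sup>+ y. ?P y \<partial>PiM ?J M) \<partial>PiM ?I M)"
    using Pm by (simp add: nn_integral_cmult)
  also have "\<dots> = (\<integral>\<^sup>+ x. g k x \<partial>PiM ?I M) * (\<integral>\<^sup>+ y. ?P y \<partial>PiM ?J M)"
    using insert.prems(3)[of k] by (intro nn_integral_multc) auto
  also have "(\<integral>\<^sup>+ y. ?P y \<partial>PiM ?J M) = (\<Prod>k\<in>K. \<integral>\<^sup>+ x. g k x \<partial>PiM (S k) M)"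
    using insert.prems by (intro insert.IH) (auto simp: disjoint_family_on_def)
  finally show ?case using insert.hyps by simp
qed

lemma space_cspace: "space (cspace A S) = S \<rightarrow>\<^sub>E A"
  by (simp add: cspace_def space_PiM space_restrict_space)

lemma sets_PiM_eq_cspace:
  assumes "\<And>z. sets (\<mu> z) = sets (restrict_space borel A)"
  shows "sets (PiM S \<mu>) = sets (cspace A S)"
  unfolding cspace_def using assms by (intro sets_PiM_cong) auto

locale coloring_process = prob_space P for P :: "(int ^ 'd \<Rightarrow> real) measure" +
  fixes A :: "real set" and \<mu> :: "int ^ 'd \<Rightarrow> real measure" and r :: nat
  assumes sets_P: "sets P = sets (cspace A UNIV)"
    and M1: "M1 P" and M2: "M2 A P \<mu>" and M3: "M3 A P \<mu> r"
begin

lemma space_P: "space P = Omega A"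
  using sets_eq_imp_space_eq[OF sets_P] by (simp add: space_cspace)

lemma sigma_finite_\<mu>: "sigma_finite_measure (\<mu> z)"
  and sets_\<mu>: "sets (\<mu> z) = sets (restrict_space borel A)"
  and abs_cont: "finite S \<Longrightarrow> absolutely_continuous (PiM S \<mu>) (marginal A P S)"
  using M2 by (auto simp: M2_def)

sublocale \<mu>: product_sigma_finite \<mu>
  by (simp add: product_sigma_finite_def sigma_finite_\<mu>)

lemma sets_PiM_\<mu>: "sets (PiM S \<mu>) = sets (cspace A S)"
  by (rule sets_PiM_eq_cspace) (rule sets_\<mu>)

lemma measurable_restrict_P: "(\<lambda>\<omega>. restrict \<omega> S) \<in> measurable P (cspace A S)"
  unfolding measurable_cong_sets[OF sets_P refl] cspace_def
  by (rule measurable_restrict_subset) simp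

lemma measurable_tau: "tau z \<in> measurable P P"
  unfolding measurable_cong_sets[OF sets_P sets_P] cspace_def tau_def
  by (rule measurable_PiM_single') (auto simp: space_PiM space_restrict_space)

lemma sets_marginal: "sets (marginal A P S) = sets (cspace A S)"
  and space_marginal: "space (marginal A P S) = S \<rightarrow>\<^sub>E A"
  by (simp_all add: marginal_def space_cspace)

lemma prob_space_marginal: "prob_space (marginal A P S)"
  unfolding marginal_def by (rule prob_space_distr[OF measurable_restrict_P])

lemma emeasure_marginal:
  "B \<in> sets (cspace A S) \<Longrightarrow> emeasure (marginal A P S) B = emeasure P {\<omega>\<in>space P. restrict \<omega> S \<in> B}"
  unfolding marginal_def
  by (subst emeasure_distr[OF measurable_restrict_P]) (auto intro!: arg_cong[where f = "emeasure P"])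

lemma sets_restrict_P:
  "B \<in> sets (cspace A S) \<Longrightarrow> {\<omega>\<in>space P. restrict \<omega> S \<in> B} \<in> sets P"
  using measurable_sets[OF measurable_restrict_P] by (simp add: vimage_def Int_def conj_commute)

lemma marginal_eq_density:
  assumes "finite S"
  shows "marginal A P S = density (PiM S \<mu>) (rho A P \<mu> S)"
proof -
  interpret finite_product_sigma_finite \<mu> S by unfold_locales (rule assms)
  show ?thesis
    unfolding rho_def
    by (rule density_RN_deriv[symmetric]) (use abs_cont[OF assms] in \<open>auto simp: sets_marginal sets_PiM_\<mu>\<close>)
qed

lemma rho_measurable: "rho A P \<mu> S \<in> borel_measurable (PiM S \<mu>)"
  unfolding rho_def by (rule borel_measurable_RN_deriv)

text \<open>(M3) is formulated for families indexed by \<open>{1..n}\<close>; enumerating the index set gives it for every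
  finite nonempty family.\<close>

lemma rho_Union:
  assumes "finite K" "K \<noteq> {}" and S: "\<And>k. k \<in> K \<Longrightarrow> finite (S k) \<and> S k \<noteq> {}"
    and sep: "\<And>k l. k \<in> K \<Longrightarrow> l \<in> K \<Longrightarrow> k \<noteq> l \<Longrightarrow> enat r < sdist (S k) (S l)"
  shows "AE \<eta> in PiM (\<Union>k\<in>K. S k) \<mu>.
    rho A P \<mu> (\<Union>k\<in>K. S k) \<eta> = (\<Prod>k\<in>K. rho A P \<mu> (S k) (restrict \<eta> (S k)))"
proof -
  obtain h where h: "bij_betw h {1..card K} K"
    using ex_bij_betw_nat_finite_1[OF \<open>finite K\<close>] by blast
  have hK: "h i \<in> K" if "i \<in> {1..card K}" for i using bij_betwE[OF h] that by blast
  have hne: "h i \<noteq> h j" if "i \<in> {1..card K}" "j \<in> {1..card K}" "i \<noteq> j" for i j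
    using inj_onD[OF bij_betw_imp_inj_on[OF h]] that by blast
  have Un: "(\<Union>i\<in>{1..card K}. S (h i)) = (\<Union>k\<in>K. S k)"
    using bij_betw_imp_surj_on[OF h] by (metis image_image)
  have "1 \<le> card K" using assms(1,2) by (simp add: Suc_le_eq card_gt_0_iff)
  moreover have "(\<forall>i\<in>{1..card K}. finite (S (h i)) \<and> S (h i) \<noteq> {}) \<and>
      (\<forall>i\<in>{1..card K}. \<forall>j\<in>{1..card K}. i \<noteq> j \<longrightarrow> enat r < sdist (S (h i)) (S (h j)))"
  proof (rule conjI; rule ballI)
    fix i assume i: "i \<in> {1..card K}"
    show "finite (S (h i)) \<and> S (h i) \<noteq> {}" by (rule S[OF hK[OF i]])
    show "\<forall>j\<in>{1..card K}. i \<noteq> j \<longrightarrow> enat r < sdist (S (h i)) (S (h j))"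
      using sep[OF hK[OF i] hK hne[OF i]] by blast
  qed
  ultimately have "AE \<eta> in PiM (\<Union>i\<in>{1..card K}. S (h i)) \<mu>.
      rho A P \<mu> (\<Union>i\<in>{1..card K}. S (h i)) \<eta> = (\<Prod>i\<in>{1..card K}. rho A P \<mu> (S (h i)) (restrict \<eta> (S (h i))))"
    by (rule M3[unfolded M3_def, THEN spec, THEN mp, THEN spec[of _ "\<lambda>i. S (h i)"], THEN mp])
  then show ?thesis
    unfolding Un prod.reindex_bij_betw[OF h, of "\<lambda>k. rho A P \<mu> (S k) (restrict _ (S k))"] .
qed

text \<open>The density factorises by (M3), so its integral over a product event does, too.\<close>

lemma emeasure_separated:
  assumes "finite K" "K \<noteq> {}" and S: "\<And>k. k \<in> K \<Longrightarrow> finite (S k) \<and> S k \<noteq> {}"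
    and sep: "\<And>k l. k \<in> K \<Longrightarrow> l \<in> K \<Longrightarrow> k \<noteq> l \<Longrightarrow> enat r < sdist (S k) (S l)"
    and B: "\<And>k. k \<in> K \<Longrightarrow> B k \<in> sets (cspace A (S k))"
  shows "emeasure P {\<omega>\<in>space P. \<forall>k\<in>K. restrict \<omega> (S k) \<in> B k}
    = (\<Prod>k\<in>K. emeasure P {\<omega>\<in>space P. restrict \<omega> (S k) \<in> B k})"
proof -
  let ?U = "\<Union>k\<in>K. S k"
  let ?C = "{\<eta>\<in>space (cspace A ?U). \<forall>k\<in>K. restrict \<eta> (S k) \<in> B k}"
  have finU: "finite ?U" using S \<open>finite K\<close> by auto
  have disj: "disjoint_family_on S K"
    unfolding disjoint_family_on_def
  proof (intro ballI impI, rule ccontr)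
    fix k l assume kl: "k \<in> K" "l \<in> K" "k \<noteq> l" "S k \<inter> S l \<noteq> {}"
    then obtain x where x: "x \<in> S k" "x \<in> S l" by blast
    then have "sdist (S k) (S l) \<le> enat (ldist x x)"
      unfolding sdist_def by (intro INF_lower2[OF x(1)] INF_lower x(2))
    also have "\<dots> \<le> enat r" by (simp add: ldist_def)
    finally show False using sep[OF kl(1-3)] by simp
  qed
  have restr: "(\<lambda>\<eta>. restrict \<eta> (S k)) \<in> measurable (cspace A ?U) (cspace A (S k))" if "k \<in> K" for k
    unfolding cspace_def using that by (intro measurable_restrict_subset) auto
  have C: "?C \<in> sets (cspace A ?U)"
  proof (rule sets.sets_Collect_finite_All'[OF _ \<open>finite K\<close> \<open>K \<noteq> {}\<close>])
    fix k assume "k \<in> K"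
    with measurable_sets[OF restr[OF this] B[OF this]]
    show "{\<eta>\<in>space (cspace A ?U). restrict \<eta> (S k) \<in> B k} \<in> sets (cspace A ?U)"
      by (simp add: vimage_def Int_def conj_commute)
  qed
  have single: "(\<integral>\<^sup>+ \<eta>. rho A P \<mu> (S k) \<eta> * indicator (B k) \<eta> \<partial>PiM (S k) \<mu>)
      = emeasure P {\<omega>\<in>space P. restrict \<omega> (S k) \<in> B k}" if "k \<in> K" for k
    using that S B emeasure_marginal[OF B[OF that]]
    by (simp add: marginal_eq_density emeasure_density rho_measurable sets_PiM_\<mu>)
  have "{\<omega>\<in>space P. \<forall>k\<in>K. restrict \<omega> (S k) \<in> B k} = {\<omega>\<in>space P. restrict \<omega> ?U \<in> ?C}"
  proof -
    have "restrict (restrict \<omega> ?U) (S k) = restrict \<omega> (S k)" if "k \<in> K" for \<omega> :: "int ^ 'd \<Rightarrow> real" and k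
      using that by (auto simp: restrict_def fun_eq_iff)
    moreover have "restrict \<omega> ?U \<in> space (cspace A ?U)" if "\<omega> \<in> space P" for \<omega>
      using measurable_space[OF measurable_restrict_P that] .
    ultimately show ?thesis by (auto simp del: restrict_apply)
  qed
  then have "emeasure P {\<omega>\<in>space P. \<forall>k\<in>K. restrict \<omega> (S k) \<in> B k} = emeasure (marginal A P ?U) ?C"
    using emeasure_marginal[OF C] by simp
  also have "\<dots> = (\<integral>\<^sup>+ \<eta>. rho A P \<mu> ?U \<eta> * indicator ?C \<eta> \<partial>PiM ?U \<mu>)"
    using C by (simp add: marginal_eq_density[OF finU] emeasure_density rho_measurable sets_PiM_\<mu>)
  also have "\<dots> = (\<integral>\<^sup>+ \<eta>. (\<Prod>k\<in>K. rho A P \<mu> (S k) (restrict \<eta> (S k)) * indicator (B k) (restrict \<eta> (S k))) \<partial>PiM ?U \<mu>)"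
  proof (rule nn_integral_cong_AE)
    have "AE \<eta> in PiM ?U \<mu>. rho A P \<mu> ?U \<eta> = (\<Prod>k\<in>K. rho A P \<mu> (S k) (restrict \<eta> (S k)))"
      by (rule rho_Union[OF assms(1,2)]) (use S sep in auto)
    then show "AE \<eta> in PiM ?U \<mu>. rho A P \<mu> ?U \<eta> * indicator ?C \<eta>
      = (\<Prod>k\<in>K. rho A P \<mu> (S k) (restrict \<eta> (S k)) * indicator (B k) (restrict \<eta> (S k)))"
      using AE_space
    proof eventually_elim
      case (elim \<eta>)
      have "\<eta> \<in> space (cspace A ?U)"
        using elim(2) sets_eq_imp_space_eq[OF sets_PiM_\<mu>[of ?U]] by simp
      then have "indicator ?C \<eta> = (\<Prod>k\<in>K. indicator (B k) (restrict \<eta> (S k)) :: ennreal)"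
        using \<open>finite K\<close> by (auto simp: indicator_def intro!: prod_zero)
      then show ?case by (simp only: elim(1) prod.distrib)
    qed
  qed
  also have "\<dots> = (\<Prod>k\<in>K. \<integral>\<^sup>+ \<eta>. rho A P \<mu> (S k) \<eta> * indicator (B k) \<eta> \<partial>PiM (S k) \<mu>)"
  proof (rule \<mu>.nn_integral_PiM_disjoint_prod[OF \<open>finite K\<close> _ disj])
    show "finite (S k)" if "k \<in> K" for k using S[OF that] by blast
    show "(\<lambda>\<eta>. rho A P \<mu> (S k) \<eta> * indicator (B k) \<eta>) \<in> borel_measurable (PiM (S k) \<mu>)" if "k \<in> K" for k
    proof -
      note rho_measurable[measurable]
      have [measurable]: "B k \<in> sets (PiM (S k) \<mu>)" using B[OF that] by (simp add: sets_PiM_\<mu>)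
      show ?thesis by measurable
    qed
  qed
  also have "\<dots> = (\<Prod>k\<in>K. emeasure P {\<omega>\<in>space P. restrict \<omega> (S k) \<in> B k})"
    by (intro prod.cong single) auto
  finally show ?thesis .
qed

lemma indep_vars_separated:
  assumes S: "\<And>k. k \<in> K \<Longrightarrow> finite (S k) \<and> S k \<noteq> {}"
    and sep: "\<And>k l. k \<in> K \<Longrightarrow> l \<in> K \<Longrightarrow> k \<noteq> l \<Longrightarrow> enat r < sdist (S k) (S l)"
  shows "indep_vars (\<lambda>k. cspace A (S k)) (\<lambda>k \<omega>. restrict \<omega> (S k)) K"
  unfolding indep_vars_def2 indep_sets_def
proof (intro conjI ballI allI impI)
  fix k show "(\<lambda>\<omega>. restrict \<omega> (S k)) \<in> measurable P (cspace A (S k))" by (rule measurable_restrict_P)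
  show "{(\<lambda>\<omega>. restrict \<omega> (S k)) -` B \<inter> space P |B. B \<in> sets (cspace A (S k))} \<subseteq> events"
    using measurable_sets[OF measurable_restrict_P] by auto
next
  fix L E assume L: "L \<subseteq> K" "L \<noteq> {}" "finite L"
    and "E \<in> Pi L (\<lambda>k. {(\<lambda>\<omega>. restrict \<omega> (S k)) -` B \<inter> space P |B. B \<in> sets (cspace A (S k))})"
  then have "\<forall>k\<in>L. \<exists>B. B \<in> sets (cspace A (S k)) \<and> E k = (\<lambda>\<omega>. restrict \<omega> (S k)) -` B \<inter> space P"
    by fast
  then obtain B where "\<forall>k\<in>L. B k \<in> sets (cspace A (S k)) \<and> E k = (\<lambda>\<omega>. restrict \<omega> (S k)) -` B k \<inter> space P"
    by (rule bchoice[THEN exE])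
  then have B: "\<And>k. k \<in> L \<Longrightarrow> B k \<in> sets (cspace A (S k))"
    "\<And>k. k \<in> L \<Longrightarrow> E k = {\<omega>\<in>space P. restrict \<omega> (S k) \<in> B k}"
    by auto
  have "(\<Inter>k\<in>L. E k) = {\<omega>\<in>space P. \<forall>k\<in>L. restrict \<omega> (S k) \<in> B k}"
    using B(2) L(2) by auto
  then have "emeasure P (\<Inter>k\<in>L. E k) = (\<Prod>k\<in>L. emeasure P (E k))"
    using emeasure_separated[of L S B, OF L(3,2)] S sep B L(1) by (simp add: subset_iff)
  then show "prob (\<Inter>k\<in>L. E k) = (\<Prod>k\<in>L. prob (E k))"
    by (simp add: emeasure_eq_measure prod_ennreal prod_nonneg)
qed
end

section \<open>Averages and integrals over finitely many cells\<close>

lemma borel_measurable_completion_AE: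
  fixes g g' :: "'a \<Rightarrow> real"
  assumes g': "g' \<in> borel_measurable M" and eq: "AE x in M. g x = g' x"
  shows "g \<in> borel_measurable (completion M)"
  unfolding borel_measurable_iff_le
proof
  fix a
  have "Measurable.pred (completion M) (\<lambda>x. g x \<noteq> g' x)"
    "Measurable.pred (completion M) (\<lambda>x. g x \<noteq> g' x \<and> g x \<le> a)"
    by (rule sets_completion_AE; use eq in eventually_elim; simp)+
  moreover have "Measurable.pred (completion M) (\<lambda>x. g' x \<le> a)"
    using measurable_completion[OF g'] by measurable
  ultimately have "Measurable.pred (completion M) (\<lambda>x. (g' x \<le> a \<and> \<not> g x \<noteq> g' x) \<or> (g x \<noteq> g' x \<and> g x \<le> a))"
    by measurable
  also have "(\<lambda>x. (g' x \<le> a \<and> \<not> g x \<noteq> g' x) \<or> (g x \<noteq> g' x \<and> g x \<le> a)) = (\<lambda>x. g x \<le> a)"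
    by auto
  finally show "{x \<in> space (completion M). g x \<le> a} \<in> sets (completion M)"
    by (rule predE)
qed

text \<open>The supremum of the lower functions is measurable. It differs from \<open>f\<close> only where the gaps
  \<open>u n - l n\<close> stay away from \<open>0\<close>, and this is a null set because their integrals tend to \<open>0\<close>.\<close>

lemma borel_measurable_completion_sandwich:
  fixes f :: "'a \<Rightarrow> real"
  assumes [measurable]: "\<And>n::nat. l n \<in> borel_measurable M" "\<And>n. u n \<in> borel_measurable M"
    and le: "\<And>n x. x \<in> space M \<Longrightarrow> l n x \<le> f x \<and> f x \<le> u n x"
    and small: "\<And>n. (\<integral>\<^sup>+ x. ennreal (u n x - l n x) \<partial>M) \<le> ennreal (1 / Suc n)"
  shows "f \<in> borel_measurable (completion M)"
proof (rule borel_measurable_completion_AE)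
  define L where "L x = (SUP n. l n x)" for x
  have bdd: "bdd_above (range (\<lambda>n. l n x))" if "x \<in> space M" for x
    using le[OF that] by (auto intro!: bdd_aboveI)
  show "L \<in> borel_measurable M"
    unfolding L_def by (intro borel_measurable_cSUP) (use bdd in auto)
  define H where "H x = (INF n. ennreal (u n x - l n x))" for x
  have [measurable]: "H \<in> borel_measurable M" unfolding H_def by measurable
  have le_n: "integral\<^sup>N M H \<le> ennreal (1 / Suc n)" for n
    using small[of n] by (rule order_trans[rotated]) (auto simp: H_def intro!: nn_integral_mono INF_lower)
  have "integral\<^sup>N M H \<le> 0"
  proof (rule ennreal_le_epsilon)
    fix e :: real assume "0 < e"
    then obtain n where "1 / Suc n < e" using nat_approx_posE by blast
    then show "integral\<^sup>N M H \<le> 0 + ennreal e"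
      using order_trans[OF le_n[of n] ennreal_leI[of "1 / Suc n" e]] by simp
  qed
  then have "AE x in M. H x = 0" by (simp add: nn_integral_0_iff_AE)
  then show "AE x in M. f x = L x"
    using AE_space
  proof eventually_elim
    case (elim x)
    have "f x - L x \<le> u n x - l n x" for n
    proof -
      have "l n x \<le> L x" unfolding L_def by (intro cSUP_upper bdd elim) auto
      then show ?thesis using le[OF elim(2), of n] by simp
    qed
    then have "ennreal (f x - L x) \<le> H x"
      unfolding H_def by (intro INF_greatest ennreal_leI)
    then have "f x \<le> L x" using elim(1) by (simp add: ennreal_eq_0_iff)
    moreover have "L x \<le> f x" unfolding L_def using le[OF elim(2)] by (intro cSUP_least) auto
    ultimately show ?case by simp
  qed
qed

lemma integral_cells:
  fixes h :: "'b \<Rightarrow> real"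
  assumes "finite_measure M" "finite J" and \<kappa>: "\<kappa> \<in> measurable M (count_space J)"
  shows "(\<lambda>x. h (\<kappa> x)) \<in> borel_measurable M" "integrable M (\<lambda>x. h (\<kappa> x))"
    and "(\<integral>x. h (\<kappa> x) \<partial>M) = (\<Sum>c\<in>J. h c * measure M (\<kappa> -` {c} \<inter> space M))"
proof -
  interpret finite_measure M by fact
  have cell: "\<kappa> -` {c} \<inter> space M \<in> sets M" if "c \<in> J" for c
    by (rule measurable_sets[OF \<kappa>]) (use that in auto)
  show meas: "(\<lambda>x. h (\<kappa> x)) \<in> borel_measurable M"
    by (rule measurable_compose[OF \<kappa>]) simp
  have eq: "h (\<kappa> x) = (\<Sum>c\<in>J. h c * indicator (\<kappa> -` {c} \<inter> space M) x)" if "x \<in> space M" for x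
  proof -
    have "(\<Sum>c\<in>J. h c * indicator (\<kappa> -` {c} \<inter> space M) x) = (\<Sum>c\<in>J. if c = \<kappa> x then h c else 0)"
      using that by (intro sum.cong) (auto simp: indicator_def)
    then show ?thesis using measurable_space[OF \<kappa> that] \<open>finite J\<close> by simp
  qed
  have int: "integrable M (\<lambda>x. \<Sum>c\<in>J. h c * indicator (\<kappa> -` {c} \<inter> space M) x)"
    using cell by (intro Bochner_Integration.integrable_sum) (auto simp: less_top[symmetric])
  then show "integrable M (\<lambda>x. h (\<kappa> x))"
    by (rule Bochner_Integration.integrable_cong[THEN iffD1, rotated 2]) (use eq in auto)
  have "(\<integral>x. h (\<kappa> x) \<partial>M) = (\<integral>x. (\<Sum>c\<in>J. h c * indicator (\<kappa> -` {c} \<inter> space M) x) \<partial>M)"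
    by (rule Bochner_Integration.integral_cong) (use eq in auto)
  also have "\<dots> = (\<Sum>c\<in>J. h c * measure M (\<kappa> -` {c} \<inter> space M))"
    using cell by (subst Bochner_Integration.integral_sum) (auto simp: less_top[symmetric])
  finally show "(\<integral>x. h (\<kappa> x) \<partial>M) = (\<Sum>c\<in>J. h c * measure M (\<kappa> -` {c} \<inter> space M))" .
qed

lemma average_cells:
  fixes h :: "'b \<Rightarrow> real"
  assumes "finite J" "\<And>t. t \<in> T \<Longrightarrow> X t \<in> W" "\<And>x. x \<in> W \<Longrightarrow> \<kappa> x \<in> J"
  shows "(\<Sum>t\<in>T. h (\<kappa> (X t))) / N = (\<Sum>c\<in>J. h c * ((\<Sum>t\<in>T. indicator (\<kappa> -` {c} \<inter> W) (X t)) / N))"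
proof -
  have "(\<Sum>t\<in>T. h (\<kappa> (X t))) = (\<Sum>t\<in>T. \<Sum>c\<in>J. h c * indicator (\<kappa> -` {c} \<inter> W) (X t))"
  proof (intro sum.cong refl)
    fix t assume t: "t \<in> T"
    have "(\<Sum>c\<in>J. h c * indicator (\<kappa> -` {c} \<inter> W) (X t)) = (\<Sum>c\<in>J. if c = \<kappa> (X t) then h c else 0)"
      using assms(2)[OF t] by (intro sum.cong) (auto simp: indicator_def)
    then show "h (\<kappa> (X t)) = (\<Sum>c\<in>J. h c * indicator (\<kappa> -` {c} \<inter> W) (X t))"
      using assms t by simp
  qed
  also have "\<dots> = (\<Sum>c\<in>J. h c * (\<Sum>t\<in>T. indicator (\<kappa> -` {c} \<inter> W) (X t)))"
    by (subst sum.swap) (simp add: sum_distrib_left)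
  finally show ?thesis by (simp add: sum_divide_distrib[symmetric])
qed

text \<open>If all frequencies were equal to the probabilities, the average and the integral would both lie
  between \<open>\<Sum>c. l c * Q(c)\<close> and \<open>\<Sum>c. u c * Q(c)\<close>, which differ by at most \<open>\<epsilon>\<close>. Only the finitely
  many frequencies enter the remaining error, which is what makes the estimate uniform in \<open>f\<close>.\<close>

lemma average_minus_integral_le:
  fixes f :: "'a \<Rightarrow> real"
  assumes Q: "prob_space Q" and J: "finite J" and \<kappa>: "\<kappa> \<in> measurable Q (count_space J)"
    and f: "f \<in> borel_measurable (completion Q)"
    and lu: "\<And>x. x \<in> space Q \<Longrightarrow> l (\<kappa> x) \<le> f x \<and> f x \<le> u (\<kappa> x)"
    and M: "\<And>c. \<bar>l c\<bar> \<le> M \<and> \<bar>u c\<bar> \<le> M"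
    and osc: "(\<Sum>c\<in>J. \<bar>u c - l c\<bar> * measure Q (\<kappa> -` {c} \<inter> space Q)) \<le> \<epsilon>"
    and T: "finite T" and X: "\<And>t. t \<in> T \<Longrightarrow> X t \<in> space Q"
  shows "\<bar>(\<Sum>t\<in>T. f (X t)) / card T - (\<integral>x. f x \<partial>completion Q)\<bar>
    \<le> \<epsilon> + M * (\<Sum>c\<in>J. \<bar>(\<Sum>t\<in>T. indicator (\<kappa> -` {c} \<inter> space Q) (X t)) / card T
      - measure Q (\<kappa> -` {c} \<inter> space Q)\<bar>)"
proof -
  interpret prob_space Q by fact
  define q where "q c = measure Q (\<kappa> -` {c} \<inter> space Q)" for c
  define p where "p c = (\<Sum>t\<in>T. indicator (\<kappa> -` {c} \<inter> space Q) (X t)) / real (card T)" for c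
  define a where "a = (\<Sum>t\<in>T. f (X t)) / card T"
  define I where "I = (\<integral>x. f x \<partial>completion Q)"
  note cells = integral_cells[OF finite_measure_axioms J \<kappa>]
  have comp: "integrable (completion Q) (\<lambda>x. h (\<kappa> x))"
    "(\<integral>x. h (\<kappa> x) \<partial>completion Q) = (\<Sum>c\<in>J. h c * q c)" for h :: "_ \<Rightarrow> real"
    using cells[of h] by (auto simp: integrable_completion integral_completion q_def)
  have intf: "integrable (completion Q) f"
  proof (rule Bochner_Integration.integrable_bound[OF _ f])
    show "integrable (completion Q) (\<lambda>x. M)" using comp(1)[of "\<lambda>_. M"] .
    have "\<bar>f x\<bar> \<le> M" if "x \<in> space Q" for x using lu[OF that] M[of "\<kappa> x"] by linarith
    then show "AE x in completion Q. norm (f x) \<le> norm M"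
      by (intro AE_I2) (force intro: order_trans)
  qed
  have I: "(\<Sum>c\<in>J. l c * q c) \<le> I" "I \<le> (\<Sum>c\<in>J. u c * q c)"
    unfolding I_def comp(2)[symmetric] using lu by (auto intro!: integral_mono comp(1) intf)
  have avg: "(\<Sum>t\<in>T. h (\<kappa> (X t))) / card T = (\<Sum>c\<in>J. h c * p c)" for h :: "_ \<Rightarrow> real"
    unfolding p_def using measurable_space[OF \<kappa>] by (intro average_cells J X) auto
  have a: "(\<Sum>c\<in>J. l c * p c) \<le> a" "a \<le> (\<Sum>c\<in>J. u c * p c)"
    unfolding a_def avg[symmetric] using lu X by (auto intro!: divide_right_mono sum_mono)
  have diff: "\<bar>(\<Sum>c\<in>J. h c * p c) - (\<Sum>c\<in>J. h c * q c)\<bar> \<le> M * (\<Sum>c\<in>J. \<bar>p c - q c\<bar>)"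
    if "\<And>c. \<bar>h c\<bar> \<le> M" for h
  proof -
    have "\<bar>(\<Sum>c\<in>J. h c * p c) - (\<Sum>c\<in>J. h c * q c)\<bar> = \<bar>\<Sum>c\<in>J. h c * (p c - q c)\<bar>"
      by (simp add: sum_subtractf algebra_simps)
    also have "\<dots> \<le> (\<Sum>c\<in>J. \<bar>h c * (p c - q c)\<bar>)" by (rule sum_abs)
    also have "\<dots> \<le> (\<Sum>c\<in>J. M * \<bar>p c - q c\<bar>)"
      using that by (intro sum_mono) (simp add: abs_mult mult_right_mono)
    finally show ?thesis by (simp add: sum_distrib_left)
  qed
  have ul: "(\<Sum>c\<in>J. u c * q c) - (\<Sum>c\<in>J. l c * q c) \<le> \<epsilon>"
  proof -
    have "(\<Sum>c\<in>J. u c * q c) - (\<Sum>c\<in>J. l c * q c) = (\<Sum>c\<in>J. (u c - l c) * q c)"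
      by (simp add: sum_subtractf left_diff_distrib)
    also have "\<dots> \<le> (\<Sum>c\<in>J. \<bar>u c - l c\<bar> * q c)"
      by (intro sum_mono mult_right_mono) (auto simp: q_def)
    finally show ?thesis using osc by (simp add: q_def)
  qed
  have "\<bar>a - I\<bar> \<le> \<epsilon> + M * (\<Sum>c\<in>J. \<bar>p c - q c\<bar>)"
    using I a ul diff[of l] diff[of u] M by (simp add: abs_le_iff)
  then show ?thesis by (simp add: a_def I_def p_def q_def)
qed

section \<open>Frequencies of patterns in the tiles\<close>

context coloring_process
begin

lemma prob_tau:
  assumes "B \<in> sets (cspace A S)"
  shows "prob {\<omega>\<in>space P. restrict (tau t \<omega>) S \<in> B} = measure (marginal A P S) B"
proof -
  let ?C = "{\<omega>\<in>space P. restrict \<omega> S \<in> B}"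
  have "measure (marginal A P S) B = measure P ?C"
    using emeasure_marginal[OF assms] by (simp add: measure_def)
  also have "\<dots> = measure (distr P P (tau t)) ?C" using M1 by (simp add: M1_def)
  also have "\<dots> = prob (tau t -` ?C \<inter> space P)"
    by (rule measure_distr[OF measurable_tau sets_restrict_P[OF assms]])
  also have "tau t -` ?C \<inter> space P = {\<omega>\<in>space P. restrict (tau t \<omega>) S \<in> B}"
    using measurable_space[OF measurable_tau] by auto
  finally show ?thesis ..
qed

lemma measurable_restrict_tau: "(\<lambda>\<omega>. restrict (tau t \<omega>) S) \<in> measurable P (cspace A S)"
  by (rule measurable_compose[OF measurable_tau measurable_restrict_P])

text \<open>The pattern seen from \<open>t\<close> is a function of the colors on the translated inner part, and these
  sets are more than \<open>r\<close> apart.\<close>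

lemma indep_vars_tiles:
  assumes "2 * r < m" and B: "B \<in> sets (cspace A (inner_part r (cube m)))"
  shows "indep_vars (\<lambda>_. borel)
    (\<lambda>t \<omega>. indicator B (restrict (tau t \<omega>) (inner_part r (cube m))) :: real) (grid m n)"
proof -
  let ?S = "inner_part r (cube m) :: (int ^ 'd) set"
  \<comment> \<open>\<open>shift\<close> moves a pattern on the translated inner part back to the inner part.\<close>
  define shift where "shift t \<eta> = (\<lambda>x\<in>?S. \<eta> (x + t))" for t and \<eta> :: "int ^ 'd \<Rightarrow> real"
  have S: "finite (translate ?S t) \<and> translate ?S t \<noteq> {}" for t
  proof -
    have "(\<chi> i. int r) \<in> ?S" using assms(1) by (simp add: inner_part_cube mem_translate_cube)
    moreover have "finite ?S" by (simp add: inner_part_cube)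
    ultimately show ?thesis by (auto simp: translate_def)
  qed
  have "indep_vars (\<lambda>_. borel) (\<lambda>t \<omega>. indicator B (shift t (restrict \<omega> (translate ?S t))) :: real) (grid m n)"
  proof (rule indep_vars_compose2[OF indep_vars_separated])
    fix t :: "int ^ 'd"
    have "shift t \<in> measurable (cspace A (translate ?S t)) (cspace A ?S)"
      unfolding shift_def cspace_def
      by (intro measurable_restrict measurable_component_singleton) (auto simp: translate_def)
    from measurable_compose[OF this borel_measurable_indicator[OF B]]
    show "(\<lambda>\<eta>. indicator B (shift t \<eta>) :: real) \<in> borel_measurable (cspace A (translate ?S t))" .
  qed (use S sdist_inner_tiles in auto)
  moreover have "shift t (restrict \<omega> (translate ?S t)) = restrict (tau t \<omega>) ?S" for t \<omega>
    by (auto simp: shift_def tau_def translate_def restrict_def fun_eq_iff)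
  ultimately show ?thesis by simp
qed

text \<open>Hoeffding's inequality for the independent indicators of a fixed pattern set; by stationarity they
  all have expectation \<open>measure (marginal A P (inner_part r (cube m))) B\<close>.\<close>

lemma tile_frequency_deviation:
  assumes "2 * r < m" "m \<le> n" and B: "B \<in> sets (cspace A (inner_part r (cube m)))" and "0 < \<delta>"
  shows "prob {\<omega>\<in>space P. \<delta> \<le> \<bar>(\<Sum>t\<in>grid m n. indicator B (restrict (tau t \<omega>) (inner_part r (cube m)))) / real ((n div m) ^ CARD('d))
      - measure (marginal A P (inner_part r (cube m))) B\<bar>} \<le> 2 * exp (- 2 * \<delta>\<^sup>2 * real ((n div m) ^ CARD('d)))"
proof -
  let ?S = "inner_part r (cube m) :: (int ^ 'd) set"
  let ?X = "\<lambda>t \<omega>. indicator B (restrict (tau t \<omega>) ?S) :: real"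
  define N where "N = real ((n div m) ^ CARD('d))"
  define q where "q = measure (marginal A P ?S) B"
  have m: "1 \<le> m" using assms(1) by simp
  have card: "real (card (grid m n :: (int ^ 'd) set)) = N"
    by (simp add: N_def card_grid[OF m])
  have N: "0 < N" using m assms(2) by (simp add: N_def div_greater_zero_iff)
  have expect: "expectation (?X t) = q" for t
  proof -
    have "expectation (?X t) = expectation (indicator {\<omega>\<in>space P. restrict (tau t \<omega>) ?S \<in> B})"
      by (intro Bochner_Integration.integral_cong) (auto simp: indicator_def)
    also have "\<dots> = prob {\<omega>\<in>space P. restrict (tau t \<omega>) ?S \<in> B}"
      by (subst Bochner_Integration.integral_indicator)
         (auto intro!: arg_cong[where f = prob])
    finally show ?thesis by (simp add: prob_tau[OF B] q_def)
  qed
  interpret H: Hoeffding_ineq P "grid m n" ?X "\<lambda>_. 0" "\<lambda>_. 1" "N * q"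
  proof unfold_locales
    show "indep_vars (\<lambda>_. borel) ?X (grid m n)" using indep_vars_tiles[OF assms(1) B] .
    show "finite (grid m n :: (int ^ 'd) set)" by (rule finite_grid[OF m])
    show "N * q \<equiv> \<Sum>t\<in>grid m n. expectation (?X t)" by (simp only: expect sum_constant card)
  qed (auto simp: indicator_def)
  have "{\<omega>\<in>space P. \<delta> \<le> \<bar>(\<Sum>t\<in>grid m n. ?X t \<omega>) / N - q\<bar>}
      = {\<omega>\<in>space P. \<delta> * N \<le> \<bar>(\<Sum>t\<in>grid m n. ?X t \<omega>) - N * q\<bar>}"
  proof -
    have "\<delta> \<le> \<bar>s / N - q\<bar> \<longleftrightarrow> \<delta> * N \<le> \<bar>s - N * q\<bar>" for s
    proof -
      have "\<bar>s / N - q\<bar> = \<bar>s - N * q\<bar> / N" using N by (simp add: field_simps abs_divide)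
      then show ?thesis using N by (simp add: pos_le_divide_eq)
    qed
    then show ?thesis by simp
  qed
  moreover have "prob {\<omega>\<in>space P. \<delta> * N \<le> \<bar>(\<Sum>t\<in>grid m n. ?X t \<omega>) - N * q\<bar>}
      \<le> 2 * exp (- 2 * (\<delta> * N)\<^sup>2 / (\<Sum>t\<in>(grid m n :: (int ^ 'd) set). (1 - 0)\<^sup>2))"
    using N card assms(4) by (intro H.Hoeffding_ineq_abs_ge) auto
  moreover have "2 * (\<delta> * N)\<^sup>2 / N = 2 * \<delta>\<^sup>2 * N" using N by (simp add: power2_eq_square)
  ultimately show ?thesis using card unfolding N_def[symmetric] q_def[symmetric] by simp
qed

lemma cell_frequencies_deviation:
  assumes "2 * r < m" "m \<le> n" "0 < \<delta>" and J: "finite J"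
    and \<kappa>: "\<kappa> \<in> measurable (marginal A P (inner_part r (cube m))) (count_space J)"
  shows "\<exists>G\<in>sets P. 1 - 2 * card J * exp (- 2 * \<delta>\<^sup>2 * real (n div m) ^ CARD('d)) \<le> prob G \<and>
    (\<forall>\<omega>\<in>G. \<forall>c\<in>J. \<bar>(\<Sum>t\<in>grid m n. indicator (\<kappa> -` {c} \<inter> space (marginal A P (inner_part r (cube m))))
        (restrict (tau t \<omega>) (inner_part r (cube m)))) / card (grid m n :: (int ^ 'd) set)
      - measure (marginal A P (inner_part r (cube m))) (\<kappa> -` {c} \<inter> space (marginal A P (inner_part r (cube m))))\<bar> \<le> \<delta>)"
proof -
  let ?S = "inner_part r (cube m) :: (int ^ 'd) set"
  let ?Q = "marginal A P ?S"
  define B where "B c = \<kappa> -` {c} \<inter> space ?Q" for c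
  define dev where "dev c \<omega> = \<bar>(\<Sum>t\<in>grid m n. indicator (B c) (restrict (tau t \<omega>) ?S)) / real ((n div m) ^ CARD('d))
      - measure ?Q (B c)\<bar>" for c \<omega>
  have m: "1 \<le> m" using assms(1) by simp
  have B: "B c \<in> sets (cspace A ?S)" if "c \<in> J" for c
    unfolding B_def sets_marginal[symmetric] by (rule measurable_sets[OF \<kappa>]) (use that in auto)
  have dev: "dev c \<in> borel_measurable P" if "c \<in> J" for c
    unfolding dev_def using measurable_compose[OF measurable_restrict_tau borel_measurable_indicator[OF B[OF that]]]
    by measurable
  define bad where "bad c = {\<omega>\<in>space P. \<delta> \<le> dev c \<omega>}" for c
  have bad: "bad c \<in> sets P" if "c \<in> J" for c
    unfolding bad_def using dev[OF that] by measurable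
  define G where "G = space P - (\<Union>c\<in>J. bad c)"
  have UN: "(\<Union>c\<in>J. bad c) \<in> sets P" using J bad by (intro sets.finite_UN) auto
  have "prob (\<Union>c\<in>J. bad c) \<le> (\<Sum>c\<in>J. prob (bad c))"
    by (rule finite_measure_subadditive_finite) (use J bad in auto)
  also have "\<dots> \<le> (\<Sum>c\<in>J. 2 * exp (- 2 * \<delta>\<^sup>2 * real ((n div m) ^ CARD('d))))"
    unfolding bad_def dev_def by (intro sum_mono tile_frequency_deviation assms B)
  finally have "1 - 2 * card J * exp (- 2 * \<delta>\<^sup>2 * real (n div m) ^ CARD('d)) \<le> prob G"
    using UN by (simp add: G_def prob_compl)
  moreover have "G \<in> sets P" using UN by (auto simp: G_def)
  moreover have "dev c \<omega> \<le> \<delta>" if "\<omega> \<in> G" "c \<in> J" for \<omega> c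
    using that by (auto simp: G_def bad_def not_le)
  ultimately show ?thesis
    unfolding dev_def B_def card_grid[OF m] by blast
qed
end

section \<open>Admissible functions\<close>

lemma supnorm_le_iff: "supnorm F \<le> ereal c \<longleftrightarrow> (\<forall>E. \<bar>F E\<bar> \<le> c)"
  by (simp add: supnorm_def SUP_le_iff)

lemma supnorm_nonneg: "0 \<le> supnorm F"
  unfolding supnorm_def by (rule SUP_upper2[of undefined]) auto

lemma tau_Omega: "\<omega> \<in> Omega A \<Longrightarrow> tau t \<omega> \<in> Omega A"
  by (auto simp: tau_def PiE_iff)

lemma admissible_BB:
  assumes "admissible A f" "finite S" "\<omega> \<in> Omega A"
  shows "f S \<omega> \<in> BB"
proof -
  have "\<forall>S. finite S \<longrightarrow> (\<forall>\<omega>\<in>Omega A. f S \<omega> \<in> BB)"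
    using assms(1) unfolding admissible_def by (elim conjE)
  then show ?thesis using assms(2,3) by blast
qed

lemma admissible_translate:
  assumes "admissible A f" "finite S" "\<omega> \<in> Omega A"
  shows "f (translate S z) \<omega> = f S (tau z \<omega>)"
proof -
  have "\<forall>S z. finite S \<longrightarrow> (\<forall>\<omega>\<in>Omega A. f (translate S z) \<omega> = f S (tau z \<omega>))"
    using assms(1) unfolding admissible_def by (elim conjE)
  then show ?thesis using assms(2,3) by blast
qed

lemma admissible_local:
  assumes "admissible A f" "finite S" "\<omega> \<in> Omega A" "\<omega>' \<in> Omega A" "restrict \<omega> S = restrict \<omega>' S"
  shows "f S \<omega> = f S \<omega>'"
proof -
  have "\<forall>S. finite S \<longrightarrow> (\<forall>\<omega>\<in>Omega A. \<forall>\<omega>'\<in>Omega A. restrict \<omega> S = restrict \<omega>' S \<longrightarrow> f S \<omega> = f S \<omega>')"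
    using assms(1) unfolding admissible_def by (elim conjE)
  then show ?thesis using assms(2-) by blast
qed

lemma admissible_boundary_term: "admissible A f \<Longrightarrow> \<exists>b. boundary_term A f b"
  unfolding admissible_def by (elim conjE)

lemma admissible_signs:
  assumes "admissible A f"
  shows "\<exists>s :: int ^ 'd \<Rightarrow> int. range s \<subseteq> {-1, 1} \<and>
    (\<forall>S. finite S \<longrightarrow> (\<forall>\<omega>\<in>Omega A. \<forall>\<omega>'\<in>Omega A. \<forall>z\<in>S. \<forall>E.
       restrict \<omega> (S - {z}) = restrict \<omega>' (S - {z}) \<and> \<omega> z \<le> \<omega>' z \<longrightarrow>
         (s z = 1 \<longrightarrow> f S \<omega> E \<le> f S \<omega>' E) \<and> (s z = -1 \<longrightarrow> f S \<omega>' E \<le> f S \<omega> E)))"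
  using assms unfolding admissible_def by (elim conjE)

lemma almost_additive:
  assumes b: "boundary_term A f b" and \<omega>: "\<omega> \<in> Omega A" and I: "finite I" "I \<noteq> {}"
    and S: "\<And>i. i \<in> I \<Longrightarrow> finite (S i)" and disj: "disjoint_family_on S I"
  shows "\<bar>f (\<Union>i\<in>I. S i) \<omega> E - (\<Sum>i\<in>I. f (S i) \<omega> E)\<bar> \<le> (\<Sum>i\<in>I. b (S i))"
proof -
  obtain h where h: "bij_betw h {1..card I} I"
    using ex_bij_betw_nat_finite_1[OF \<open>finite I\<close>] by blast
  define N where "N = card I"
  note h = h[folded N_def]
  have N: "1 \<le> N" using I by (simp add: N_def Suc_le_eq card_gt_0_iff)
  have "disjoint_family_on (\<lambda>i. S (h i)) {1..N}"
    unfolding disjoint_family_on_def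
  proof (intro ballI impI)
    fix i j assume ij: "i \<in> {1..N}" "j \<in> {1..N}" "i \<noteq> j"
    then have "h i \<noteq> h j" using inj_onD[OF bij_betw_imp_inj_on[OF h]] by blast
    then show "S (h i) \<inter> S (h j) = {}"
      using disj bij_betwE[OF h] ij by (auto simp: disjoint_family_on_def)
  qed
  moreover have "\<forall>i\<in>{1..N}. finite (S (h i))" using S bij_betwE[OF h] by blast
  moreover have "\<forall>\<omega>\<in>Omega A. \<forall>n\<ge>1. \<forall>S :: nat \<Rightarrow> (int ^ 'a) set.
      (\<forall>i\<in>{1..n}. finite (S i)) \<and> disjoint_family_on S {1..n} \<longrightarrow>
      supnorm (\<lambda>E. f (\<Union>i\<in>{1..n}. S i) \<omega> E - (\<Sum>i=1..n. f (S i) \<omega> E)) \<le> ereal (\<Sum>i=1..n. b (S i))"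
    using b unfolding boundary_term_def by (elim conjE)
  ultimately have "supnorm (\<lambda>E. f (\<Union>i\<in>{1..N}. S (h i)) \<omega> E - (\<Sum>i=1..N. f (S (h i)) \<omega> E))
      \<le> ereal (\<Sum>i=1..N. b (S (h i)))"
    using \<omega> N by simp
  moreover have "(\<Union>i\<in>{1..N}. S (h i)) = (\<Union>i\<in>I. S i)"
    using bij_betw_imp_surj_on[OF h] by (metis image_image)
  moreover have "(\<Sum>i=1..N. f (S (h i)) \<omega> E) = (\<Sum>i\<in>I. f (S i) \<omega> E)" for E
    by (rule sum.reindex_bij_betw[OF h])
  moreover have "(\<Sum>i=1..N. b (S (h i))) = (\<Sum>i\<in>I. b (S i))"
    by (rule sum.reindex_bij_betw[OF h])
  ultimately show ?thesis by (simp add: supnorm_le_iff)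
qed

lemma boundary_term_empty:
  assumes "boundary_term A f b"
  shows "b {} \<le> 0"
proof -
  have "\<exists>D>0. \<forall>S. finite S \<longrightarrow> b S \<le> D * real (card S)"
    using assms unfolding boundary_term_def by (elim conjE)
  then obtain D where "\<forall>S. finite S \<longrightarrow> b S \<le> D * real (card S)" by (elim exE conjE)
  from this[rule_format, of "{}"] show ?thesis by simp
qed

text \<open>Writing \<open>{}\<close> as the disjoint union of two empty sets gives \<open>|f({}) - 2 f({})| \<le> 2 b({}) \<le> 0\<close>.\<close>

lemma boundary_term_field_empty:
  assumes "boundary_term A f b" "\<omega> \<in> Omega A"
  shows "f {} \<omega> E = 0"
proof -
  have "\<bar>f (\<Union>i\<in>{0,1::nat}. {}) \<omega> E - (\<Sum>i\<in>{0,1::nat}. f {} \<omega> E)\<bar> \<le> (\<Sum>i\<in>{0,1::nat}. b {})"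
    by (rule almost_additive[OF assms]) (auto simp: disjoint_family_on_def)
  then show ?thesis using boundary_term_empty[OF assms(1)] by simp
qed

lemma field_bound:
  assumes f: "admissible A f" "Kf A f \<le> ereal K" and "finite S" and \<omega>: "\<omega> \<in> Omega A"
  shows "\<bar>f S \<omega> E\<bar> \<le> K * card S"
proof (cases "S = {}")
  case True
  obtain b where "boundary_term A f b" using admissible_boundary_term[OF f(1)] by blast
  then show ?thesis using True boundary_term_field_empty[OF _ \<omega>] by simp
next
  case False
  then have card: "0 < card S" using \<open>finite S\<close> by (simp add: card_gt_0_iff)
  have "supnorm (f S \<omega>) / ereal (real (card S)) \<le> Kf A f"
    unfolding Kf_def by (rule SUP_upper2[of "(\<omega>, S)"]) (use \<omega> False \<open>finite S\<close> in auto)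
  then have "supnorm (f S \<omega>) / ereal (real (card S)) \<le> ereal K" using f(2) by (rule order_trans)
  then have "supnorm (f S \<omega>) \<le> ereal (K * card S)"
    using card by (subst (asm) ereal_divide_le_pos) (auto simp: mult.commute)
  then show ?thesis by (simp add: supnorm_le_iff)
qed

lemma coloring_extension_exists:
  assumes "A \<noteq> {}" "\<eta> \<in> S \<rightarrow>\<^sub>E A"
  shows "\<exists>\<omega>\<in>Omega A. restrict \<omega> S = \<eta>"
proof -
  obtain a where "a \<in> A" using assms(1) by blast
  then show ?thesis
    using assms(2) by (intro bexI[of _ "\<lambda>z. if z \<in> S then \<eta> z else a"])
      (auto simp: PiE_iff extensional_def restrict_def fun_eq_iff)
qed

lemma floc_restrict:
  assumes "admissible A f" "finite S" "\<omega> \<in> Omega A"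
  shows "floc A f S (restrict \<omega> S) = f S \<omega>"
proof -
  define \<omega>' where "\<omega>' = (SOME \<omega>'. \<omega>' \<in> Omega A \<and> restrict \<omega>' S = restrict \<omega> S)"
  have "\<omega>' \<in> Omega A \<and> restrict \<omega>' S = restrict \<omega> S"
    unfolding \<omega>'_def by (rule someI[of _ \<omega>]) (simp add: assms(3))
  then show ?thesis
    unfolding floc_def \<omega>'_def[symmetric] using admissible_local[OF assms(1,2) _ assms(3)] by blast
qed

text \<open>The two colorings are joined by changing the colors at the points of \<open>S\<close> one after the other.\<close>

lemma monotone_in_all_coordinates:
  fixes f :: "('d::finite) field_fun"
  assumes "finite S" and \<omega>: "\<omega> \<in> Omega A" "\<omega>' \<in> Omega A"
    and \<sigma>: "range \<sigma> \<subseteq> {-1, 1 :: int}"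
    and loc: "\<And>\<omega> \<omega>'. \<omega> \<in> Omega A \<Longrightarrow> \<omega>' \<in> Omega A \<Longrightarrow> restrict \<omega> S = restrict \<omega>' S \<Longrightarrow> f S \<omega> = f S \<omega>'"
    and mono: "\<And>\<omega> \<omega>' z E. \<omega> \<in> Omega A \<Longrightarrow> \<omega>' \<in> Omega A \<Longrightarrow> z \<in> S \<Longrightarrow>
      restrict \<omega> (S - {z}) = restrict \<omega>' (S - {z}) \<Longrightarrow> \<omega> z \<le> \<omega>' z \<Longrightarrow>
      (\<sigma> z = 1 \<longrightarrow> f S \<omega> E \<le> f S \<omega>' E) \<and> (\<sigma> z = -1 \<longrightarrow> f S \<omega>' E \<le> f S \<omega> E)"
    and le: "\<And>z. z \<in> S \<Longrightarrow> if \<sigma> z = 1 then \<omega> z \<le> \<omega>' z else \<omega>' z \<le> \<omega> z"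
  shows "f S \<omega> E \<le> f S \<omega>' E"
proof -
  define mix where "mix U = (\<lambda>z. if z \<in> U then \<omega>' z else \<omega> z)" for U
  have mix: "mix U \<in> Omega A" for U using \<omega> by (auto simp: mix_def PiE_iff)
  have "f S \<omega> E \<le> f S (mix U) E" if "U \<subseteq> S" for U
    using finite_subset[OF that \<open>finite S\<close>] that
  proof (induction U rule: finite_induct)
    case empty
    then show ?case by (simp add: mix_def)
  next
    case (insert z U)
    then have z: "z \<in> S" by simp
    have same: "restrict (mix U) (S - {z}) = restrict (mix (insert z U)) (S - {z})"
      by (auto simp: mix_def restrict_def fun_eq_iff)
    have vals: "mix U z = \<omega> z" "mix (insert z U) z = \<omega>' z" using insert.hyps by (auto simp: mix_def)
    have "f S (mix U) E \<le> f S (mix (insert z U)) E"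
    proof (cases "\<sigma> z = 1")
      case True
      then show ?thesis using mono[OF mix mix z same] le[OF z] vals by simp
    next
      case False
      then have "\<sigma> z = -1" using \<sigma> by blast
      then show ?thesis using mono[OF mix mix z same[symmetric]] le[OF z] vals False by simp
    qed
    then show ?case using insert by auto
  qed
  from this[of S] have "f S \<omega> E \<le> f S (mix S) E" by simp
  also have "f S (mix S) = f S \<omega>'"
    by (rule loc[OF mix \<omega>(2)]) (auto simp: mix_def restrict_def fun_eq_iff)
  finally show ?thesis .
qed

lemma floc_coordinatewise_monotone:
  assumes f: "admissible A f" and "finite S" "A \<noteq> {}"
  shows "\<exists>s. coordinatewise_monotone s S A (\<lambda>\<eta>. floc A f S \<eta> E)"
proof -
  obtain \<sigma> where \<sigma>: "range \<sigma> \<subseteq> {-1, 1 :: int}"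
    and mono: "\<forall>S. finite S \<longrightarrow> (\<forall>\<omega>\<in>Omega A. \<forall>\<omega>'\<in>Omega A. \<forall>z\<in>S. \<forall>E.
       restrict \<omega> (S - {z}) = restrict \<omega>' (S - {z}) \<and> \<omega> z \<le> \<omega>' z \<longrightarrow>
         (\<sigma> z = 1 \<longrightarrow> f S \<omega> E \<le> f S \<omega>' E) \<and> (\<sigma> z = -1 \<longrightarrow> f S \<omega>' E \<le> f S \<omega> E))"
    using admissible_signs[OF f] by (elim exE conjE)
  have "coordinatewise_monotone (\<lambda>z. \<sigma> z = 1) S A (\<lambda>\<eta>. floc A f S \<eta> E)"
    unfolding coordinatewise_monotone_def
  proof (intro ballI impI)
    fix x y assume xy: "x \<in> S \<rightarrow>\<^sub>E A" "y \<in> S \<rightarrow>\<^sub>E A" "\<forall>i\<in>S. if \<sigma> i = 1 then x i \<le> y i else y i \<le> x i"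
    obtain \<omega> \<omega>' where \<omega>: "\<omega> \<in> Omega A" "restrict \<omega> S = x" "\<omega>' \<in> Omega A" "restrict \<omega>' S = y"
      using coloring_extension_exists[OF \<open>A \<noteq> {}\<close>] xy(1,2) by metis
    have vals: "\<omega> z = x z" "\<omega>' z = y z" if "z \<in> S" for z
      unfolding \<omega>(2)[symmetric] \<omega>(4)[symmetric] using that by simp_all
    have "f S \<omega> E \<le> f S \<omega>' E"
    proof (rule monotone_in_all_coordinates[of S \<omega> A \<omega>' \<sigma> f, OF \<open>finite S\<close> \<omega>(1,3) \<sigma>])
      show "f S \<omega> = f S \<omega>'"
        if "\<omega> \<in> Omega A" "\<omega>' \<in> Omega A" "restrict \<omega> S = restrict \<omega>' S" for \<omega> \<omega>'
        by (rule admissible_local[OF f \<open>finite S\<close> that])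
      show "if \<sigma> z = 1 then \<omega> z \<le> \<omega>' z else \<omega>' z \<le> \<omega> z" if "z \<in> S" for z
        using xy(3) that by (simp add: vals)
    qed (use mono \<open>finite S\<close> in simp_all)
    then show "floc A f S x E \<le> floc A f S y E"
      using floc_restrict[OF f \<open>finite S\<close>] \<omega> by metis
  qed
  then show ?thesis by blast
qed

lemma floc_bound:
  assumes f: "admissible A f" "Kf A f \<le> ereal K" and "finite S" "A \<noteq> {}" "\<eta> \<in> S \<rightarrow>\<^sub>E A"
  shows "\<bar>floc A f S \<eta> E\<bar> \<le> K * card S"
  using coloring_extension_exists[OF assms(4,5)] floc_restrict[OF f(1) \<open>finite S\<close>] field_bound[OF f \<open>finite S\<close>]
  by metis

section \<open>The uniform law of large numbers\<close>

lemma finite_inner_part: "finite (inner_part r (cube m) :: (int ^ 'd) set)"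
  by (simp add: inner_part_cube)

text \<open>The empirical measure is carried by finitely many points, which are measurable sets. So every
  function agrees almost everywhere with a measurable one and is measurable for the completion.\<close>

lemma pairing_empirical:
  fixes \<omega> :: "int ^ 'd \<Rightarrow> real"
  assumes f: "admissible A f" and \<omega>: "\<omega> \<in> Omega A" and m: "1 \<le> m"
  shows "pairing (floc A f (inner_part r (cube m))) (empirical A r m n \<omega>) E
    = (\<Sum>t\<in>grid m n. floc A f (inner_part r (cube m)) (restrict (tau t \<omega>) (inner_part r (cube m))) E)
        / card (grid m n :: (int ^ 'd) set)"
proof -
  let ?S = "inner_part r (cube m) :: (int ^ 'd) set"
  let ?T = "grid m n :: (int ^ 'd) set"
  define X where "X t = restrict (tau t \<omega>) ?S" for t
  define g where "g \<eta> = floc A f ?S \<eta> E" for \<eta>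
  define L where "L = empirical A r m n \<omega>"
  have fin: "finite ?T" by (rule finite_grid[OF m])
  have X: "X t \<in> space (cspace A ?S)" for t
    using tau_Omega[OF \<omega>, of t] by (auto simp: X_def space_cspace PiE_iff)
  have Xm: "X \<in> measurable (uniform_count_measure ?T) (cspace A ?S)"
    by (rule measurableI) (auto simp: X sets_uniform_count_measure space_uniform_count_measure)
  have L: "L = distr (uniform_count_measure ?T) (cspace A ?S) X"
    by (simp add: L_def empirical_def X_def[abs_def])
  define Y where "Y = X ` ?T"
  have single: "{y} \<in> sets (cspace A ?S)" if "y \<in> Y" for y
  proof -
    have y: "y \<in> ?S \<rightarrow>\<^sub>E A" using that X by (auto simp: Y_def space_cspace)
    have "{y} = (\<Pi>\<^sub>E i\<in>?S. {y i})"
      using y by (auto simp: PiE_iff extensional_def fun_eq_iff) metis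
    also have "\<dots> \<in> sets (cspace A ?S)"
      unfolding cspace_def using y
      by (intro sets_PiM_I_finite finite_inner_part) (auto simp: sets_restrict_space image_iff PiE_iff intro!: bexI[of _ "{y _}"])
    finally show ?thesis .
  qed
  define g' where "g' \<eta> = (\<Sum>y\<in>Y. g y * indicator {y} \<eta>)" for \<eta>
  have g'm: "g' \<in> borel_measurable (cspace A ?S)"
    unfolding g'_def using single by (intro borel_measurable_sum borel_measurable_times borel_measurable_indicator) auto
  have g'Y: "g' y = g y" if "y \<in> Y" for y
  proof -
    have "g' y = (\<Sum>y'\<in>Y. if y' = y then g y' else 0)"
      unfolding g'_def by (intro sum.cong) (auto simp: indicator_def)
    then show ?thesis using that fin by (simp add: Y_def)
  qed
  have ae: "AE \<eta> in L. g \<eta> = g' \<eta>"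
  proof -
    have "AE \<eta> in L. \<eta> \<in> Y"
      unfolding L
    proof (subst AE_distr_iff[OF Xm])
      have "(\<Union>y\<in>Y. {y}) \<in> sets (cspace A ?S)"
        using fin single by (intro sets.finite_UN) (auto simp: Y_def)
      then have Y: "Y \<in> sets (cspace A ?S)" by (simp only: UN_singleton)
      have "{\<eta> \<in> space (cspace A ?S). \<eta> \<in> Y} = Y" using sets.sets_into_space[OF Y] by blast
      then show "{\<eta> \<in> space (cspace A ?S). \<eta> \<in> Y} \<in> sets (cspace A ?S)" using Y by (simp only:)
    qed (auto simp: Y_def space_uniform_count_measure)
    then show ?thesis by eventually_elim (simp add: g'Y)
  qed
  have "sets L = sets (cspace A ?S)" by (simp add: L)
  from measurable_cong_sets[OF this refl] g'm have g'mL: "g' \<in> borel_measurable L" by blast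
  have "(\<integral>\<eta>. g \<eta> \<partial>completion L) = (\<integral>\<eta>. g' \<eta> \<partial>completion L)"
    using borel_measurable_completion_AE[OF g'mL ae] measurable_completion[OF g'mL] AE_completion[OF ae]
    by (rule integral_cong_AE)
  also have "\<dots> = (\<integral>\<eta>. g' \<eta> \<partial>L)" by (rule integral_completion[OF g'mL])
  also have "\<dots> = (\<integral>t. g' (X t) \<partial>uniform_count_measure ?T)"
    unfolding L by (rule integral_distr[OF Xm g'm])
  also have "\<dots> = (\<Sum>t\<in>?T. g' (X t)) / card ?T"
    using fin by (simp add: lebesgue_integral_point_measure_finite uniform_count_measure_def sum_divide_distrib)
  also have "(\<Sum>t\<in>?T. g' (X t)) = (\<Sum>t\<in>?T. g (X t))"
    by (intro sum.cong) (auto simp: g'Y Y_def)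
  finally show ?thesis by (simp add: pairing_def L_def X_def g_def)
qed

context coloring_process
begin

lemma A_nonempty: "A \<noteq> {}"
  using not_empty by (auto simp: space_P PiE_eq_empty_iff)

lemma marginal_cells:
  assumes "finite S" "0 \<le> M" "0 < \<epsilon>"
  shows "\<exists>(J :: (int ^ 'd \<Rightarrow> nat \<times> bool) set) \<kappa>. adapted_cells A S (marginal A P S) M \<epsilon> J \<kappa>"
  by (rule monotone_cells[OF assms(1) sigma_finite_\<mu> sets_\<mu> prob_space_marginal _ abs_cont assms(2,3)])
     (simp_all add: sets_marginal sets_PiM_\<mu> assms(1))

text \<open>The cells for \<open>\<epsilon> = 1 / (n + 1)\<close> squeeze \<open>f\<^sub>\<Lambda>\<close> between measurable functions. Monotonicity is
  essential here: \<open>f\<close> itself carries no measurability assumption.\<close>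

lemma floc_measurable:
  assumes f: "admissible A f" "Kf A f \<le> ereal K" and "finite S" and "0 \<le> K"
  shows "(\<lambda>\<eta>. floc A f S \<eta> E) \<in> borel_measurable (completion (marginal A P S))"
proof -
  let ?Q = "marginal A P S"
  interpret Q: prob_space ?Q by (rule prob_space_marginal)
  obtain s where s: "coordinatewise_monotone s S A (\<lambda>\<eta>. floc A f S \<eta> E)"
    using floc_coordinatewise_monotone[OF f(1) \<open>finite S\<close> A_nonempty] by blast
  define good where "good n l u \<longleftrightarrow> l \<in> borel_measurable ?Q \<and> u \<in> borel_measurable ?Q \<and>
      (\<forall>x\<in>space ?Q. l x \<le> floc A f S x E \<and> floc A f S x E \<le> u x) \<and>
      (\<integral>\<^sup>+ x. ennreal (u x - l x) \<partial>?Q) \<le> ennreal (1 / Suc n)" for n :: nat and l u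
  have "\<exists>l u. good n l u" for n
  proof -
    obtain J :: "(int ^ 'd \<Rightarrow> nat \<times> bool) set" and \<kappa> where
      cells: "adapted_cells A S ?Q (K * card S) (1 / Suc n) J \<kappa>"
      using marginal_cells[OF \<open>finite S\<close>, of "K * card S" "1 / Suc n"] \<open>0 \<le> K\<close> by auto
    note J = adapted_cellsD(1)[OF cells] and \<kappa> = adapted_cellsD(2)[OF cells]
    obtain l u where lu: "\<forall>x\<in>S \<rightarrow>\<^sub>E A. l (\<kappa> x) \<le> floc A f S x E \<and> floc A f S x E \<le> u (\<kappa> x)"
      "(\<Sum>c\<in>J. \<bar>u c - l c\<bar> * measure ?Q (\<kappa> -` {c} \<inter> space ?Q)) \<le> 1 / Suc n"
      using adapted_cellsD(3)[OF cells s floc_bound[OF f \<open>finite S\<close> A_nonempty]] by blast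
    note int = integral_cells[OF Q.finite_measure_axioms J \<kappa>]
    have "(\<integral>\<^sup>+ x. ennreal (u (\<kappa> x) - l (\<kappa> x)) \<partial>?Q) \<le> (\<integral>\<^sup>+ x. ennreal \<bar>u (\<kappa> x) - l (\<kappa> x)\<bar> \<partial>?Q)"
      by (intro nn_integral_mono ennreal_leI) auto
    also have "\<dots> = ennreal (\<integral>x. \<bar>u (\<kappa> x) - l (\<kappa> x)\<bar> \<partial>?Q)"
      using int(2)[of "\<lambda>c. \<bar>u c - l c\<bar>"] by (intro nn_integral_eq_integral) auto
    also have "\<dots> \<le> ennreal (1 / Suc n)"
      using lu(2) int(3)[of "\<lambda>c. \<bar>u c - l c\<bar>"] by (intro ennreal_leI) simp
    finally show ?thesis
      using lu(1) int(1)[of l] int(1)[of u] unfolding good_def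
      by (intro exI[of _ "\<lambda>x. l (\<kappa> x)"] exI[of _ "\<lambda>x. u (\<kappa> x)"]) (auto simp: space_marginal)
  qed
  then obtain l u where "\<And>n. good n (l n) (u n)" by metis
  then show ?thesis
    unfolding good_def by (intro borel_measurable_completion_sandwich[of l _ u]) blast+
qed

text \<open>If the inner part is empty, (M3) says nothing, but then both pairings vanish because \<open>f({}) = 0\<close>.\<close>

lemma deviation_empty_inner_part:
  fixes f :: "'d field_fun"
  assumes f: "admissible A f" and \<omega>: "\<omega> \<in> Omega A" and m: "1 \<le> m" "m \<le> 2 * r"
  shows "deviation A P r m n \<omega> f = 0"
proof -
  have S: "inner_part r (cube m) = ({} :: (int ^ 'd) set)"
    using m by (simp add: inner_part_cube) (simp add: translate_def cube_def)
  obtain b where b: "boundary_term A f b" using admissible_boundary_term[OF f] by blast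
  have 0: "floc A f {} \<eta> E = 0" if \<eta>: "\<eta> \<in> {} \<rightarrow>\<^sub>E A" for \<eta> E
  proof -
    obtain \<omega> where "\<omega> \<in> Omega A" "restrict \<omega> {} = \<eta>"
      using coloring_extension_exists[OF A_nonempty \<eta>] by blast
    then show ?thesis
      using floc_restrict[OF f finite.emptyI] boundary_term_field_empty[OF b] by metis
  qed
  have "pairing (floc A f {}) (marginal A P {}) E = (\<integral>\<eta>. 0 \<partial>completion (marginal A P {}))" for E
    unfolding pairing_def by (rule Bochner_Integration.integral_cong) (auto simp: space_marginal 0)
  moreover have "pairing (floc A f (inner_part r (cube m))) (empirical A r m n \<omega>) E = 0" for E
  proof -
    have "floc A f {} (restrict \<eta> {}) E = 0" for \<eta> by (rule 0) (simp add: restrict_def)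
    then show ?thesis unfolding pairing_empirical[OF f \<omega> m(1)] unfolding S by (simp only: sum.neutral_const div_0)
  qed
  ultimately show ?thesis by (simp add: deviation_def S supnorm_def)
qed

text \<open>If the inner part is nonempty, the event \<open>G\<close> says that all cell frequencies are within \<open>\<delta>\<close> of
  their probabilities. The cells and \<open>\<delta>\<close> are chosen from \<open>m\<close>, \<open>\<epsilon>\<close> and \<open>K\<close> before any \<open>f\<close> is given, so one event serves all \<open>f\<close>.\<close>

lemma deviation_exponential:
  assumes m: "1 \<le> m" and "0 < \<epsilon>" "0 < K"
  shows "\<exists>a>0. \<exists>b. \<forall>n\<ge>m. \<exists>G\<in>sets P. 1 - b * exp (- a * real (n div m) ^ CARD('d)) \<le> prob G \<and>
    (\<forall>\<omega>\<in>G. \<forall>f :: 'd field_fun. admissible A f \<longrightarrow> Kf A f \<le> ereal K \<longrightarrow> deviation A P r m n \<omega> f \<le> ereal \<epsilon>)"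
proof (cases "m \<le> 2 * r")
  case True
  have "\<exists>G\<in>sets P. 1 - 0 * exp (- 1 * real (n div m) ^ CARD('d)) \<le> prob G \<and>
    (\<forall>\<omega>\<in>G. \<forall>f :: 'd field_fun. admissible A f \<longrightarrow> Kf A f \<le> ereal K \<longrightarrow> deviation A P r m n \<omega> f \<le> ereal \<epsilon>)"
    if "m \<le> n" for n
  proof (intro bexI[of _ "space P"] conjI ballI allI impI)
    fix \<omega> and f :: "'d field_fun" assume "\<omega> \<in> space P" "admissible A f"
    then have "deviation A P r m n \<omega> f = 0"
      unfolding space_P by (intro deviation_empty_inner_part m True)
    then show "deviation A P r m n \<omega> f \<le> ereal \<epsilon>" using \<open>0 < \<epsilon>\<close> by simp
  qed (simp_all add: prob_space)
  then show ?thesis using zero_less_one by blast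
next
  case False
  let ?S = "inner_part r (cube m) :: (int ^ 'd) set"
  let ?Q = "marginal A P ?S"
  define M where "M = K * card ?S"
  have M: "0 \<le> M" using \<open>0 < K\<close> by (simp add: M_def)
  note finS = finite_inner_part[of r m]
  obtain J :: "(int ^ 'd \<Rightarrow> nat \<times> bool) set" and \<kappa> where cells: "adapted_cells A ?S ?Q M (\<epsilon> / 2) J \<kappa>"
    using marginal_cells[OF finS M, of "\<epsilon> / 2"] \<open>0 < \<epsilon>\<close> by auto
  note J = adapted_cellsD(1)[OF cells] and \<kappa> = adapted_cellsD(2)[OF cells]
  \<comment> \<open>Half of \<open>\<epsilon>\<close> is spent on the oscillation, the other half on the \<open>card J\<close> frequencies with
    weight \<open>M\<close> each; adding \<open>1\<close> to both factors avoids division by zero.\<close>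
  define C where "C = (M + 1) * (card J + 1)"
  have C: "0 < C" using M by (simp add: C_def)
  define \<delta> where "\<delta> = \<epsilon> / (2 * C)"
  have \<delta>: "0 < \<delta>" using \<open>0 < \<epsilon>\<close> C by (simp add: \<delta>_def)
  have small: "M * (card J * \<delta>) \<le> \<epsilon> / 2"
  proof -
    have "M * (card J * \<delta>) \<le> C * \<delta>"
      using M \<delta> by (simp add: C_def algebra_simps)
    also have "\<dots> = \<epsilon> / 2" using C by (simp add: \<delta>_def)
    finally show ?thesis .
  qed
  show ?thesis
  proof (rule exI[of _ "2 * \<delta>\<^sup>2"], rule conjI, use \<delta> in simp, rule exI[of _ "real (2 * card J)"], intro allI impI)
    fix n assume "m \<le> n"
    obtain G where G: "G \<in> sets P" "1 - 2 * card J * exp (- 2 * \<delta>\<^sup>2 * real (n div m) ^ CARD('d)) \<le> prob G"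
      and freq: "\<And>\<omega> c. \<omega> \<in> G \<Longrightarrow> c \<in> J \<Longrightarrow>
        \<bar>(\<Sum>t\<in>grid m n. indicator (\<kappa> -` {c} \<inter> space ?Q) (restrict (tau t \<omega>) ?S)) / card (grid m n :: (int ^ 'd) set)
          - measure ?Q (\<kappa> -` {c} \<inter> space ?Q)\<bar> \<le> \<delta>"
      using cell_frequencies_deviation[OF _ \<open>m \<le> n\<close> \<delta> J \<kappa>] False by auto
    have "deviation A P r m n \<omega> f \<le> ereal \<epsilon>"
      if \<omega>: "\<omega> \<in> G" and f: "admissible A f" "Kf A f \<le> ereal K" for \<omega> and f :: "'d field_fun"
      unfolding deviation_def supnorm_le_iff
    proof
      fix E
      have \<omega>': "\<omega> \<in> Omega A" using \<omega> G(1) sets.sets_into_space space_P by blast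
      obtain s where s: "coordinatewise_monotone s ?S A (\<lambda>\<eta>. floc A f ?S \<eta> E)"
        using floc_coordinatewise_monotone[OF f(1) finS A_nonempty] by blast
      obtain l u where lu: "\<forall>x\<in>?S \<rightarrow>\<^sub>E A. l (\<kappa> x) \<le> floc A f ?S x E \<and> floc A f ?S x E \<le> u (\<kappa> x)"
        "\<forall>c. \<bar>l c\<bar> \<le> M \<and> \<bar>u c\<bar> \<le> M"
        "(\<Sum>c\<in>J. \<bar>u c - l c\<bar> * measure ?Q (\<kappa> -` {c} \<inter> space ?Q)) \<le> \<epsilon> / 2"
        using adapted_cellsD(3)[OF cells s floc_bound[OF f finS A_nonempty, folded M_def]] by blast
      have "\<bar>(\<Sum>t\<in>grid m n. floc A f ?S (restrict (tau t \<omega>) ?S) E) / card (grid m n :: (int ^ 'd) set)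
          - (\<integral>\<eta>. floc A f ?S \<eta> E \<partial>completion ?Q)\<bar>
        \<le> \<epsilon> / 2 + M * (\<Sum>c\<in>J. \<bar>(\<Sum>t\<in>grid m n. indicator (\<kappa> -` {c} \<inter> space ?Q) (restrict (tau t \<omega>) ?S))
            / card (grid m n :: (int ^ 'd) set) - measure ?Q (\<kappa> -` {c} \<inter> space ?Q)\<bar>)"
      proof (rule average_minus_integral_le[OF prob_space_marginal J \<kappa> _ _ _ lu(3) finite_grid[OF m]])
        show "(\<lambda>\<eta>. floc A f ?S \<eta> E) \<in> borel_measurable (completion ?Q)"
          using \<open>0 < K\<close> by (intro floc_measurable[OF f finS]) simp
        show "restrict (tau t \<omega>) ?S \<in> space ?Q" for t
          using tau_Omega[OF \<omega>', of t] by (auto simp: space_marginal PiE_iff)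
      qed (use lu in \<open>auto simp: space_marginal\<close>)
      also have "\<dots> \<le> \<epsilon> / 2 + M * (\<Sum>c\<in>J. \<delta>)"
        using freq[OF \<omega>] M by (intro add_left_mono mult_left_mono sum_mono) auto
      also have "\<dots> \<le> \<epsilon>" using small by simp
      finally show "\<bar>pairing (floc A f ?S) (empirical A r m n \<omega>) E - pairing (floc A f ?S) ?Q E\<bar> \<le> \<epsilon>"
        unfolding pairing_empirical[OF f(1) \<omega>' m] by (simp add: pairing_def)
    qed
    then show "\<exists>G\<in>sets P. 1 - real (2 * card J) * exp (- (2 * \<delta>\<^sup>2) * real (n div m) ^ CARD('d)) \<le> prob G \<and>
      (\<forall>\<omega>\<in>G. \<forall>f :: 'd field_fun. admissible A f \<longrightarrow> Kf A f \<le> ereal K \<longrightarrow> deviation A P r m n \<omega> f \<le> ereal \<epsilon>)"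
      using G by (intro bexI[of _ G]) auto
  qed
qed
end

section \<open>Almost additivity along the tiling\<close>

text \<open>Bernoulli's inequality, in the form that measures a layer near the boundary of a cube of side
  length \<open>x\<close>.\<close>

lemma power_minus_power_le:
  fixes x y :: real
  assumes "0 < x" "0 \<le> y" "y \<le> x"
  shows "x ^ k - (x - y) ^ k \<le> real k * y / x * x ^ k"
proof -
  have "1 + real k * (- (y / x)) \<le> (1 + - (y / x)) ^ k"
    by (rule Bernoulli_inequality) (use assms in simp)
  also have "1 + - (y / x) = (x - y) / x" using assms by (simp add: field_simps)
  finally have "(1 - real k * (y / x)) * x ^ k \<le> ((x - y) / x) ^ k * x ^ k"
    using assms by (intro mult_right_mono) auto
  also have "((x - y) / x) ^ k * x ^ k = (x - y) ^ k" using assms by (simp add: power_divide)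
  finally show ?thesis by (simp add: algebra_simps)
qed

text \<open>Suprema over an empty set would be \<open>-\<infinity>\<close> and could not tend to \<open>0\<close>.\<close>

lemma zero_in_UU:
  fixes K D D' :: real
  assumes "0 < K" "0 < D" "0 < D'" "1 \<le> r'"
  shows "(\<lambda>_ _ _. 0) \<in> UU A K D D' r'"
proof -
  have [simp]: "supnorm (\<lambda>_. 0) = 0" by (simp add: supnorm_def)
  have b: "boundary_term A (\<lambda>_ _ _. 0) (\<lambda>_. 0)"
    unfolding boundary_term_def by (auto intro!: exI[of _ 1])
  have "admissible A (\<lambda>_ _ _. 0)"
    unfolding admissible_def
  proof (intro conjI)
    show "\<exists>b. boundary_term A (\<lambda>_ _ _. 0) b" using b by blast
    show "(SUP \<omega>\<in>Omega A. supnorm (\<lambda>_. 0)) < \<infinity>"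
      by (rule le_less_trans[of _ 0]) (auto intro!: SUP_least)
  qed (auto simp: BB_def intro!: exI[of _ "\<lambda>_. 1"])
  moreover have "Kf A (\<lambda>_ _ _. 0) \<le> ereal K"
    unfolding Kf_def using assms by (auto intro!: SUP_least)
  ultimately show ?thesis
    unfolding UU_def mem_Collect_eq using b assms
    by (intro conjI exI[of _ "\<lambda>_. 0"] exI[of _ D] exI[of _ D'] exI[of _ r'] order_refl allI impI) simp_all
qed

lemma UU_boundary_term:
  fixes f :: "('d::finite) field_fun" and D D' :: real
  assumes "f \<in> UU A K D D' r'"
  shows "\<exists>b. boundary_term A f b \<and> (\<forall>S. finite S \<longrightarrow> b S \<le> D * card S) \<and>
    (\<forall>N\<ge>1. \<forall>z. b (translate (cube N) z) \<le> D' * 4 ^ CARD('d) * real r' ^ CARD('d) * real N ^ (CARD('d) - 1))"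
proof -
  obtain b Df Df' rf' where b: "boundary_term A f b" "0 < Df" "Df \<le> D"
    "\<forall>S. finite S \<longrightarrow> b S \<le> Df * real (card S)" "0 < Df'" "Df' \<le> D'" "1 \<le> rf'" "rf' \<le> r'"
    "\<forall>n\<ge>1. \<forall>z. b (translate (cube n) z) \<le> Df' * real (card (bdry rf' (translate (cube n) z)))"
    using assms unfolding UU_def mem_Collect_eq by (elim exE conjE)
  have "b S \<le> D * card S" if "finite S" for S
  proof -
    have "b S \<le> Df * card S" using b(4) that by blast
    also have "\<dots> \<le> D * card S" using b(3) by (intro mult_right_mono) auto
    finally show ?thesis .
  qed
  moreover have "b (translate (cube N) z) \<le> D' * 4 ^ CARD('d) * real r' ^ CARD('d) * real N ^ (CARD('d) - 1)"
    if "1 \<le> N" for N z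
  proof -
    have "b (translate (cube N) z) \<le> Df' * real (card (bdry rf' (translate (cube N) z)))"
      using b(9) that by blast
    also have "\<dots> \<le> D' * (4 ^ CARD('d) * real rf' ^ CARD('d) * real N ^ (CARD('d) - 1))"
      using b(5,6) card_bdry_cube_le[OF that b(7), of z] by (intro mult_mono) auto
    also have "\<dots> \<le> D' * (4 ^ CARD('d) * real r' ^ CARD('d) * real N ^ (CARD('d) - 1))"
      using b(5,6,8) by (intro mult_left_mono mult_right_mono power_mono) auto
    finally show ?thesis by (simp only: mult.assoc)
  qed
  ultimately show ?thesis using b(1) by blast
qed

text \<open>Shrinking a tile to its inner part costs the boundary term of the inner part, which is itself a
  cube, and \<open>K + D\<close> for each of the removed points.\<close>

lemma field_minus_inner_field_le:
  fixes f :: "('d::finite) field_fun" and K D B :: real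
  assumes f: "admissible A f" "Kf A f \<le> ereal K" and \<omega>: "\<omega> \<in> Omega A" and "2 * r < m" "0 \<le> K" "0 \<le> D" "0 \<le> B"
    and b: "boundary_term A f b" "\<And>S. finite S \<Longrightarrow> b S \<le> D * card S"
      "\<And>N z. 1 \<le> N \<Longrightarrow> b (translate (cube N) z) \<le> B * real N ^ (CARD('d) - 1)"
  shows "\<bar>f (cube m) \<omega> E - f (inner_part r (cube m)) \<omega> E\<bar>
    \<le> B * real m ^ (CARD('d) - 1) + (K + D) * (CARD('d) * (2 * r) / m * real m ^ CARD('d))"
proof -
  let ?S = "inner_part r (cube m) :: (int ^ 'd) set"
  let ?R = "cube m - ?S"
  have sub: "?S \<subseteq> cube m" by (auto simp: inner_part_def)
  define P where "P = (\<lambda>i::bool. if i then ?S else ?R)"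
  have "\<bar>f (\<Union>i\<in>UNIV. P i) \<omega> E - (\<Sum>i\<in>UNIV. f (P i) \<omega> E)\<bar> \<le> (\<Sum>i\<in>UNIV. b (P i))"
    by (rule almost_additive[OF b(1) \<omega>])
       (auto simp: P_def finite_inner_part disjoint_family_on_def split: if_splits)
  moreover have "(\<Union>i\<in>UNIV. P i) = cube m" using sub by (auto simp: P_def UNIV_bool)
  ultimately have 1: "\<bar>f (cube m) \<omega> E - (f ?S \<omega> E + f ?R \<omega> E)\<bar> \<le> b ?S + b ?R"
    by (simp add: P_def UNIV_bool add.commute)
  have card_R: "real (card ?R) \<le> CARD('d) * (2 * r) / m * real m ^ CARD('d)"
  proof -
    have "card ?R = card (cube m :: (int ^ 'd) set) - card ?S"
      by (intro card_Diff_subset sub finite_inner_part)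
    then have "real (card ?R) = real m ^ CARD('d) - real (m - 2 * r) ^ CARD('d)"
      using card_mono[OF finite_cube sub] by (simp add: of_nat_diff card_cube inner_part_cube card_translate_cube)
    also have "real (m - 2 * r) = real m - real (2 * r)" using assms(4) by (simp add: of_nat_diff)
    also have "real m ^ CARD('d) - (real m - real (2 * r)) ^ CARD('d) \<le> CARD('d) * real (2 * r) / m * real m ^ CARD('d)"
      using assms(4) by (intro power_minus_power_le) auto
    finally show ?thesis by simp
  qed
  have "\<bar>f ?R \<omega> E\<bar> \<le> K * card ?R" by (rule field_bound[OF f _ \<omega>]) simp
  moreover have "b ?R \<le> D * card ?R" by (rule b(2)) simp
  moreover have "b ?S \<le> B * real m ^ (CARD('d) - 1)"
  proof -
    have "b ?S \<le> B * real (m - 2 * r) ^ (CARD('d) - 1)"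
      unfolding inner_part_cube using assms(4) by (intro b(3)) simp
    also have "\<dots> \<le> B * real m ^ (CARD('d) - 1)"
      using \<open>0 \<le> B\<close> by (intro mult_left_mono power_mono) auto
    finally show ?thesis .
  qed
  ultimately have "\<bar>f (cube m) \<omega> E - f ?S \<omega> E\<bar> \<le> B * real m ^ (CARD('d) - 1) + (K + D) * card ?R"
    using 1 by (simp add: distrib_right)
  also have "\<dots> \<le> B * real m ^ (CARD('d) - 1) + (K + D) * (CARD('d) * (2 * r) / m * real m ^ CARD('d))"
    using card_R assms(5,6) by (intro add_left_mono mult_left_mono) auto
  finally show ?thesis .
qed

text \<open>Three errors add up. The points not covered by tiles cost \<open>K + D\<close> each. Every tile costs its own
  boundary term and the price of shrinking it to its inner part. Finally the sum over the tiles is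
  normalised by \<open>|\<Lambda>\<^sub>n|\<close> on one side and by the volume of all tiles on the other, which costs another
  \<open>K\<close> for each uncovered point. The uncovered points form a fraction of at most \<open>d m / n\<close>.\<close>

lemma field_average_minus_pairing_le:
  fixes f :: "('d::finite) field_fun" and K D D' :: real
  assumes f: "f \<in> UU A K D D' r'" and \<omega>: "\<omega> \<in> Omega A" and m: "2 * r < m" "m \<le> n"
    and pos: "0 < K" "0 < D" "0 < D'"
  shows "\<bar>f (cube n) \<omega> E / real n ^ CARD('d)
      - pairing (floc A f (inner_part r (cube m))) (empirical A r m n \<omega>) E / real m ^ CARD('d)\<bar>
    \<le> (2 * K + D) * (CARD('d) * m / n)
      + (2 * (D' * 4 ^ CARD('d) * real r' ^ CARD('d)) + (K + D) * (2 * CARD('d) * r)) / m"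
proof -
  let ?d = "CARD('d)" and ?S = "inner_part r (cube m) :: (int ^ 'd) set" and ?T = "grid m n :: (int ^ 'd) set"
  have adm: "admissible A f" "Kf A f \<le> ereal K" using f by (auto simp: UU_def)
  define B where "B = D' * 4 ^ ?d * real r' ^ ?d"
  have B: "0 \<le> B" using pos by (simp add: B_def)
  from UU_boundary_term[OF f, folded B_def] obtain b where b1: "boundary_term A f b"
    and b2: "\<forall>S. finite S \<longrightarrow> b S \<le> D * card S"
    and b3: "\<forall>N\<ge>1. \<forall>z. b (translate (cube N) z) \<le> B * real N ^ (?d - 1)"
    by (elim exE conjE)
  note b = b1 b2[rule_format] b3[rule_format]
  have m1: "1 \<le> m" and n1: "1 \<le> n" using m by auto
  have finT: "finite ?T" by (rule finite_grid[OF m1])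
  define C where "C = translate (cube m :: (int ^ 'd) set)"
  define R where "R = cube n - (\<Union>t\<in>?T. C t)"
  define V where "V = real n ^ ?d"
  define W where "W = real m ^ ?d"
  define N where "N = real (card ?T)"
  define s where "s t = f ?S (tau t \<omega>) E" for t
  define sh where "sh = CARD('d) * (2 * r) / m * real m ^ CARD('d)"
  have V: "0 < V" and W: "0 < W" using m1 n1 by (auto simp: V_def W_def)
  have N: "0 < N" using m1 m by (simp add: N_def card_grid div_greater_zero_iff)
  have finR: "finite R" by (simp add: R_def)
  have tile_sub: "(\<Union>t\<in>?T. C t) \<subseteq> cube n" by (auto simp: C_def grid_def)
  have card_tiles: "real (card (\<Union>t\<in>?T. C t)) = N * W"
  proof -
    have "card (\<Union>t\<in>?T. C t) = (\<Sum>t\<in>?T. card (C t))"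
      using disjoint_tiles[of m n] finT
      by (intro card_UN_disjoint) (auto simp: C_def disjoint_family_on_def)
    then show ?thesis by (simp add: C_def card_translate_cube N_def W_def)
  qed
  have card_R: "real (card R) = V - N * W"
  proof -
    have "card R = card (cube n :: (int ^ 'd) set) - card (\<Union>t\<in>?T. C t)"
      unfolding R_def by (rule card_Diff_subset) (use tile_sub finT in \<open>auto simp: C_def\<close>)
    then show ?thesis
      using card_mono[OF finite_cube tile_sub] card_tiles by (simp add: of_nat_diff card_cube V_def)
  qed
  have R_small: "V - N * W \<le> ?d * m / n * V"
  proof -
    have "n = m * (n div m) + n mod m" "n mod m < m" using m1 by simp_all
    then have "n \<le> m * (n div m) + m" by linarith
    then have "real n \<le> real (m * (n div m) + m)" by (rule of_nat_mono)
    then have "real n - real m \<le> real m * real (n div m)" by simp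
    then have "(real n - real m) ^ ?d \<le> (real m * real (n div m)) ^ ?d"
      using m by (intro power_mono) auto
    also have "\<dots> = N * W" by (simp add: N_def W_def card_grid[OF m1] power_mult_distrib mult.commute)
    finally have "V - N * W \<le> real n ^ ?d - (real n - real m) ^ ?d" by (simp add: V_def)
    also have "\<dots> \<le> ?d * m / n * V"
      unfolding V_def of_nat_mult using m n1 by (intro power_minus_power_le) auto
    finally show ?thesis .
  qed
  have NW: "N * W \<le> V" using card_R by linarith
  \<comment> \<open>The tiles and the uncovered rest partition the large cube.\<close>
  define Q where "Q = (\<lambda>i. case i of None \<Rightarrow> R | Some t \<Rightarrow> C t)"
  have split: "\<bar>f (\<Union>i\<in>insert None (Some ` ?T). Q i) \<omega> E - (\<Sum>i\<in>insert None (Some ` ?T). f (Q i) \<omega> E)\<bar>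
      \<le> (\<Sum>i\<in>insert None (Some ` ?T). b (Q i))"
  proof (rule almost_additive[OF b(1) \<omega>])
    show "disjoint_family_on Q (insert None (Some ` ?T))"
      using disjoint_tiles[of m n] by (fastforce simp: disjoint_family_on_def Q_def R_def C_def)
  qed (use finT finR in \<open>auto simp: Q_def C_def\<close>)
  have Un: "(\<Union>i\<in>insert None (Some ` ?T). Q i) = cube n"
    using tile_sub by (auto simp: Q_def R_def)
  have sum_parts: "(\<Sum>i\<in>insert None (Some ` ?T). h (Q i)) = h R + (\<Sum>t\<in>?T. h (C t))" for h :: "_ \<Rightarrow> real"
    using finT by (subst sum.insert) (auto simp: sum.reindex Q_def)
  have 1: "\<bar>f (cube n) \<omega> E - (f R \<omega> E + (\<Sum>t\<in>?T. f (C t) \<omega> E))\<bar> \<le> b R + (\<Sum>t\<in>?T. b (C t))"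
    using split unfolding Un sum_parts[of "\<lambda>X. f X \<omega> E"] sum_parts[of b] .
  have 2: "b R \<le> D * (V - N * W)" using b(2)[OF finR] card_R by simp
  have 3: "\<bar>f R \<omega> E\<bar> \<le> K * (V - N * W)" using field_bound[OF adm finR \<omega>] card_R by metis
  have 4: "(\<Sum>t\<in>?T. b (C t)) \<le> N * (B * real m ^ (?d - 1))"
    using sum_bounded_above[of ?T "\<lambda>t. b (C t)" "B * real m ^ (?d - 1)"] b(3)[OF m1]
    by (simp add: C_def N_def)
  have 5: "\<bar>(\<Sum>t\<in>?T. f (C t) \<omega> E) - (\<Sum>t\<in>?T. s t)\<bar> \<le> N * (B * real m ^ (?d - 1) + (K + D) * sh)"
  proof -
    have "\<bar>f (C t) \<omega> E - s t\<bar> \<le> B * real m ^ (?d - 1) + (K + D) * sh" for t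
      unfolding C_def s_def sh_def admissible_translate[OF adm(1) finite_cube \<omega>]
      using pos by (intro field_minus_inner_field_le[OF adm tau_Omega[OF \<omega>] m(1) _ _ B b]) auto
    then have "(\<Sum>t\<in>?T. \<bar>f (C t) \<omega> E - s t\<bar>) \<le> N * (B * real m ^ (?d - 1) + (K + D) * sh)"
      unfolding N_def by (intro sum_bounded_above)
    then show ?thesis
      unfolding sum_subtractf[symmetric] using sum_abs[of "\<lambda>t. f (C t) \<omega> E - s t" ?T] by linarith
  qed
  have 6: "\<bar>\<Sum>t\<in>?T. s t\<bar> \<le> N * (K * W)"
  proof -
    have "\<bar>s t\<bar> \<le> K * W" for t
    proof -
      have "\<bar>s t\<bar> \<le> K * card ?S"
        unfolding s_def by (rule field_bound[OF adm finite_inner_part tau_Omega[OF \<omega>]])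
      also have "real (card ?S) \<le> W"
        unfolding inner_part_cube card_translate_cube W_def of_nat_power by (intro power_mono) auto
      finally show ?thesis using pos by (simp add: mult_left_mono)
    qed
    then have "(\<Sum>t\<in>?T. \<bar>s t\<bar>) \<le> N * (K * W)"
      unfolding N_def by (intro sum_bounded_above)
    then show ?thesis using sum_abs[of s ?T] by linarith
  qed
  define \<Sigma> where "\<Sigma> = (\<Sum>t\<in>?T. s t)"
  have pair: "pairing (floc A f ?S) (empirical A r m n \<omega>) E = \<Sigma> / N"
    unfolding pairing_empirical[OF adm(1) \<omega> m1] \<Sigma>_def N_def s_def
    by (simp add: floc_restrict[OF adm(1) finite_inner_part tau_Omega[OF \<omega>]])
  have "\<bar>f (cube n) \<omega> E / V - \<Sigma> / V\<bar> \<le> ((K + D) * (V - N * W) + N * (2 * (B * real m ^ (?d - 1)) + (K + D) * sh)) / V"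
  proof -
    have "\<bar>f (cube n) \<omega> E - \<Sigma>\<bar> \<le> (K + D) * (V - N * W) + N * (2 * (B * real m ^ (?d - 1)) + (K + D) * sh)"
      using 1 2 3 4 5 unfolding \<Sigma>_def by (simp add: algebra_simps)
    then have "\<bar>f (cube n) \<omega> E - \<Sigma>\<bar> / V \<le> ((K + D) * (V - N * W) + N * (2 * (B * real m ^ (?d - 1)) + (K + D) * sh)) / V"
      using V by (intro divide_right_mono) auto
    then show ?thesis using V by (simp add: diff_divide_distrib[symmetric])
  qed
  also have "\<dots> = (K + D) * ((V - N * W) / V) + N / V * (2 * (B * real m ^ (?d - 1)) + (K + D) * sh)"
    by (simp add: add_divide_distrib)
  also have "\<dots> \<le> (K + D) * ((V - N * W) / V) + 1 / W * (2 * (B * real m ^ (?d - 1)) + (K + D) * sh)"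
  proof (intro add_left_mono mult_right_mono)
    show "N / V \<le> 1 / W" using NW V W by (simp add: field_simps)
    show "0 \<le> 2 * (B * real m ^ (?d - 1)) + (K + D) * sh" using B pos by (simp add: sh_def)
  qed
  also have "1 / W * (2 * (B * real m ^ (?d - 1)) + (K + D) * sh) = (2 * B + (K + D) * (2 * ?d * r)) / m"
  proof -
    have Wd: "W = real m * real m ^ (?d - 1)"
      unfolding W_def by (metis power_minus_mult mult.commute zero_less_card_finite)
    have "sh = 2 * ?d * r * real m ^ (?d - 1)"
      unfolding sh_def W_def[symmetric] Wd using m1 by simp
    then show ?thesis unfolding Wd using m1 by (simp add: field_simps)
  qed
  finally have A: "\<bar>f (cube n) \<omega> E / V - \<Sigma> / V\<bar>
    \<le> (K + D) * ((V - N * W) / V) + (2 * B + (K + D) * (2 * ?d * r)) / m" .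
  \<comment> \<open>Now the normalisation is changed from the volume of the cube to that of the tiles.\<close>
  have "\<bar>\<Sigma> / V - \<Sigma> / N / W\<bar> = \<bar>\<Sigma>\<bar> * (1 / (N * W) - 1 / V)"
  proof -
    have "0 \<le> 1 / (N * W) - 1 / V" using NW V W N by (simp add: field_simps)
    moreover have "\<Sigma> / V - \<Sigma> / N / W = - (\<Sigma> * (1 / (N * W) - 1 / V))" by (simp add: algebra_simps)
    ultimately show ?thesis by (simp add: abs_mult)
  qed
  also have "\<dots> \<le> (N * (K * W)) * (1 / (N * W) - 1 / V)"
    using 6 NW V W N unfolding \<Sigma>_def by (intro mult_right_mono) (auto simp: field_simps)
  also have "\<dots> = K * ((V - N * W) / V)" using V W N by (simp add: field_simps)
  finally have C': "\<bar>\<Sigma> / V - \<Sigma> / N / W\<bar> \<le> K * ((V - N * W) / V)" .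
  have "(2 * K + D) * ((V - N * W) / V) = (K + D) * ((V - N * W) / V) + K * ((V - N * W) / V)"
    unfolding distrib_right[symmetric] by simp
  with A C' have "\<bar>f (cube n) \<omega> E / V - \<Sigma> / N / W\<bar>
      \<le> (2 * K + D) * ((V - N * W) / V) + (2 * B + (K + D) * (2 * ?d * r)) / m"
    by linarith
  also have "\<dots> \<le> (2 * K + D) * (?d * m / n) + (2 * B + (K + D) * (2 * ?d * r)) / m"
    using R_small V pos by (intro add_right_mono mult_left_mono) (auto simp: pos_divide_le_eq)
  finally show ?thesis unfolding pair V_def W_def B_def .
qed

section \<open>Limits of bounded right-continuous functions\<close>

lemma supnorm_tendsto_0_iff:
  "(\<lambda>n. supnorm (h n)) \<longlonglongrightarrow> 0 \<longleftrightarrow> (\<forall>\<epsilon>>0. \<forall>\<^sub>F n in sequentially. \<forall>E. \<bar>h n E\<bar> \<le> \<epsilon>)"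
proof (intro iffI allI impI)
  fix \<epsilon> :: real assume "(\<lambda>n. supnorm (h n)) \<longlonglongrightarrow> 0" "0 < \<epsilon>"
  then have "\<forall>\<^sub>F n in sequentially. supnorm (h n) < ereal \<epsilon>" by (intro order_tendstoD(2)) auto
  then show "\<forall>\<^sub>F n in sequentially. \<forall>E. \<bar>h n E\<bar> \<le> \<epsilon>"
    by eventually_elim (simp add: supnorm_le_iff[symmetric] less_imp_le)
next
  assume small: "\<forall>\<epsilon>>0. \<forall>\<^sub>F n in sequentially. \<forall>E. \<bar>h n E\<bar> \<le> \<epsilon>"
  show "(\<lambda>n. supnorm (h n)) \<longlonglongrightarrow> 0"
  proof (rule order_tendstoI)
    fix a :: ereal assume "a < 0"
    then show "\<forall>\<^sub>F n in sequentially. a < supnorm (h n)"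
      by (intro always_eventually allI less_le_trans[OF _ supnorm_nonneg])
  next
    fix a :: ereal assume "0 < a"
    then obtain \<epsilon> where \<epsilon>: "0 < ereal \<epsilon>" "ereal \<epsilon> < a" using ereal_dense2 by blast
    then have "\<forall>\<^sub>F n in sequentially. \<forall>E. \<bar>h n E\<bar> \<le> \<epsilon>" using small by simp
    then show "\<forall>\<^sub>F n in sequentially. supnorm (h n) < a"
      by eventually_elim (use \<epsilon> supnorm_le_iff le_less_trans in blast)
  qed
qed

text \<open>The limit is described through the approximations \<open>q m\<close> and not through \<open>g\<close>. For the fields,
  \<open>q m\<close> is deterministic while \<open>g\<close> depends on the coloring; so the limit is the same for all
  colorings.\<close>

lemma uniform_limit_of_approximations:
  fixes g q :: "nat \<Rightarrow> 'a \<Rightarrow> real"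
  assumes approx: "\<And>m \<epsilon>. M0 < m \<Longrightarrow> 0 < \<epsilon> \<Longrightarrow> \<forall>\<^sub>F n in sequentially. \<forall>E. \<bar>g n E - q m E\<bar> \<le> c m + \<epsilon>"
    and c: "c \<longlonglongrightarrow> 0"
  shows "M0 < m \<Longrightarrow> \<bar>lim (\<lambda>m. q m E) - q m E\<bar> \<le> c m"
    and "0 < \<epsilon> \<Longrightarrow> \<forall>\<^sub>F n in sequentially. \<forall>E. \<bar>g n E - lim (\<lambda>m. q m E)\<bar> \<le> \<epsilon>"
proof -
  have close: "\<bar>q m E - q m' E\<bar> \<le> c m + c m'" if "M0 < m" "M0 < m'" for m m' E
  proof (rule field_le_epsilon)
    fix e :: real assume "0 < e"
    then have "0 < e / 2" by simp
    from approx[OF that(1) this] approx[OF that(2) this]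
    have "\<forall>\<^sub>F n in sequentially. \<bar>q m E - q m' E\<bar> \<le> c m + c m' + e"
    proof eventually_elim
      case (elim n)
      then have "\<bar>g n E - q m E\<bar> \<le> c m + e / 2" "\<bar>g n E - q m' E\<bar> \<le> c m' + e / 2" by auto
      then show ?case by linarith
    qed
    then show "\<bar>q m E - q m' E\<bar> \<le> c m + c m' + e" by simp
  qed
  have conv: "(\<lambda>m. q m E) \<longlonglongrightarrow> lim (\<lambda>m. q m E)" for E
  proof -
    have "Cauchy (\<lambda>m. q m E)"
    proof (rule metric_CauchyI)
      fix e :: real assume "0 < e"
      then have "\<forall>\<^sub>F m in sequentially. c m < e / 2" using c by (intro order_tendstoD(2)) auto
      then obtain M1 where M1: "\<And>m. M1 \<le> m \<Longrightarrow> c m < e / 2" by (auto simp: eventually_sequentially)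
      have "dist (q m E) (q m' E) < e" if "max M1 (Suc M0) \<le> m" "max M1 (Suc M0) \<le> m'" for m m'
        using close[of m m' E] M1[of m] M1[of m'] that by (simp add: dist_real_def)
      then show "\<exists>M. \<forall>m\<ge>M. \<forall>n\<ge>M. dist (q m E) (q n E) < e" by blast
    qed
    then show ?thesis using Cauchy_convergent convergent_LIMSEQ_iff by blast
  qed
  have limit: "\<bar>lim (\<lambda>m. q m E) - q m E\<bar> \<le> c m" if "M0 < m" for m E
  proof (rule tendsto_le[OF trivial_limit_sequentially])
    show "(\<lambda>m'. \<bar>q m' E - q m E\<bar>) \<longlonglongrightarrow> \<bar>lim (\<lambda>m. q m E) - q m E\<bar>" by (intro tendsto_intros conv)
    show "(\<lambda>m'. c m' + c m) \<longlonglongrightarrow> c m" using tendsto_add[OF c tendsto_const[of "c m"]] by simp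
    show "\<forall>\<^sub>F m' in sequentially. \<bar>q m' E - q m E\<bar> \<le> c m' + c m"
      using eventually_gt_at_top[of M0] by eventually_elim (rule close[OF _ that])
  qed
  then show "M0 < m \<Longrightarrow> \<bar>lim (\<lambda>m. q m E) - q m E\<bar> \<le> c m" .
  assume "0 < \<epsilon>"
  then have "\<forall>\<^sub>F m in sequentially. c m < \<epsilon> / 3" using c by (intro order_tendstoD(2)) auto
  then have "\<forall>\<^sub>F m in sequentially. c m < \<epsilon> / 3 \<and> M0 < m"
    using eventually_gt_at_top[of M0] by (rule eventually_conj)
  then obtain m where m: "c m < \<epsilon> / 3" "M0 < m" using eventually_happens trivial_limit_sequentially by blast
  have "\<forall>\<^sub>F n in sequentially. \<forall>E. \<bar>g n E - q m E\<bar> \<le> c m + \<epsilon> / 3"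
    using approx[OF m(2)] \<open>0 < \<epsilon>\<close> by simp
  then show "\<forall>\<^sub>F n in sequentially. \<forall>E. \<bar>g n E - lim (\<lambda>m. q m E)\<bar> \<le> \<epsilon>"
  proof eventually_elim
    case (elim n)
    show ?case
    proof
      fix E
      have "\<bar>g n E - q m E\<bar> \<le> c m + \<epsilon> / 3" using elim by blast
      then show "\<bar>g n E - lim (\<lambda>m. q m E)\<bar> \<le> \<epsilon>" using limit[OF m(2), of E] m(1) by linarith
    qed
  qed
qed

lemma BB_uniform_limit:
  assumes g: "\<And>n. g n \<in> BB" and lim: "\<forall>\<epsilon>>0. \<forall>\<^sub>F n in sequentially. \<forall>E. \<bar>g n E - F E\<bar> \<le> \<epsilon>"
  shows "F \<in> BB"
proof -
  have unif: "uniform_limit UNIV g F sequentially"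
    unfolding uniform_limit_iff
  proof (intro allI impI)
    fix e :: real assume "0 < e"
    then have "\<forall>\<^sub>F n in sequentially. \<forall>E. \<bar>g n E - F E\<bar> \<le> e / 2"
      using lim half_gt_zero by blast
    then show "\<forall>\<^sub>F n in sequentially. \<forall>E\<in>UNIV. dist (g n E) (F E) < e"
    proof eventually_elim
      case (elim n)
      show ?case
      proof
        fix E
        have "\<bar>g n E - F E\<bar> \<le> e / 2" using elim by blast
        then show "dist (g n E) (F E) < e" using \<open>0 < e\<close> by (simp add: dist_real_def)
      qed
    qed
  qed
  have "continuous (at_right E) F" for E
  proof -
    have "(F \<longlongrightarrow> F E) (at E within {E<..})"
    proof (rule swap_uniform_limit)
      show "\<forall>\<^sub>F n in sequentially. (g n \<longlongrightarrow> g n E) (at E within {E<..})"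
        using g by (auto simp: BB_def continuous_within)
      show "(\<lambda>n. g n E) \<longlonglongrightarrow> F E" by (rule tendsto_uniform_limitI[OF unif]) simp
      show "uniform_limit {E<..} g F sequentially" by (rule uniform_limit_on_subset[OF unif]) simp
    qed simp
    then show ?thesis by (simp add: continuous_within)
  qed
  moreover have "bounded (range F)"
  proof -
    obtain n where n: "\<forall>E. \<bar>g n E - F E\<bar> \<le> 1"
      using lim[rule_format, of 1] eventually_happens trivial_limit_sequentially by fastforce
    obtain C where C: "\<And>E. \<bar>g n E\<bar> \<le> C"
      using g[of n] unfolding BB_def bounded_iff by auto
    have "\<bar>F E\<bar> \<le> C + 1" for E using n[rule_format, of E] C[of E] by linarith
    then show ?thesis unfolding bounded_iff by auto
  qed
  ultimately show ?thesis by (simp add: BB_def)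
qed

section \<open>The almost sure limit and the error bound\<close>

lemma (in prob_space) AE_imp_prob_1_event:
  assumes "AE x in M. Q x"
  shows "\<exists>G\<in>sets M. prob G = 1 \<and> (\<forall>x\<in>G. Q x)"
proof -
  obtain N where N: "{x \<in> space M. \<not> Q x} \<subseteq> N" "emeasure M N = 0" "N \<in> sets M"
    using assms by (rule AE_E)
  then have "prob N = 0" by (simp add: measure_def)
  then have "prob (space M - N) = 1" using N(3) by (simp add: prob_compl)
  then show ?thesis using N by (intro bexI[of _ "space M - N"]) auto
qed

lemma BB_divide:
  assumes "F \<in> BB"
  shows "(\<lambda>E. F E / c) \<in> BB"
proof -
  have "continuous (at_right E) (\<lambda>E. F E / c)" for E
    using assms unfolding BB_def mem_Collect_eq continuous_within divide_inverse
    by (intro tendsto_mult_right) blast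
  moreover have "bounded (range (\<lambda>E. F E / c))"
  proof -
    have "bounded ((\<lambda>x. x * inverse c) ` range F)"
      by (rule bounded_linear_image[OF _ bounded_linear_mult_left]) (use assms in \<open>simp add: BB_def\<close>)
    then show ?thesis by (simp add: image_image divide_inverse)
  qed
  ultimately show ?thesis by (simp add: BB_def)
qed

lemma real_le_power_nat: "1 \<le> k \<Longrightarrow> real n \<le> real n ^ k"
  by (cases "n = 0") (auto intro: self_le_power)

text \<open>The exponent grows at least linearly in \<open>n\<close>, so a geometric series dominates.\<close>

lemma summable_exp_div:
  assumes "0 < a" "1 \<le> m" "1 \<le> k"
  shows "summable (\<lambda>n. exp (- a * real (n div m) ^ k))"
proof (rule summable_comparison_test')
  show "summable (\<lambda>n. exp a * exp (- a / m) ^ n)"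
    using assms by (intro summable_mult summable_geometric) simp
  fix n :: nat
  \<comment> \<open>\<open>n div m \<ge> n / m - 1\<close>, and raising a natural number to a positive power does not decrease it.\<close>
  have "n = m * (n div m) + n mod m" "n mod m < m" using assms(2) by simp_all
  then have "n \<le> m * (n div m) + m" by linarith
  then have "real n \<le> real (m * (n div m) + m)" by (rule of_nat_mono)
  then have "real n / m - 1 \<le> real (n div m)" using assms(2) by (simp add: field_simps)
  also have "\<dots> \<le> real (n div m) ^ k" by (rule real_le_power_nat[OF assms(3)])
  finally have "a * (real n / m - 1) \<le> a * real (n div m) ^ k"
    using assms(1) by (intro mult_left_mono) auto
  then have "exp (- a * real (n div m) ^ k) \<le> exp (a + real n * (- a / m))"
    by (simp add: algebra_simps)
  also have "\<dots> = exp a * exp (- a / m) ^ n" by (simp only: exp_add exp_of_nat_mult)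
  finally show "norm (exp (- a * real (n div m) ^ k)) \<le> exp a * exp (- a / m) ^ n" by simp
qed

text \<open>The left side collects the error \<open>e(m, n)\<close> of \<open>field_average_minus_pairing_le\<close> and its limit
  for \<open>n \<rightarrow> \<infinity>\<close>. The comparison is termwise and uses \<open>d \<le> 4\<^sup>d\<close> and \<open>x \<le> x\<^sup>d\<close> for natural numbers \<open>x\<close>.\<close>

lemma error_constants_le:
  fixes K D D' :: real
  assumes "0 < K" "0 < D" "0 < D'" "2 * m < n" "2 * r < m" "1 \<le> d"
  shows "(2 * K + D) * (real (d * m) / real n)
      + 2 * ((2 * (D' * 4 ^ d * real r' ^ d) + (K + D) * real (2 * d * r)) / real m)
    \<le> 2 ^ (2 * d + 1) * (((2 * K + D) * real m ^ d + D' * real r' ^ d) / (real n - 2 * real m)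
      + (2 * (K + D) * real r ^ d + 3 * D' * real r' ^ d) / (real m - 2 * real r))"
proof -
  define q :: real where "q = 4 ^ d"
  have q: "2 ^ (2 * d + 1) = 2 * q" by (simp add: q_def power_mult)
  have "d < 4 ^ d" by (rule less_exp[THEN less_le_trans]) (auto intro: power_mono)
  then have "real d < real (4 ^ d)" by (rule of_nat_less_iff[THEN iffD2])
  then have dq: "real d \<le> q" by (simp add: q_def)
  moreover have "0 \<le> q" by (simp add: q_def)
  ultimately have d2q: "real d \<le> 2 * q" by linarith
  have n: "0 < real n - 2 * real m" "real n - 2 * real m \<le> real n" using assms by auto
  have m: "0 < real m - 2 * real r" "real m - 2 * real r \<le> real m" using assms by auto
  have "real (d * m) / real n \<le> real (d * m) / (real n - 2 * real m)"
    using n by (intro divide_left_mono) auto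
  also have "\<dots> \<le> (2 * q * real m ^ d) / (real n - 2 * real m)"
  proof (rule divide_right_mono)
    have "real d * real m \<le> (2 * q) * real m ^ d"
      using d2q \<open>0 \<le> q\<close> real_le_power_nat[OF assms(6)] by (intro mult_mono) auto
    then show "real (d * m) \<le> 2 * q * real m ^ d" by simp
  qed (use n in simp)
  finally have "(2 * K + D) * (real (d * m) / real n) \<le> (2 * K + D) * ((2 * q * real m ^ d) / (real n - 2 * real m))"
    using assms by (intro mult_left_mono) auto
  also have "\<dots> = 2 * q * ((2 * K + D) * real m ^ d / (real n - 2 * real m))" by simp
  also have "\<dots> \<le> 2 * q * (((2 * K + D) * real m ^ d + D' * real r' ^ d) / (real n - 2 * real m))"
    using assms n by (intro mult_left_mono divide_right_mono) (auto simp: q_def)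
  finally have 1: "(2 * K + D) * (real (d * m) / real n)
    \<le> 2 * q * (((2 * K + D) * real m ^ d + D' * real r' ^ d) / (real n - 2 * real m))" .
  have "2 * ((2 * (D' * q * real r' ^ d) + (K + D) * real (2 * d * r)) / real m)
      \<le> 2 * ((2 * (D' * q * real r' ^ d) + (K + D) * real (2 * d * r)) / (real m - 2 * real r))"
    using assms m by (intro mult_left_mono divide_left_mono add_nonneg_nonneg) (auto simp: q_def)
  also have "\<dots> \<le> 2 * ((q * (2 * (K + D) * real r ^ d + 3 * D' * real r' ^ d)) / (real m - 2 * real r))"
  proof (intro mult_left_mono divide_right_mono)
    have "(K + D) * (2 * (real d * real r)) \<le> (K + D) * (2 * (q * real r ^ d))"
      using assms dq real_le_power_nat[OF assms(6)] by (intro mult_left_mono mult_mono) (auto simp: q_def)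
    moreover have "0 \<le> D' * q * real r' ^ d" using assms by (simp add: q_def)
    ultimately show "2 * (D' * q * real r' ^ d) + (K + D) * real (2 * d * r)
        \<le> q * (2 * (K + D) * real r ^ d + 3 * D' * real r' ^ d)"
      by (simp add: algebra_simps)
  qed (use m in auto)
  also have "\<dots> = 2 * q * ((2 * (K + D) * real r ^ d + 3 * D' * real r' ^ d) / (real m - 2 * real r))" by simp
  finally show ?thesis using 1 unfolding q q_def[symmetric] distrib_left by linarith
qed

context coloring_process
begin

abbreviation worst_deviation :: "real \<Rightarrow> real \<Rightarrow> real \<Rightarrow> nat \<Rightarrow> nat \<Rightarrow> nat \<Rightarrow> (int ^ 'd \<Rightarrow> real) \<Rightarrow> ereal" where
  "worst_deviation K D D' r' m n \<omega> \<equiv> SUP f\<in>(UU A K D D' r' :: 'd field_fun set). deviation A P r m n \<omega> f"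

text \<open>Two events of probability \<open>1\<close> have a common point, so the almost sure limit is unique.\<close>

lemma fstar_eqI:
  assumes F: "F \<in> BB" and G: "G \<in> sets P" "prob G = 1"
    and lim: "\<And>\<omega>. \<omega> \<in> G \<Longrightarrow>
      (\<lambda>n. supnorm (\<lambda>E. f (cube n) \<omega> E / real (card (cube n :: (int ^ 'd) set)) - F E)) \<longlonglongrightarrow> 0"
  shows "fstar P (f :: 'd field_fun) = F"
  unfolding fstar_def
proof (rule the_equality)
  show "F \<in> BB \<and> (\<exists>G\<in>sets P. prob G = 1 \<and> (\<forall>\<omega>\<in>G.
      (\<lambda>n. supnorm (\<lambda>E. f (cube n) \<omega> E / real (card (cube n :: (int ^ 'd) set)) - F E)) \<longlonglongrightarrow> 0))"
    using assms by blast
next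
  fix F' assume "F' \<in> BB \<and> (\<exists>G\<in>sets P. prob G = 1 \<and> (\<forall>\<omega>\<in>G.
      (\<lambda>n. supnorm (\<lambda>E. f (cube n) \<omega> E / real (card (cube n :: (int ^ 'd) set)) - F' E)) \<longlonglongrightarrow> 0))"
  then obtain G' where G': "G' \<in> sets P" "prob G' = 1" and lim': "\<And>\<omega>. \<omega> \<in> G' \<Longrightarrow>
      (\<lambda>n. supnorm (\<lambda>E. f (cube n) \<omega> E / real (card (cube n :: (int ^ 'd) set)) - F' E)) \<longlonglongrightarrow> 0"
    by blast
  have "G \<inter> G' \<noteq> {}"
  proof
    assume "G \<inter> G' = {}"
    then have "prob (G \<union> G') = 2" using finite_measure_Union[OF G(1) G'(1)] G G' by simp
    then show False using prob_le_1[of "G \<union> G'"] by simp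
  qed
  then obtain \<omega> where \<omega>: "\<omega> \<in> G" "\<omega> \<in> G'" by blast
  define g where "g n E = f (cube n) \<omega> E / real (card (cube n :: (int ^ 'd) set))" for n E
  show "F' = F"
  proof
    fix E
    have conv: "(\<lambda>n. g n E) \<longlonglongrightarrow> H E" if "(\<lambda>n. supnorm (\<lambda>E. g n E - H E)) \<longlonglongrightarrow> 0" for H
    proof (rule tendstoI)
      fix e :: real assume "0 < e"
      then have "\<forall>\<^sub>F n in sequentially. \<forall>E. \<bar>g n E - H E\<bar> \<le> e / 2"
        using that half_gt_zero unfolding supnorm_tendsto_0_iff by blast
      then show "\<forall>\<^sub>F n in sequentially. dist (g n E) (H E) < e"
      proof eventually_elim
        case (elim n)
        then have "\<bar>g n E - H E\<bar> \<le> e / 2" by blast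
        then show ?case using \<open>0 < e\<close> by (simp add: dist_real_def)
      qed
    qed
    show "F' E = F E"
      using conv[OF lim'[OF \<omega>(2), folded g_def]] conv[OF lim[OF \<omega>(1), folded g_def]]
      by (rule LIMSEQ_unique)
  qed
qed

text \<open>Borel-Cantelli, for every \<open>m\<close> and along \<open>\<epsilon> = 1 / (k + 1)\<close>. It is applied to the events of
  \<open>deviation_exponential\<close>, which are measurable although the supremum over \<open>f\<close> need not be.\<close>

lemma deviation_SUP_tendsto_0:
  fixes K :: real
  assumes "0 < K"
  shows "\<exists>G\<in>sets P. prob G = 1 \<and> (\<forall>D D' r'. 0 < D \<and> 0 < D' \<and> 1 \<le> r' \<longrightarrow> (\<forall>m\<ge>1. \<forall>\<omega>\<in>G.
    (\<lambda>n. worst_deviation K D D' r' m n \<omega>) \<longlonglongrightarrow> 0))"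
proof -
  let ?small = "\<lambda>m n \<epsilon> \<omega>. \<forall>f :: 'd field_fun. admissible A f \<longrightarrow> Kf A f \<le> ereal K \<longrightarrow>
    deviation A P r m n \<omega> f \<le> ereal \<epsilon>"
  have "AE \<omega> in P. \<forall>\<^sub>F n in sequentially. ?small m n \<epsilon> \<omega>" if m: "1 \<le> m" and "0 < \<epsilon>" for m \<epsilon>
  proof -
    obtain a b where a: "0 < a" and ab: "\<forall>n\<ge>m. \<exists>G\<in>sets P.
        1 - b * exp (- a * real (n div m) ^ CARD('d)) \<le> prob G \<and> (\<forall>\<omega>\<in>G. ?small m n \<epsilon> \<omega>)"
      using deviation_exponential[OF m \<open>0 < \<epsilon>\<close> assms] by (elim exE conjE)
    then have "\<forall>n. \<exists>G. m \<le> n \<longrightarrow> G \<in> sets P \<and>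
        1 - b * exp (- a * real (n div m) ^ CARD('d)) \<le> prob G \<and> (\<forall>\<omega>\<in>G. ?small m n \<epsilon> \<omega>)"
      by blast
    then obtain G where G: "\<forall>n. m \<le> n \<longrightarrow> G n \<in> sets P \<and>
        1 - b * exp (- a * real (n div m) ^ CARD('d)) \<le> prob (G n) \<and> (\<forall>\<omega>\<in>G n. ?small m n \<epsilon> \<omega>)"
      by (rule choice[THEN exE])
    \<comment> \<open>No event is available for the finitely many \<open>n < m\<close>.\<close>
    define Bad where "Bad n = (if m \<le> n then space P - G n else {})" for n
    have Bad: "Bad n \<in> sets P" for n using G by (auto simp: Bad_def)
    have "AE \<omega> in P. \<forall>\<^sub>F n in sequentially. \<omega> \<in> space P - Bad n"
    proof (rule borel_cantelli_AE1[OF Bad])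
      show "summable (\<lambda>n. prob (Bad n))"
      proof (rule summable_comparison_test')
        show "summable (\<lambda>n. \<bar>b\<bar> * exp (- a * real (n div m) ^ CARD('d)))"
          using summable_exp_div[OF a m] by (intro summable_mult) (simp add: Suc_le_eq)
        fix n
        show "norm (prob (Bad n)) \<le> \<bar>b\<bar> * exp (- a * real (n div m) ^ CARD('d))"
        proof (cases "m \<le> n")
          case True
          then have "prob (Bad n) \<le> b * exp (- a * real (n div m) ^ CARD('d))"
            using G[rule_format, OF True] by (simp add: Bad_def prob_compl)
          also have "\<dots> \<le> \<bar>b\<bar> * exp (- a * real (n div m) ^ CARD('d))" by (intro mult_right_mono) auto
          finally show ?thesis by simp
        qed (simp add: Bad_def)
      qed
    qed (simp add: less_top[symmetric])
    then show ?thesis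
    proof eventually_elim
      case (elim \<omega>)
      from elim eventually_ge_at_top[of m] show ?case
        by eventually_elim (use G in \<open>auto simp: Bad_def\<close>)
    qed
  qed
  then have "AE \<omega> in P. \<forall>m k. \<forall>\<^sub>F n in sequentially. ?small (Suc m) n (1 / Suc k) \<omega>"
    by (intro AE_all_countable[THEN iffD2] allI) auto
  from AE_imp_prob_1_event[OF this] obtain G where G: "G \<in> sets P" "prob G = 1"
    and small': "\<forall>\<omega>\<in>G. \<forall>m k. \<forall>\<^sub>F n in sequentially. ?small (Suc m) n (1 / Suc k) \<omega>"
    by (elim bexE conjE)
  have small: "\<forall>\<^sub>F n in sequentially. ?small (Suc m) n (1 / Suc k) \<omega>" if "\<omega> \<in> G" for \<omega> m k
    using bspec[OF small' that, THEN spec, THEN spec, of m k] .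
  have "(\<lambda>n. worst_deviation K D D' r' m n \<omega>) \<longlonglongrightarrow> 0"
    if pos: "0 < D" "0 < D'" "1 \<le> r'" and m: "1 \<le> m" and \<omega>: "\<omega> \<in> G" for D D' :: real and r' m \<omega>
  proof (rule order_tendstoI)
    fix x :: ereal assume "x < 0"
    have nonneg: "0 \<le> worst_deviation K D D' r' m n \<omega>" for n
    proof -
      have "0 \<le> deviation A P r m n \<omega> (\<lambda>_ _ _. 0)" unfolding deviation_def by (rule supnorm_nonneg)
      also have "\<dots> \<le> worst_deviation K D D' r' m n \<omega>"
        by (rule SUP_upper[OF zero_in_UU[OF assms pos]])
      finally show ?thesis .
    qed
    show "\<forall>\<^sub>F n in sequentially. x < worst_deviation K D D' r' m n \<omega>"
      by (intro always_eventually allI less_le_trans[OF \<open>x < 0\<close> nonneg])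
  next
    fix x :: ereal assume "0 < x"
    then obtain \<epsilon> where \<epsilon>: "0 < ereal \<epsilon>" "ereal \<epsilon> < x" using ereal_dense2 by blast
    then have "0 < \<epsilon>" by simp
    then obtain k where k: "1 / Suc k < \<epsilon>" by (rule nat_approx_posE)
    obtain m' where m': "m = Suc m'" using m by (cases m) auto
    show "\<forall>\<^sub>F n in sequentially. worst_deviation K D D' r' m n \<omega> < x"
      using small[OF \<omega>, of m' k]
    proof eventually_elim
      case (elim n)
      then have "worst_deviation K D D' r' m n \<omega> \<le> ereal (1 / Suc k)"
        by (intro SUP_least) (simp add: UU_def m')
      also have "\<dots> < x" using k \<epsilon>(2) by (metis ereal_less(1) less_ereal.simps(1) less_trans)
      finally show ?case .
    qed
  qed
  then show ?thesis using G by (intro bexI[of _ G]) auto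
qed

text \<open>For every coloring in \<open>G\<close>, the fields \<open>f(\<Lambda>\<^sub>n) / |\<Lambda>\<^sub>n|\<close> are eventually within the stated
  error plus any \<open>\<epsilon> > 0\<close> of the integral against the marginal, divided by \<open>|\<Lambda>\<^sub>m|\<close>. This makes them converge uniformly in \<open>E\<close>, to a
  limit that is the same for all these colorings and is therefore \<open>fstar\<close>.\<close>

lemma fstar_minus_marginal_pairing_le:
  fixes f :: "'d field_fun" and K D D' :: real
  assumes f: "f \<in> UU A K D D' r'" and pos: "0 < K" "0 < D" "0 < D'"
    and G: "G \<in> sets P" "prob G = 1"
    and dev: "\<And>m \<omega>. 1 \<le> m \<Longrightarrow> \<omega> \<in> G \<Longrightarrow>
      (\<lambda>n. worst_deviation K D D' r' m n \<omega>) \<longlonglongrightarrow> 0"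
    and m: "2 * r < m"
  shows "\<bar>fstar P f E - pairing (floc A f (inner_part r (cube m))) (marginal A P (inner_part r (cube m))) E / real m ^ CARD('d)\<bar>
    \<le> (2 * (D' * 4 ^ CARD('d) * real r' ^ CARD('d)) + (K + D) * real (2 * CARD('d) * r)) / real m"
proof -
  define C where "C = 2 * (D' * 4 ^ CARD('d) * real r' ^ CARD('d)) + (K + D) * real (2 * CARD('d) * r)"
  define q where "q m E = pairing (floc A f (inner_part r (cube m))) (marginal A P (inner_part r (cube m))) E / real m ^ CARD('d)" for m E
  define g where "g \<omega> n E = f (cube n) \<omega> E / real n ^ CARD('d)" for \<omega> n E
  define F where "F E = lim (\<lambda>m. q m E)" for E
  have adm: "admissible A f" using f by (simp add: UU_def)
  have GO: "\<omega> \<in> Omega A" if "\<omega> \<in> G" for \<omega> using that G(1) sets.sets_into_space space_P by blast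
  have approx: "\<forall>\<^sub>F n in sequentially. \<forall>E. \<bar>g \<omega> n E - q m E\<bar> \<le> C / m + \<epsilon>"
    if \<omega>: "\<omega> \<in> G" and m: "2 * r < m" and "0 < \<epsilon>" for \<omega> m \<epsilon>
  proof -
    define W where "W = real m ^ CARD('d)"
    have W: "0 < W" using m by (simp add: W_def)
    have "(\<lambda>n. (2 * K + D) * (real (CARD('d) * m) / real n)) \<longlonglongrightarrow> 0"
      by (intro tendsto_mult_right_zero lim_const_over_n)
    then have "\<forall>\<^sub>F n in sequentially. (2 * K + D) * (real (CARD('d) * m) / real n) < \<epsilon> / 2"
      using \<open>0 < \<epsilon>\<close> by (intro order_tendstoD(2)) auto
    moreover have "\<forall>\<^sub>F n in sequentially. worst_deviation K D D' r' m n \<omega> < ereal (\<epsilon> / 2 * W)"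
      using dev[OF _ \<omega>, of m] m \<open>0 < \<epsilon>\<close> W by (intro order_tendstoD(2)) auto
    ultimately show ?thesis
      using eventually_ge_at_top[of m]
    proof eventually_elim
      case (elim n)
      show ?case
      proof
        fix E
        let ?e = "pairing (floc A f (inner_part r (cube m))) (empirical A r m n \<omega>) E"
        let ?p = "pairing (floc A f (inner_part r (cube m))) (marginal A P (inner_part r (cube m))) E"
        have "deviation A P r m n \<omega> f \<le> ereal (\<epsilon> / 2 * W)"
          using SUP_upper[OF f, of "deviation A P r m n \<omega>"] elim(2) by (metis less_imp_le order_trans)
        then have "\<bar>?e - ?p\<bar> \<le> \<epsilon> / 2 * W" unfolding deviation_def supnorm_le_iff by blast
        then have "\<bar>?e / W - ?p / W\<bar> \<le> \<epsilon> / 2"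
          using W by (simp add: diff_divide_distrib[symmetric] pos_divide_le_eq)
        moreover have "\<bar>g \<omega> n E - ?e / W\<bar> \<le> (2 * K + D) * (real (CARD('d) * m) / real n) + C / m"
          using field_average_minus_pairing_le[OF f GO[OF \<omega>] m elim(3) pos, of E]
          unfolding g_def W_def C_def .
        ultimately show "\<bar>g \<omega> n E - q m E\<bar> \<le> C / m + \<epsilon>"
          using elim(1) unfolding q_def W_def[symmetric] by linarith
      qed
    qed
  qed
  have c: "(\<lambda>m. C / real m) \<longlonglongrightarrow> 0" by (rule lim_const_over_n)
  have "G \<noteq> {}" using G(2) by auto
  then obtain \<omega>0 where \<omega>0: "\<omega>0 \<in> G" by blast
  have lim: "\<forall>\<epsilon>>0. \<forall>\<^sub>F n in sequentially. \<forall>E. \<bar>g \<omega> n E - F E\<bar> \<le> \<epsilon>" if "\<omega> \<in> G" for \<omega>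
    unfolding F_def by (intro allI impI uniform_limit_of_approximations(2)[OF approx[OF that] c])
  have "F \<in> BB"
  proof (rule BB_uniform_limit[OF _ lim[OF \<omega>0]])
    fix n
    show "g \<omega>0 n \<in> BB"
      unfolding g_def by (intro BB_divide admissible_BB[OF adm finite_cube GO[OF \<omega>0]])
  qed
  then have "fstar P f = F"
  proof (rule fstar_eqI[OF _ G])
    fix \<omega> assume "\<omega> \<in> G"
    from lim[OF this] show "(\<lambda>n. supnorm (\<lambda>E. f (cube n) \<omega> E / real (card (cube n :: (int ^ 'd) set)) - F E)) \<longlonglongrightarrow> 0"
      unfolding supnorm_tendsto_0_iff g_def card_cube of_nat_power .
  qed
  then show ?thesis
    using uniform_limit_of_approximations(1)[OF approx[OF \<omega>0] c m, of E]
    unfolding F_def q_def C_def by simp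
qed

lemma field_average_minus_fstar_le:
  fixes f :: "'d field_fun" and K D D' :: real
  assumes f: "f \<in> UU A K D D' r'" and pos: "0 < K" "0 < D" "0 < D'"
    and G: "G \<in> sets P" "prob G = 1"
    and dev: "\<And>m \<omega>. 1 \<le> m \<Longrightarrow> \<omega> \<in> G \<Longrightarrow>
      (\<lambda>n. worst_deviation K D D' r' m n \<omega>) \<longlonglongrightarrow> 0"
    and \<omega>: "\<omega> \<in> G" and m: "2 * m < n" "2 * r < m"
  shows "supnorm (\<lambda>E. f (cube n) \<omega> E / real (card (cube n :: (int ^ 'd) set)) - fstar P f E)
    \<le> ereal (2 ^ (2 * CARD('d) + 1) *
         (((2 * K + D) * real m ^ CARD('d) + D' * real r' ^ CARD('d)) / (real n - 2 * real m)
          + (2 * (K + D) * real r ^ CARD('d) + 3 * D' * real r' ^ CARD('d)) / (real m - 2 * real r)))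
      + deviation A P r m n \<omega> f / ereal (real (card (cube m :: (int ^ 'd) set)))"
    (is "_ \<le> ereal ?bound + _")
  unfolding supnorm_def
proof (rule SUP_least)
  fix E
  let ?e = "pairing (floc A f (inner_part r (cube m))) (empirical A r m n \<omega>) E"
  let ?p = "pairing (floc A f (inner_part r (cube m))) (marginal A P (inner_part r (cube m))) E"
  define W where "W = real m ^ CARD('d)"
  have W: "0 < W" using m by (simp add: W_def)
  define C where "C = (2 * (D' * 4 ^ CARD('d) * real r' ^ CARD('d)) + (K + D) * real (2 * CARD('d) * r)) / real m"
  have \<omega>': "\<omega> \<in> Omega A" using \<omega> G(1) sets.sets_into_space space_P by blast
  have "\<bar>f (cube n) \<omega> E / real n ^ CARD('d) - ?e / W\<bar> \<le> (2 * K + D) * (real (CARD('d) * m) / real n) + C"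
    using field_average_minus_pairing_le[OF f \<omega>' m(2) _ pos, of n E] m unfolding W_def C_def by simp
  moreover have "\<bar>fstar P f E - ?p / W\<bar> \<le> C"
    unfolding W_def C_def by (rule fstar_minus_marginal_pairing_le[OF f pos G dev m(2)])
  moreover have "(2 * K + D) * (real (CARD('d) * m) / real n) + 2 * C \<le> ?bound"
    unfolding C_def using pos m by (intro error_constants_le) (auto simp: Suc_le_eq)
  ultimately have "\<bar>f (cube n) \<omega> E / real n ^ CARD('d) - fstar P f E\<bar> \<le> ?bound + \<bar>?e / W - ?p / W\<bar>"
    by linarith
  also have "\<bar>?e / W - ?p / W\<bar> = \<bar>?e - ?p\<bar> / W"
    using W by (simp add: diff_divide_distrib[symmetric])
  finally have "ereal \<bar>f (cube n) \<omega> E / real n ^ CARD('d) - fstar P f E\<bar> \<le> ereal ?bound + ereal \<bar>?e - ?p\<bar> / ereal W"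
    using W by simp
  also have "\<dots> \<le> ereal ?bound + deviation A P r m n \<omega> f / ereal W"
  proof (intro add_left_mono ereal_divide_right_mono)
    show "ereal \<bar>?e - ?p\<bar> \<le> deviation A P r m n \<omega> f"
      unfolding deviation_def supnorm_def by (rule SUP_upper2[of E]) auto
  qed (use W in simp)
  finally show "ereal \<bar>f (cube n) \<omega> E / real (card (cube n :: (int ^ 'd) set)) - fstar P f E\<bar>
    \<le> ereal (?bound)
      + deviation A P r m n \<omega> f / ereal (real (card (cube m :: (int ^ 'd) set)))"
    unfolding W_def card_cube of_nat_power .
qed

end

theorem theorem2p8:
  fixes A :: "real set" and P :: "(int ^ 'd \<Rightarrow> real) measure"
    and \<mu> :: "int ^ 'd \<Rightarrow> real measure" and r :: nat
  assumes "prob_space P"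
    and "sets P = sets (cspace A UNIV)"
    and "M1 P" and "M2 A P \<mu>" and "M3 A P \<mu> r"
  shows
    "(\<forall>K D D' :: real. \<forall>r'::nat. 0 < K \<and> 0 < D \<and> 0 < D' \<and> 1 \<le> r' \<longrightarrow>
       (\<exists>G\<in>sets P. measure P G = 1 \<and>
          (\<forall>m n :: nat. \<forall>\<omega>\<in>G. 2 * m < n \<and> 4 * r < 2 * m \<longrightarrow>
             (SUP f\<in>UU A K D D' r'.
                supnorm (\<lambda>E. f (cube n) \<omega> E / real (card (cube n :: (int ^ 'd) set)) - fstar P f E))
             \<le> ereal (2 ^ (2 * CARD('d) + 1) *
                   (((2 * K + D) * real m ^ CARD('d) + D' * real r' ^ CARD('d))
                       / (real n - 2 * real m)
                    + (2 * (K + D) * real r ^ CARD('d) + 3 * D' * real r' ^ CARD('d))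
                       / (real m - 2 * real r)))
               + (SUP f\<in>UU A K D D' r'.
                    deviation A P r m n \<omega> f / ereal (real (card (cube m :: (int ^ 'd) set))))) \<and>
          (\<forall>m\<ge>1. \<forall>\<omega>\<in>G. (\<lambda>n. SUP f\<in>UU A K D D' r'. deviation A P r m n \<omega> f) \<longlonglongrightarrow> 0))) \<and>
     (\<forall>m\<ge>1. \<forall>\<epsilon>>0. \<forall>K>0. \<exists>a>0. \<exists>b::real.
       \<forall>D D' :: real. \<forall>r'::nat. 0 < D \<and> 0 < D' \<and> 1 \<le> r' \<longrightarrow>
         (\<forall>n\<ge>m. \<exists>G\<in>sets P.
            1 - b * exp (- a * real (n div m) ^ CARD('d)) \<le> measure P G \<and>
            (\<forall>\<omega>\<in>G. (SUP f\<in>UU A K D D' r'. deviation A P r m n \<omega> f) \<le> ereal \<epsilon>)))"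
proof -
  interpret coloring_process P A \<mu> r
    using assms by (simp add: coloring_process_def coloring_process_axioms_def)
  show ?thesis
  proof ((rule conjI; intro allI impI), goal_cases)
    case pos: (1 K D D' r')
    then have "0 < K" by simp
    from deviation_SUP_tendsto_0[OF this] obtain G where G: "G \<in> sets P" "prob G = 1"
      and dev0: "\<forall>D D' r'. 0 < D \<and> 0 < D' \<and> 1 \<le> r' \<longrightarrow> (\<forall>m\<ge>1. \<forall>\<omega>\<in>G.
        (\<lambda>n. worst_deviation K D D' r' m n \<omega>) \<longlonglongrightarrow> 0)"
      by (elim bexE conjE)
    have dev: "(\<lambda>n. worst_deviation K D D' r' m n \<omega>) \<longlonglongrightarrow> 0"
      if "1 \<le> m" "\<omega> \<in> G" for m \<omega>
      using dev0[rule_format, of D D' r' m \<omega>] pos that by simp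
    show ?case
    proof (rule bexI[OF _ G(1)], intro conjI allI ballI impI, goal_cases)
      case (2 m n \<omega>)
      then have "2 * m < n" "2 * r < m" "0 < K" "0 < D" "0 < D'" using pos by auto
      note bound = field_average_minus_fstar_le[OF _ this(3-5) G dev \<open>\<omega> \<in> G\<close> this(1,2)]
      show ?case
        by (rule SUP_least, rule order_trans[OF bound], assumption+, intro add_left_mono SUP_upper)
    qed (use G dev in auto)
  next
    case (2 m \<epsilon> K)
    from deviation_exponential[OF this] obtain a b where a: "0 < a" and ab: "\<forall>n\<ge>m. \<exists>G\<in>sets P.
        1 - b * exp (- a * real (n div m) ^ CARD('d)) \<le> prob G \<and>
        (\<forall>\<omega>\<in>G. \<forall>f :: 'd field_fun. admissible A f \<longrightarrow> Kf A f \<le> ereal K \<longrightarrow> deviation A P r m n \<omega> f \<le> ereal \<epsilon>)"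
      by (elim exE conjE)
    have large: "\<exists>G\<in>sets P. 1 - b * exp (- a * real (n div m) ^ CARD('d)) \<le> prob G \<and>
        (\<forall>\<omega>\<in>G. worst_deviation K D D' r' m n \<omega> \<le> ereal \<epsilon>)"
      if "m \<le> n" for n D D' r'
    proof -
      from ab[rule_format, OF that] obtain G where
        "G \<in> sets P" "1 - b * exp (- a * real (n div m) ^ CARD('d)) \<le> prob G"
        and small: "\<forall>\<omega>\<in>G. \<forall>f :: 'd field_fun. admissible A f \<longrightarrow> Kf A f \<le> ereal K \<longrightarrow> deviation A P r m n \<omega> f \<le> ereal \<epsilon>"
        by (elim bexE conjE)
      moreover have "worst_deviation K D D' r' m n \<omega> \<le> ereal \<epsilon>" if "\<omega> \<in> G" for \<omega>
        using small that by (intro SUP_least) (simp add: UU_def)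
      ultimately show ?thesis by blast
    qed
    show ?case
      by (rule exI[of _ a], rule conjI[OF a], rule exI[of _ b], intro allI impI, rule large)
  qed
qed

end
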